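(* Let $q$ be an odd prime, let $\zeta=\zeta_q=e^{2\pi i/q}$, $K=\mathbb{Q}(\zeta)$, and let $G=(\mathbb{Z}/q\mathbb{Z})^*/\{\pm1\}$, identified with a fixed set of representatives in $(\mathbb{Z}/q\mathbb{Z})^*$ containing $1$. For $j\in G$ let $\sigma_j:K\to\mathbb{C}$ be the embedding with $\sigma_j(\zeta)=\zeta^j$, and define $\operatorname{Log}:K^*\to\mathbb{R}^{G}$ by $\operatorname{Log}(a)=(\log|\sigma_j(a)|)_{j\in G}$. For $j\in G\setminus\{1\}$ let $b_j=\frac{\zeta^j-1}{\zeta-1}$ and $\mathbf{b}_j=\operatorname{Log}(b_j)\in\mathbb{R}^{G}$; these vectors are linearly independent and form a basis of the log-cyclotomic-unit lattice. Let $\{\mathbf{b}_j^\vee\}_{j\in G\setminus\{1\}}$ be the dual basis, i.e. the vectors in the real span of $\{\mathbf{b}_j\}_{j\in G\setminus\{1\}}$ satisfying $\langle\mathbf{b}_j^\vee,\mathbf{b}_{j'}\rangle=\delta_{j,j'}$ for all $j,j'\in G\setminus\{1\}$. Then all the norms $\lVert\mathbf{b}_j^\vee\rVert$ are equal, and moreover, assuming the Generalized Riemann Hypothesis, for every $\varepsilon>0$, \[\lVert\mathbf{b}_j^\vee\rVert^2=\frac{4\zeta(2)}{\zeta(4)}\cdot\frac{1}{q}\left(1+O\!\left(q^{-1+\varepsilon}\right)\right)\quad\text{as } q\to\infty \text{ through primes},\] where $\zeta(s)$ denotes the Riemann zeta function.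
   Context: $\langle\cdot,\cdot\rangle$ is the standard inner product on $\mathbb{R}^G$ and $\lVert\cdot\rVert$ the Euclidean norm. The Generalized Riemann Hypothesis (GRH) asserts that every nontrivial zero of every Dirichlet $L$-function $L(s,\chi)$ has real part $1/2$. The implied constant in the $O$-term may depend on $\varepsilon$. *)

theory Defs
  imports "HOL-Complex_Analysis.Complex_Analysis" "HOL-Computational_Algebra.Primes"
begin

definition rzeta :: "real \<Rightarrow> real" where
  "rzeta s = (\<Sum>n. 1 / (real (Suc n)) powr s)"

definition dirichlet_char :: "nat \<Rightarrow> (nat \<Rightarrow> complex) \<Rightarrow> bool" where
  "dirichlet_char k chi \<longleftrightarrow> k > 0 \<and> (\<forall>n. chi (n + k) = chi n) \<and>
     (\<forall>m n. chi (m * n) = chi m * chi n) \<and> chi 1 = 1 \<and>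
     (\<forall>n. chi n = 0 \<longleftrightarrow> \<not> coprime n k)"

definition GRH :: bool where
  "GRH \<longleftrightarrow> (\<forall>k chi f. dirichlet_char k chi \<and> f holomorphic_on (- {1}) \<and>
      (\<forall>s. Re s > 1 \<longrightarrow> f s = (\<Sum>n. chi (Suc n) / of_nat (Suc n) powr s)) \<longrightarrow>
      (\<forall>s. 0 < Re s \<and> Re s < 1 \<and> f s = 0 \<longrightarrow> Re s = 1 / 2))"

definition zq :: "nat \<Rightarrow> complex" where
  "zq q = cis (2 * pi / real q)"

text \<open>Set of representatives R \<subseteq> {1..q-1} of (Z/qZ)^*/{+-1} containing 1.\<close>
definition reps :: "nat \<Rightarrow> nat set \<Rightarrow> bool" where
  "reps q R \<longleftrightarrow> R \<subseteq> {1..<q} \<and> 1 \<in> R \<and> (\<forall>a\<in>{1..<q}. a \<in> R \<longleftrightarrow> q - a \<notin> R)"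

text \<open>sigma_k(b_j) = (zeta^(jk) - 1)/(zeta^k - 1), where b_j = (zeta^j-1)/(zeta-1).\<close>
definition sigma_b :: "nat \<Rightarrow> nat \<Rightarrow> nat \<Rightarrow> complex" where
  "sigma_b q j k = (zq q ^ (j * k) - 1) / (zq q ^ k - 1)"

text \<open>The vector Log(b_j) in R^G, G identified with R (zero outside R).\<close>
definition logb :: "nat \<Rightarrow> nat set \<Rightarrow> nat \<Rightarrow> nat \<Rightarrow> real" where
  "logb q R j = (\<lambda>k. if k \<in> R then ln (cmod (sigma_b q j k)) else 0)"

definition innerG :: "nat set \<Rightarrow> (nat \<Rightarrow> real) \<Rightarrow> (nat \<Rightarrow> real) \<Rightarrow> real" where
  "innerG R x y = (\<Sum>k\<in>R. x k * y k)"

definition dual_basis :: "nat \<Rightarrow> nat set \<Rightarrow> (nat \<Rightarrow> nat \<Rightarrow> real) \<Rightarrow> bool" where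
  "dual_basis q R v \<longleftrightarrow>
     (\<forall>j\<in>R - {1}. \<exists>c. \<forall>k. v j k = (\<Sum>j'\<in>R - {1}. c j' * logb q R j' k)) \<and>
     (\<forall>j\<in>R - {1}. \<forall>j'\<in>R - {1}. innerG R (v j) (logb q R j') = (if j = j' then 1 else 0))"

end

theory Submission
  imports Defs "HOL-Computational_Algebra.Squarefree" "HOL-Number_Theory.Residue_Primitive_Roots"
begin

text \<open>
  Put \<open>f k = ln \<bar>1 - \<zeta>\<^sup>k\<bar>\<close>. The vectors \<open>b\<^sub>j\<close> are the differences of the translates of \<open>f\<close> by
  \<open>j\<close> and by \<open>1\<close>, so on the cyclic group \<open>G\<close> of order \<open>n = (q - 1) / 2\<close> the dual basis consists of
  the translates of a single function, whose Fourier coefficients are the conjugate reciprocals of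
  those of \<open>f\<close>. Hence all norms agree, and by the Gauss sum evaluation of the Fourier coefficients
  their square is \<open>4 / (q n)\<close> times the sum of \<open>\<bar>L(1,\<chi>)\<bar> powr - 2\<close> over the nontrivial even characters.

  Nonvanishing of \<open>L(1 + it, \<chi>)\<close>: with \<open>g = 1 * \<chi> n powr - it\<close>, Ramanujan's identity expresses
  \<open>\<Sum>\<bar>g n\<bar>\<^sup>2 n powr - s\<close> through \<open>\<zeta>\<close> and \<open>L\<close>; a zero would make this series with nonnegative coefficients
  continue to \<open>Re s > 1/2\<close> and tend to \<open>0\<close> at \<open>1/2\<close>, which its Taylor expansion at \<open>2\<close> forbids.

  Under GRH, \<open>1 / L\<close> is holomorphic in \<open>\<bar>s - 2\<bar> < 3/2\<close>, and by the Borel-Caratheodory inequality it is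
  bounded by a power of \<open>q\<close> in \<open>\<bar>s - 2\<bar> \<le> 5/4\<close>. So \<open>O(log q)\<close> terms of the Taylor series at \<open>2\<close> determine
  \<open>1 / L(1,\<chi>)\<close> up to a negative power of \<open>q\<close>, and they form a smoothly weighted sum of
  \<open>\<mu>(m) \<chi>(m) / m\<close>. Its mean square over the even characters is computed by Parseval's identity;
  the diagonal yields \<open>\<Sum>\<mu>(m)\<^sup>2 / m\<^sup>2 = \<zeta>(2) / \<zeta>(4)\<close>.
\<close>

section \<open>Dirichlet series of periodic sequences and their continuation\<close>

text \<open>\<open>GRH\<close> speaks only about functions that continue a character series to the
  plane minus 1, so such a continuation must be built before the hypothesis says anything. It is
  silent on the line \<open>Re s = 1\<close>, which meets every disc used below, so that line needs
  an unconditional argument. The other obstacle is uniformity in the character. Borel-Caratheodory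
  acts on the logarithm, so a bound for L that is linear in q already yields a polynomial bound for
  1/L. The radii 5/4 < 11/8 < 3/2 are nested for this: L does not vanish within 3/2, is bounded
  within 11/8, its reciprocal is bounded within 5/4, and 5/4 > 1 makes the Taylor terms at 1 decay
  like (4/5)^k. Truncation after K terms puts a smooth weight on the Moebius series. For any y < 1
  the l1 norm of the weighted series is at most a constant times y^-K; with K of order log q this is
  a power of q whose exponent tends to 0 as y tends to 1. That is the origin of \<epsilon>.\<close>

lemma summable_Suc_powr:
  assumes "\<sigma> > 1"
  shows "summable (\<lambda>n. real (Suc n) powr - \<sigma>)"
proof -
  have "summable (\<lambda>n. real n powr - \<sigma>)"
    using assms by (simp add: summable_real_powr_iff)
  then show ?thesis by (subst summable_Suc_iff)
qed

text \<open>Local majorants give locally uniform convergence, hence holomorphy and termwise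
  differentiation to all orders. The second conclusion later turns Dirichlet coefficients into
  Taylor coefficients at 2.\<close>

lemma
  assumes S: "open S" and hol: "\<And>n. f n holomorphic_on S"
    and dom: "\<And>x. x \<in> S \<Longrightarrow> \<exists>d>0. \<exists>M. summable M \<and> cball x d \<subseteq> S \<and> (\<forall>n. \<forall>z\<in>cball x d. cmod (f n z) \<le> M n)"
  shows holomorphic_suminf: "(\<lambda>z. \<Sum>n. f n z) holomorphic_on S"
    and higher_deriv_suminf: "x \<in> S \<Longrightarrow> (\<lambda>n. (deriv ^^ k) (f n) x) sums (deriv ^^ k) (\<lambda>z. \<Sum>n. f n z) x"
proof -
  have ul: "\<exists>d>0. cball x d \<subseteq> S \<and> uniform_limit (cball x d) (\<lambda>N z. \<Sum>n<N. f n z) (\<lambda>z. \<Sum>n. f n z) sequentially"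
    if x: "x \<in> S" for x
  proof -
    obtain d M where d: "d > 0" "summable M" "cball x d \<subseteq> S" "\<forall>n. \<forall>z\<in>cball x d. cmod (f n z) \<le> M n"
      using dom[OF x] by blast
    have "uniform_limit (cball x d) (\<lambda>N z. \<Sum>n<N. f n z) (\<lambda>z. \<Sum>n. f n z) sequentially"
      by (rule Weierstrass_m_test) (use d in auto)
    then show ?thesis using d by blast
  qed
  have holp: "(\<lambda>z. \<Sum>n<N. f n z) holomorphic_on S" for N
    by (intro holomorphic_intros hol)
  show "(\<lambda>z. \<Sum>n. f n z) holomorphic_on S"
    by (rule holomorphic_uniform_sequence[OF S holp ul])
  assume x: "x \<in> S"
  obtain d where d: "d > 0" "cball x d \<subseteq> S"
    and u: "uniform_limit (cball x d) (\<lambda>N z. \<Sum>n<N. f n z) (\<lambda>z. \<Sum>n. f n z) sequentially"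
    using ul[OF x] by blast
  have "(\<lambda>N. (deriv ^^ k) (\<lambda>z. \<Sum>n<N. f n z) x) \<longlonglongrightarrow> (deriv ^^ k) (\<lambda>z. \<Sum>n. f n z) x"
  proof (rule higher_deriv_complex_uniform_limit)
    show "uniform_limit (ball x d) (\<lambda>N z. \<Sum>n<N. f n z) (\<lambda>z. \<Sum>n. f n z) sequentially"
      by (rule uniform_limit_on_subset[OF u]) auto
    show "\<forall>\<^sub>F N in sequentially. (\<lambda>z. \<Sum>n<N. f n z) holomorphic_on ball x d"
      using holp d by (intro always_eventually allI) (meson ball_subset_cball holomorphic_on_subset order_trans)
  qed (use d in auto)
  moreover have "(deriv ^^ k) (\<lambda>z. \<Sum>n<N. f n z) x = (\<Sum>n<N. (deriv ^^ k) (f n) x)" for N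
  proof (induction N)
    case (Suc N)
    have "(deriv ^^ k) (\<lambda>z. (\<Sum>n<N. f n z) + f N z) x = (deriv ^^ k) (\<lambda>z. \<Sum>n<N. f n z) x + (deriv ^^ k) (f N) x"
      by (rule higher_deriv_add[OF holp hol S x])
    then show ?case using Suc by simp
  qed (simp add: higher_deriv_const)
  ultimately show "(\<lambda>n. (deriv ^^ k) (f n) x) sums (deriv ^^ k) (\<lambda>z. \<Sum>n. f n z) x"
    by (simp add: sums_def)
qed

text \<open>Up to the sign (-1)^k this is the k-th forward difference of \<open>x powr -s\<close>.
  Each difference gains one power of x, which drives the continuation.\<close>

fun dlt :: "nat \<Rightarrow> complex \<Rightarrow> real \<Rightarrow> complex" where
  "dlt 0 s x = of_real x powr (-s)"
| "dlt (Suc k) s x = dlt k s x - dlt k s (x + 1)"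

lemma dlt_has_derivative:
  "x > 0 \<Longrightarrow> (dlt k s has_vector_derivative - s * dlt k (s + 1) x) (at x)"
proof (induction k arbitrary: x)
  case 0
  have "((\<lambda>z. z powr (-s)) has_field_derivative (-s) * of_real x powr (-s - 1)) (at (of_real x))"
    using 0 by (intro has_field_derivative_powr) (auto simp: complex_nonpos_Reals_iff)
  from field_vector_diff_chain_at[OF has_vector_derivative_of_real[OF DERIV_ident] this]
  show ?case by (simp add: o_def)
next
  case (Suc k)
  have "((dlt k s \<circ> (\<lambda>x. x + 1)) has_vector_derivative 1 *\<^sub>R (- s * dlt k (s + 1) (x + 1))) (at x)"
    using Suc.prems by (intro vector_diff_chain_at Suc.IH) (auto intro!: derivative_eq_intros)
  from has_vector_derivative_diff[OF Suc.IH[OF Suc.prems] this]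
  show ?case by (simp add: o_def algebra_simps)
qed

lemma dlt_holomorphic: "x > 0 \<Longrightarrow> (\<lambda>s. dlt k s x) holomorphic_on S"
  by (induction k arbitrary: x) (auto intro!: holomorphic_intros)

lemma norm_of_real_powr: "x > 0 \<Longrightarrow> cmod (of_real x powr s) = x powr Re s"
  by (subst norm_powr_real_powr) auto

text \<open>A difference is bounded by the derivative on \<open>{x..x+1}\<close>, and
  differentiating \<open>dlt k s\<close> gives \<open>-s\<close> times \<open>dlt k (s + 1)\<close>.
  The induction therefore runs over varying s and collects the modulus of the rising factorial
  s(s+1)...(s+k-1).\<close>

lemma dlt_bound:
  assumes "x > 0" "Re s + real k \<ge> 0"
  shows "cmod (dlt k s x) \<le> (\<Prod>i<k. cmod (s + of_nat i)) * x powr - (Re s + real k)"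
  using assms
proof (induction k arbitrary: s x)
  case 0
  then show ?case by (simp add: norm_of_real_powr)
next
  case (Suc k)
  let ?B = "cmod s * ((\<Prod>i<k. cmod (s + 1 + of_nat i)) * x powr - (Re (s + 1) + real k))"
  have "cmod (dlt k s x - dlt k s (x + 1)) \<le> ?B * cmod (complex_of_real 1)"
  proof -
    have "norm (dlt k s x - dlt k s (x + 1)) \<le> ?B * norm (x - (x + 1))"
    proof (rule differentiable_bound)
      show "convex {x..x+1}" by simp
      fix y assume y: "y \<in> {x..x+1}"
      then have y0: "y > 0" using Suc.prems by auto
      show "(dlt k s has_derivative (\<lambda>h. h *\<^sub>R (- s * dlt k (s + 1) y))) (at y within {x..x+1})"
        using dlt_has_derivative[OF y0, of k s]
        by (auto simp: has_vector_derivative_def intro: has_derivative_at_withinI)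
      have "cmod (dlt k (s+1) y) \<le> (\<Prod>i<k. cmod (s + 1 + of_nat i)) * y powr - (Re (s + 1) + real k)"
        by (rule Suc.IH) (use y0 Suc.prems in auto)
      also have "\<dots> \<le> (\<Prod>i<k. cmod (s + 1 + of_nat i)) * x powr - (Re (s + 1) + real k)"
        by (intro mult_left_mono powr_mono2' prod_nonneg) (use y Suc.prems in auto)
      finally have b: "cmod (dlt k (s+1) y) \<le> (\<Prod>i<k. cmod (s + 1 + of_nat i)) * x powr - (Re (s + 1) + real k)" .
      show "onorm (\<lambda>h. h *\<^sub>R (- s * dlt k (s + 1) y)) \<le> ?B"
      proof (rule onorm_le)
        fix h :: real
        have "norm (h *\<^sub>R (- s * dlt k (s + 1) y)) = cmod s * cmod (dlt k (s+1) y) * norm h"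
          by (simp add: norm_mult)
        also have "\<dots> \<le> ?B * norm h" by (intro mult_right_mono mult_left_mono b) auto
        finally show "norm (h *\<^sub>R (- s * dlt k (s + 1) y)) \<le> ?B * norm h" .
      qed
    qed auto
    then show ?thesis by simp
  qed
  moreover have "(\<Prod>i<Suc k. cmod (s + of_nat i)) = cmod s * (\<Prod>i<k. cmod (s + 1 + of_nat i))"
    by (subst prod.lessThan_Suc_shift) (simp add: algebra_simps)
  ultimately show ?case by (simp add: algebra_simps)
qed

definition dser :: "nat \<Rightarrow> (nat \<Rightarrow> complex) \<Rightarrow> complex \<Rightarrow> complex" where
  "dser k H s = (\<Sum>n. H n * dlt k s (real (Suc n)))"

lemma dser_term_bound:
  assumes "\<And>n. cmod (H n) \<le> B" "Re s + real k \<ge> \<sigma>" "\<sigma> \<ge> 0" "cmod s \<le> R"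
  shows "cmod (H n * dlt k s (real (Suc n))) \<le> B * (\<Prod>i<k. R + real i) * real (Suc n) powr - \<sigma>"
proof -
  have "cmod (dlt k s (real (Suc n))) \<le> (\<Prod>i<k. cmod (s + of_nat i)) * real (Suc n) powr - (Re s + real k)"
    by (rule dlt_bound) (use assms in auto)
  also have "\<dots> \<le> (\<Prod>i<k. R + real i) * real (Suc n) powr - \<sigma>"
  proof (intro mult_mono prod_mono conjI)
    fix i
    show "cmod (s + of_nat i) \<le> R + real i"
      using norm_triangle_ineq[of s "of_nat i"] assms(4) by simp
    show "real (Suc n) powr - (Re s + real k) \<le> real (Suc n) powr - \<sigma>"
      by (rule powr_mono) (use assms in auto)
  next
    have "R \<ge> 0" using assms(4) norm_ge_zero order_trans by blast
    then show "0 \<le> (\<Prod>i<k. R + real i)" by (intro prod_nonneg) auto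
  qed auto
  finally have "cmod (dlt k s (real (Suc n))) \<le> (\<Prod>i<k. R + real i) * real (Suc n) powr - \<sigma>" .
  moreover have "B \<ge> 0" using assms(1)[of 0] norm_ge_zero order_trans by blast
  ultimately have "cmod (H n) * cmod (dlt k s (real (Suc n))) \<le> B * ((\<Prod>i<k. R + real i) * real (Suc n) powr - \<sigma>)"
    by (intro mult_mono assms(1)) auto
  then show ?thesis by (simp add: norm_mult mult.assoc)
qed

lemma halfplane_open: "open {s. Re s > c}"
  by (simp add: open_halfspace_Re_gt)

lemma dser_dom:
  assumes "\<And>n. cmod (H n) \<le> B" and x: "Re x > 1 - real k"
  shows "\<exists>d>0. \<exists>M. summable M \<and> cball x d \<subseteq> {s. Re s > 1 - real k} \<and>
     (\<forall>n. \<forall>z\<in>cball x d. cmod (H n * dlt k z (real (Suc n))) \<le> M n)"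
proof -
  define d where "d = (Re x - (1 - real k)) / 2"
  define M where "M n = B * (\<Prod>i<k. (cmod x + d) + real i) * real (Suc n) powr - (1 + d)" for n
  have d: "d > 0" using x by (simp add: d_def)
  have re: "Re z \<ge> Re x - d" "cmod z \<le> cmod x + d" if "z \<in> cball x d" for z
  proof -
    have *: "cmod (x - z) \<le> d" using that by (simp add: dist_norm)
    then show "Re z \<ge> Re x - d" using abs_Re_le_cmod[of "x - z"] by simp
    show "cmod z \<le> cmod x + d" using * norm_triangle_ineq3[of x z] by linarith
  qed
  have "summable M" unfolding M_def by (intro summable_mult summable_Suc_powr) (use d in auto)
  moreover have "cball x d \<subseteq> {s. Re s > 1 - real k}"
  proof
    fix z assume "z \<in> cball x d"
    from re(1)[OF this] x show "z \<in> {s. Re s > 1 - real k}" by (simp add: d_def field_simps)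
  qed
  moreover have "cmod (H n * dlt k z (real (Suc n))) \<le> M n" if z: "z \<in> cball x d" for n z
    unfolding M_def
    by (rule dser_term_bound[OF assms(1)]) (use re[OF z] d in \<open>auto simp: d_def field_simps\<close>)
  ultimately show ?thesis using d by blast
qed

lemma dser_holomorphic:
  assumes "\<And>n. cmod (H n) \<le> B"
  shows "dser k H holomorphic_on {s. Re s > 1 - real k}"
  unfolding dser_def
  by (rule holomorphic_suminf[OF halfplane_open])
     (use dser_dom[OF assms] in \<open>auto intro!: holomorphic_intros dlt_holomorphic\<close>)

lemma dser_sums:
  assumes "\<And>n. cmod (H n) \<le> B" "Re s > 1 - real k"
  shows "(\<lambda>n. H n * dlt k s (real (Suc n))) sums dser k H s"
proof -
  obtain d M where "d > 0" and M: "summable M"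
    and le: "\<forall>n. \<forall>z\<in>cball s d. cmod (H n * dlt k z (real (Suc n))) \<le> M n"
    using dser_dom[where H=H and B=B and x=s and k=k, OF assms] by (elim exE conjE)
  then have "s \<in> cball s d" by simp
  then have "cmod (H n * dlt k s (real (Suc n))) \<le> M n" for n
    using le by blast
  then have "summable (\<lambda>n. H n * dlt k s (real (Suc n)))"
    by (intro summable_comparison_test[OF _ M] exI[of _ 0] allI impI)
  then show ?thesis unfolding dser_def by (rule summable_sums)
qed

text \<open>Repeated Abel summation for periodic coefficients of mean zero: replacing the coefficients by
  their partial sums, recentred to mean zero, trades one power of decay against a difference
  of \<open>n powr - s\<close>, so the Dirichlet series continues one unit further to the left each time.\<close>

definition mz_periodic :: "nat \<Rightarrow> (nat \<Rightarrow> complex) \<Rightarrow> bool" where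
  "mz_periodic q H \<longleftrightarrow> q > 0 \<and> (\<forall>n. H (n + q) = H n) \<and> (\<Sum>j<q. H j) = 0"

definition psum :: "(nat \<Rightarrow> complex) \<Rightarrow> nat \<Rightarrow> complex" where
  "psum H n = (\<Sum>j\<le>n. H j)"

definition pmean :: "nat \<Rightarrow> (nat \<Rightarrow> complex) \<Rightarrow> complex" where
  "pmean q H = (\<Sum>j<q. psum H j) / of_nat q"

primrec Hs :: "nat \<Rightarrow> (nat \<Rightarrow> complex) \<Rightarrow> nat \<Rightarrow> nat \<Rightarrow> complex" where
  "Hs q h 0 = h"
| "Hs q h (Suc k) = (\<lambda>n. psum (Hs q h k) n - pmean q (Hs q h k))"

lemma psum_periodic:
  assumes "mz_periodic q H"
  shows "psum H (n + q) = psum H n"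
proof (induction n)
  case 0
  from assms have "H (0 + q) = H 0" unfolding mz_periodic_def by blast
  with assms have q: "q > 0" "H q = H 0" "(\<Sum>j<q. H j) = 0"
    by (auto simp: mz_periodic_def)
  have "psum H q = (\<Sum>j<q. H j) + H q"
    by (simp add: psum_def lessThan_Suc_atMost[symmetric])
  with q show ?case by (simp add: psum_def)
next
  case (Suc n)
  have "H (Suc n + q) = H (Suc n)" using assms unfolding mz_periodic_def by blast
  then show ?case using Suc by (simp add: psum_def)
qed

lemma mz_periodic_step:
  assumes "mz_periodic q H"
  shows "mz_periodic q (\<lambda>n. psum H n - pmean q H)"
proof -
  have "q > 0" using assms by (simp add: mz_periodic_def)
  then show ?thesis
    unfolding mz_periodic_def using psum_periodic[OF assms] by (simp add: pmean_def sum_subtractf)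
qed

lemma mz_periodic_Hs: "mz_periodic q h \<Longrightarrow> mz_periodic q (Hs q h k)"
  by (induction k) (simp_all add: mz_periodic_step)

lemma periodic_mod:
  fixes H :: "nat \<Rightarrow> 'a"
  assumes "\<And>n. H (n + q) = H n"
  shows "H (n mod q) = H n"
proof -
  have "H (m + q * k) = H m" for m k
  proof (induction k)
    case (Suc k)
    have "H (m + q * Suc k) = H ((m + q * k) + q)" by (simp add: add_ac)
    then show ?case using assms Suc by simp
  qed simp
  from this[of "n mod q" "n div q"] show ?thesis by simp
qed

lemma mz_periodic_bound:
  assumes "mz_periodic q H"
  obtains B where "\<And>n. cmod (H n) \<le> B"
proof -
  have "cmod (H n) \<le> (\<Sum>j<q. cmod (H j))" for n
  proof -
    have "cmod (H n) = cmod (H (n mod q))"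
      using periodic_mod[of H q n] assms by (simp add: mz_periodic_def)
    also have "\<dots> \<le> (\<Sum>j<q. cmod (H j))"
      by (rule member_le_sum) (use assms in \<open>auto simp: mz_periodic_def\<close>)
    finally show ?thesis .
  qed
  then show ?thesis using that by blast
qed

text \<open>Summation by parts with the partial sums shifted by an arbitrary constant: the
  differences of \<open>\<phi>\<close> telescope, which leaves \<open>c * \<phi> 0\<close>. The
  continuation takes the mean for c, Abel's limit theorem takes 0.\<close>

lemma abel_step:
  fixes \<phi> :: "nat \<Rightarrow> complex" and c :: complex
  defines "H' \<equiv> (\<lambda>H n. psum H n - c)"
  shows "(\<Sum>n\<le>N. H n * \<phi> n) = c * \<phi> 0 + (\<Sum>n<N. H' H n * (\<phi> n - \<phi> (Suc n))) + H' H N * \<phi> N"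
  by (induction N) (simp_all add: H'_def psum_def algebra_simps)

lemma dlt_tendsto_0:
  assumes "Re s + real k > 0" "\<And>n. cmod (H n) \<le> B"
  shows "(\<lambda>n. H n * dlt k s (real (Suc n))) \<longlonglongrightarrow> 0"
proof (rule Lim_null_comparison)
  show "\<forall>\<^sub>F n in sequentially. cmod (H n * dlt k s (real (Suc n))) \<le>
      B * (\<Prod>i<k. cmod s + real i) * real (Suc n) powr - (Re s + real k)"
    by (intro always_eventually allI dser_term_bound assms) (use assms in auto)
  have "(\<lambda>n. real (Suc n) powr - (Re s + real k)) \<longlonglongrightarrow> 0"
    by (rule LIMSEQ_Suc) (intro tendsto_neg_powr assms filterlim_real_sequentially, use assms in auto)
  from tendsto_mult_right_zero[OF this]
  show "(\<lambda>n. B * (\<Prod>i<k. cmod s + real i) * real (Suc n) powr - (Re s + real k)) \<longlonglongrightarrow> 0" .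
qed

text \<open>Majorants for order k exist when \<open>Re s > 1 - real k\<close>. One more summation by
  parts, whose boundary term tends to 0, gives convergence and a formula for the sum one unit
  further left.\<close>

lemma dser_step_sums:
  assumes mz: "mz_periodic q h" and s: "Re s + real k > 0"
  shows "(\<lambda>n. Hs q h k n * dlt k s (real (Suc n))) sums
     (pmean q (Hs q h k) * dlt k s 1 + dser (Suc k) (Hs q h (Suc k)) s)"
proof -
  obtain B where B: "\<And>n. cmod (Hs q h (Suc k) n) \<le> B"
    using mz_periodic_bound[OF mz_periodic_Hs[OF mz]] by blast
  have 1: "(\<lambda>n. Hs q h (Suc k) n * dlt (Suc k) s (real (Suc n))) sums dser (Suc k) (Hs q h (Suc k)) s"
    by (rule dser_sums[OF B]) (use s in auto)
  have 2: "(\<lambda>n. Hs q h (Suc k) n * dlt k s (real (Suc n))) \<longlonglongrightarrow> 0"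
    by (rule dlt_tendsto_0[OF s B])
  have "(\<lambda>N. pmean q (Hs q h k) * dlt k s 1 + (\<Sum>n<N. Hs q h (Suc k) n * dlt (Suc k) s (real (Suc n)))
       + Hs q h (Suc k) N * dlt k s (real (Suc N)))
     \<longlonglongrightarrow> pmean q (Hs q h k) * dlt k s 1 + dser (Suc k) (Hs q h (Suc k)) s + 0"
    by (intro tendsto_add tendsto_const 2) (use 1 in \<open>simp add: sums_def\<close>)
  moreover have "(\<Sum>n\<le>N. Hs q h k n * dlt k s (real (Suc n))) = pmean q (Hs q h k) * dlt k s 1
       + (\<Sum>n<N. Hs q h (Suc k) n * dlt (Suc k) s (real (Suc n))) + Hs q h (Suc k) N * dlt k s (real (Suc N))" for N
    using abel_step[of "Hs q h k" "\<lambda>n. dlt k s (real (Suc n))" N "pmean q (Hs q h k)"]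
    by (simp add: add_ac)
  ultimately show ?thesis by (simp add: sums_def_le)
qed

definition Lpart :: "nat \<Rightarrow> (nat \<Rightarrow> complex) \<Rightarrow> nat \<Rightarrow> complex \<Rightarrow> complex" where
  "Lpart q h k s = (\<Sum>i<k. pmean q (Hs q h i) * dlt i s 1) + dser k (Hs q h k) s"

text \<open>\<open>nat \<lfloor>2 - Re s\<rfloor>\<close> is a number k with
  \<open>Re s > 1 - real k\<close>, so \<open>Lpart\<close> of that order is meaningful at s; any
  larger order gives the same value.\<close>

definition Lent :: "nat \<Rightarrow> (nat \<Rightarrow> complex) \<Rightarrow> complex \<Rightarrow> complex" where
  "Lent q h s = Lpart q h (nat \<lfloor>2 - Re s\<rfloor>) s"

section \<open>Well-definedness, holomorphy and growth of the continuation\<close>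

context
  fixes q :: nat and h :: "nat \<Rightarrow> complex" assumes mz: "mz_periodic q h"
begin

lemma Lpart_Suc:
  assumes "Re s > 1 - real k"
  shows "Lpart q h (Suc k) s = Lpart q h k s"
proof -
  obtain B where B: "\<And>n. cmod (Hs q h k n) \<le> B"
    using mz_periodic_bound[OF mz_periodic_Hs[OF mz]] by blast
  have "dser k (Hs q h k) s = pmean q (Hs q h k) * dlt k s 1 + dser (Suc k) (Hs q h (Suc k)) s"
    by (rule sums_unique2[OF dser_sums[OF B assms] dser_step_sums[OF mz]]) (use assms in auto)
  then show ?thesis by (simp add: Lpart_def)
qed

lemma Lpart_mono:
  assumes "Re s > 1 - real k" "k \<le> l"
  shows "Lpart q h l s = Lpart q h k s"
  using assms(2)
proof (induction l rule: dec_induct)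
  case (step m)
  then show ?case using Lpart_Suc[of m s] assms(1) by simp
qed simp

lemma Lent_eq_Lpart:
  assumes "Re s > 1 - real k"
  shows "Lent q h s = Lpart q h k s"
proof -
  let ?m = "nat \<lfloor>2 - Re s\<rfloor>"
  have "2 - Re s < real_of_int \<lfloor>2 - Re s\<rfloor> + 1" by linarith
  then have m: "Re s > 1 - real ?m" by linarith
  show ?thesis
    using Lpart_mono[OF m, of k] Lpart_mono[OF assms, of ?m] by (cases "?m \<le> k") (auto simp: Lent_def)
qed

lemma Lpart_holomorphic: "Lpart q h k holomorphic_on {s. Re s > 1 - real k}"
proof -
  obtain B where B: "\<And>n. cmod (Hs q h k n) \<le> B"
    using mz_periodic_bound[OF mz_periodic_Hs[OF mz]] by blast
  show ?thesis
    unfolding Lpart_def by (intro holomorphic_intros dlt_holomorphic dser_holomorphic[OF B]) auto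
qed

lemma Lent_holomorphic: "Lent q h holomorphic_on S"
proof -
  have "Lent q h field_differentiable at s" for s
  proof -
    obtain k :: nat where k: "real k > 1 - Re s" using reals_Archimedean2 by blast
    have "Lent q h holomorphic_on {s. Re s > 1 - real k}"
      by (rule holomorphic_transform[OF Lpart_holomorphic]) (simp add: Lent_eq_Lpart)
    then show ?thesis
      using holomorphic_on_imp_differentiable_at[OF _ halfplane_open] k by auto
  qed
  then show ?thesis by (meson field_differentiable_at_within holomorphic_on_def)
qed

lemma Lent_sums:
  assumes "Re s > 0"
  shows "(\<lambda>n. h n * of_nat (Suc n) powr - s) sums Lent q h s"
proof -
  have "Lent q h s = Lpart q h 1 s" by (rule Lent_eq_Lpart) (use assms in auto)
  then show ?thesis
    using dser_step_sums[OF mz, of s 0] assms by (simp add: Lpart_def)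
qed

text \<open>A partial sum of a mean-zero periodic sequence reduces to one over at most a period, so
  after one summation by parts the coefficients are at most 2q. Linear growth in q suffices, as only
  its logarithm enters the estimate of 1/L.\<close>

lemma Lent_bound:
  assumes h: "\<And>n. cmod (h n) \<le> 1" and s: "Re s \<ge> \<sigma>" "\<sigma> > 0" "cmod s \<le> R"
  shows "cmod (Lent q h s) \<le> real q * (1 + 2 * R * (\<Sum>n. real (Suc n) powr - (1 + \<sigma>)))"
proof -
  have q: "q > 0" using mz by (simp add: mz_periodic_def)
  have p: "cmod (psum h n) \<le> real q" for n :: nat
  proof -
    have "psum h n = psum h (n mod q)" by (rule periodic_mod[symmetric]) (rule psum_periodic[OF mz])
    also have "cmod \<dots> \<le> (\<Sum>j\<le>n mod q. 1)" unfolding psum_def by (rule sum_norm_le) (rule h)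
    also have "\<dots> = real (Suc (n mod q))" by simp
    also have "\<dots> \<le> real q" using q by (metis mod_less_divisor of_nat_le_iff Suc_leI)
    finally show ?thesis .
  qed
  have "cmod (\<Sum>j<q. psum h j) \<le> (\<Sum>j<q. real q)" by (rule sum_norm_le) (rule p)
  then have c: "cmod (pmean q h) \<le> real q"
    using q by (simp add: pmean_def norm_divide divide_le_eq)
  have H: "cmod (Hs q h 1 n) \<le> 2 * real q" for n
    using p[of n] c norm_triangle_ineq4[of "psum h n" "pmean q h"] by simp
  have R: "R \<ge> 0" using s(3) norm_ge_zero order_trans by blast
  have b: "cmod (Hs q h 1 n * dlt 1 s (real (Suc n))) \<le> 2 * real q * R * real (Suc n) powr - (1 + \<sigma>)" for n
    using dser_term_bound[where H="Hs q h 1" and k=1, OF H, of "1+\<sigma>" s R n] s by simp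
  have sm: "summable (\<lambda>n. 2 * real q * R * real (Suc n) powr - (1 + \<sigma>))"
    by (intro summable_mult summable_Suc_powr) (use s in auto)
  have "cmod (dser 1 (Hs q h 1) s) \<le> (\<Sum>n. 2 * real q * R * real (Suc n) powr - (1 + \<sigma>))"
    unfolding dser_def by (rule norm_suminf_le[OF _ sm]) (rule b)
  also have "\<dots> = 2 * real q * R * (\<Sum>n. real (Suc n) powr - (1 + \<sigma>))"
    by (rule suminf_mult, rule summable_Suc_powr) (use s in auto)
  finally have d: "cmod (dser 1 (Hs q h 1) s) \<le> 2 * real q * R * (\<Sum>n. real (Suc n) powr - (1 + \<sigma>))" .
  have "Lent q h s = Lpart q h 1 s" by (rule Lent_eq_Lpart) (use s in auto)
  also have "\<dots> = pmean q h + dser 1 (Hs q h 1) s" by (simp add: Lpart_def)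
  finally have "cmod (Lent q h s) \<le> cmod (pmean q h) + cmod (dser 1 (Hs q h 1) s)"
    using norm_triangle_ineq by metis
  with c d show ?thesis by (simp add: algebra_simps)
qed

end

text \<open>The function \<open>(s - 1) \<zeta>(s)\<close> on \<open>Re s > 0\<close>, obtained by comparing \<open>\<zeta>\<close> with the integral of \<open>x powr - s\<close>.\<close>

definition zdiff :: "complex \<Rightarrow> real \<Rightarrow> complex" where
  "zdiff s x = (s - 1) * dlt 0 s x - dlt 1 (s - 1) x"

definition zt :: "complex \<Rightarrow> complex" where
  "zt s = 1 + (\<Sum>n. zdiff s (real (Suc n)))"

lemma zdiff_bound:
  assumes x: "x > 0" and s: "Re s \<ge> \<sigma>" "\<sigma> \<ge> 0" "cmod s \<le> R" "x \<ge> 1"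
  shows "cmod (zdiff s x) \<le> (R + 1) * R * x powr - (1 + \<sigma>)"
proof -
  have R: "R \<ge> 0" using s(3) norm_ge_zero order_trans by blast
  have s1: "cmod (s - 1) \<le> R + 1" using norm_triangle_ineq4[of s 1] s by simp
  define B where "B = R * x powr - (1 + \<sigma>)"
  have B0: "B \<ge> 0" using R by (simp add: B_def)
  have d0: "cmod (dlt 0 s x - dlt 0 s y) \<le> B" if y: "y \<in> {x..x+1}" for y
  proof -
    have "norm (dlt 0 s x - dlt 0 s y) \<le> B * norm (x - y)"
    proof (rule differentiable_bound)
      show "convex {x..x+1}" by simp
      fix y assume y: "y \<in> {x..x+1}"
      then have y0: "y > 0" using x by auto
      show "(dlt 0 s has_derivative (\<lambda>h. h *\<^sub>R (- s * dlt 0 (s + 1) y))) (at y within {x..x+1})"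
        using dlt_has_derivative[OF y0, of 0 s]
        by (auto simp: has_vector_derivative_def intro: has_derivative_at_withinI)
      have "cmod (dlt 0 (s+1) y) = y powr - (Re s + 1)"
        using y0 by (simp add: norm_of_real_powr)
      also have "\<dots> \<le> x powr - (Re s + 1)" by (rule powr_mono2') (use y x s in auto)
      also have "\<dots> \<le> x powr - (1 + \<sigma>)" by (rule powr_mono) (use s in auto)
      finally have b: "cmod (dlt 0 (s+1) y) \<le> x powr - (1 + \<sigma>)" .
      show "onorm (\<lambda>h. h *\<^sub>R (- s * dlt 0 (s + 1) y)) \<le> B"
      proof (rule onorm_le)
        fix h :: real
        have "norm (h *\<^sub>R (- s * dlt 0 (s + 1) y)) = cmod s * cmod (dlt 0 (s+1) y) * norm h"
          by (simp add: norm_mult)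
        also have "\<dots> \<le> B * norm h" unfolding B_def
          by (intro mult_right_mono mult_mono b s) (use R in auto)
        finally show "norm (h *\<^sub>R (- s * dlt 0 (s + 1) y)) \<le> B * norm h" .
      qed
    qed (use y in auto)
    also have "\<dots> \<le> B * 1" using y by (intro mult_left_mono B0) auto
    finally show ?thesis by simp
  qed
  \<comment> \<open>The increment of \<open>e\<close> over \<open>{x..x+1}\<close> is
    \<open>zdiff s x\<close>, and its derivative at y is (s - 1) times the difference of
    \<open>dlt 0 s\<close> between x and y, which \<open>d0\<close> has already bounded. The mean
    value inequality is thus used twice.\<close>
  define e where "e y = dlt 0 (s - 1) y + of_real y * ((s - 1) * dlt 0 s x)" for y
  have "norm (e x - e (x+1)) \<le> (R + 1) * B * norm (x - (x + 1))"
  proof (rule differentiable_bound)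
    show "convex {x..x+1}" by simp
    fix y assume y: "y \<in> {x..x+1}"
    then have y0: "y > 0" using x by auto
    have "(e has_vector_derivative (- (s - 1) * dlt 0 (s - 1 + 1) y + 1 * ((s - 1) * dlt 0 s x))) (at y)"
      unfolding e_def
      by (intro has_vector_derivative_add dlt_has_derivative y0 has_vector_derivative_mult_left)
         (auto intro!: derivative_eq_intros)
    then have "(e has_vector_derivative ((s - 1) * (dlt 0 s x - dlt 0 s y))) (at y)"
      by (simp add: algebra_simps)
    then show "(e has_derivative (\<lambda>h. h *\<^sub>R ((s - 1) * (dlt 0 s x - dlt 0 s y)))) (at y within {x..x+1})"
      by (auto simp: has_vector_derivative_def intro: has_derivative_at_withinI)
    show "onorm (\<lambda>h. h *\<^sub>R ((s - 1) * (dlt 0 s x - dlt 0 s y))) \<le> (R + 1) * B"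
    proof (rule onorm_le)
      fix h :: real
      have "norm (h *\<^sub>R ((s - 1) * (dlt 0 s x - dlt 0 s y))) = cmod (s - 1) * cmod (dlt 0 s x - dlt 0 s y) * norm h"
        by (simp add: norm_mult)
      also have "\<dots> \<le> (R + 1) * B * norm h"
        by (intro mult_right_mono mult_mono d0 s1) (use R y in auto)
      finally show "norm (h *\<^sub>R ((s - 1) * (dlt 0 s x - dlt 0 s y))) \<le> (R + 1) * B * norm h" .
    qed
  qed auto
  then have "cmod (e (x + 1) - e x) \<le> (R + 1) * B" by (simp add: norm_minus_commute)
  moreover have "e (x + 1) - e x = zdiff s x"
    by (simp add: e_def zdiff_def algebra_simps)
  ultimately show ?thesis by (simp add: B_def mult.assoc)
qed

lemma zt_dom:
  assumes x: "Re x > 0"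
  shows "\<exists>d>0. \<exists>M. summable M \<and> cball x d \<subseteq> {s. Re s > 0} \<and>
     (\<forall>n. \<forall>z\<in>cball x d. cmod (zdiff z (real (Suc n))) \<le> M n)"
proof -
  define d where "d = Re x / 2"
  define R where "R = cmod x + d"
  define M where "M n = (R + 1) * R * real (Suc n) powr - (1 + d)" for n
  have d: "d > 0" using x by (simp add: d_def)
  have re: "Re z \<ge> d" "cmod z \<le> R" if "z \<in> cball x d" for z
  proof -
    have *: "cmod (x - z) \<le> d" using that by (simp add: dist_norm)
    then show "Re z \<ge> d" using abs_Re_le_cmod[of "x - z"] by (simp add: d_def)
    show "cmod z \<le> R" using * norm_triangle_ineq3[of x z] unfolding R_def by linarith
  qed
  have "summable M" unfolding M_def by (intro summable_mult summable_Suc_powr) (use d in auto)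
  moreover have "cball x d \<subseteq> {s. Re s > 0}" using re(1) d by force
  moreover have "cmod (zdiff z (real (Suc n))) \<le> M n" if z: "z \<in> cball x d" for n z
    unfolding M_def by (rule zdiff_bound) (use re[OF z] d in auto)
  ultimately show ?thesis using d by blast
qed

lemma zt_holomorphic: "zt holomorphic_on {s. Re s > 0}"
proof -
  have "(\<lambda>s. \<Sum>n. zdiff s (real (Suc n))) holomorphic_on {s. Re s > 0}"
  proof (rule holomorphic_suminf[OF halfplane_open])
    fix n
    have "(\<lambda>s. (s - 1) * dlt 0 s (real (Suc n)) - (dlt 0 (s - 1) (real (Suc n)) - dlt 0 (s - 1) (real (Suc n) + 1)))
      holomorphic_on {s. 0 < Re s}"
      by (auto intro!: holomorphic_intros)
    then show "(\<lambda>s. zdiff s (real (Suc n))) holomorphic_on {s. 0 < Re s}"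
      by (simp add: zdiff_def)
  qed (use zt_dom in auto)
  then show ?thesis unfolding zt_def by (intro holomorphic_intros)
qed

lemma zt_1: "zt 1 = 1"
proof -
  have "zdiff 1 (real (Suc n)) = 0" for n
  proof -
    have "complex_of_real (real (Suc n)) \<noteq> 0" "complex_of_real (real (Suc n) + 1) \<noteq> 0"
      unfolding of_real_eq_0_iff by linarith+
    then show ?thesis by (simp add: zdiff_def del: of_nat_Suc of_real_of_nat_eq of_real_add)
  qed
  then show ?thesis by (simp add: zt_def)
qed

text \<open>The terms coming from the integral telescope to 1, and the leading 1 of
  \<open>zt\<close> compensates for them.\<close>

lemma zt_eq:
  assumes "Re s > 1"
  shows "zt s = (s - 1) * (\<Sum>n. of_nat (Suc n) powr - s)"
proof -
  have 1: "(\<lambda>n. of_nat (Suc n) powr - s) sums dser 0 (\<lambda>_. 1) s"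
    using dser_sums[of "\<lambda>_. 1" 1 0 s] assms by simp
  have "(\<lambda>n. dlt 0 (s - 1) (real (Suc n))) \<longlonglongrightarrow> 0"
    using dlt_tendsto_0[of "s - 1" 0 "\<lambda>_. 1" 1] assms by simp
  from telescope_sums'[OF this]
  have 2: "(\<lambda>n. dlt 1 (s - 1) (real (Suc n))) sums 1"
    by (simp add: add_ac)
  have "(\<lambda>n. zdiff s (real (Suc n))) sums ((s - 1) * dser 0 (\<lambda>_. 1) s - 1)"
    unfolding zdiff_def by (intro sums_diff sums_mult 2) (use 1 in simp)
  then have "zt s = (s - 1) * dser 0 (\<lambda>_. 1) s" by (simp add: zt_def sums_iff)
  with 1 show ?thesis by (simp add: sums_iff)
qed

section \<open>Dirichlet series and the Moebius function\<close>

text \<open>Since 0 powr anything is 0, the term at n = 0 vanishes, so series over all naturals and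
  sums over the positive integers are interchangeable.\<close>

abbreviation nps :: "nat \<Rightarrow> complex \<Rightarrow> complex" where
  "nps n s \<equiv> of_nat n powr (- s)"

lemma nps_mult: "nps (m * n) s = nps m s * nps n s"
  by (simp add: powr_times_real)

lemma norm_nps: "cmod (nps n s) = real n powr (- Re s)"
proof (cases "n = 0")
  case False
  then have "cmod (complex_of_real (real n) powr (- s)) = real n powr (- Re s)"
    by (subst norm_of_real_powr) auto
  then show ?thesis by simp
qed simp

lemma nps_exp: "n > 0 \<Longrightarrow> nps n s = exp (- s * of_real (ln (real n)))"
  using Ln_of_real[of "real n"] by (simp add: powr_def)

lemma nps_shift: "nps n (s + u) = nps n s * nps n u"
  using powr_add[of "of_nat n" "-s" "-u"] by (simp add: algebra_simps)

lemma cnj_nps: "cnj (nps n s) = nps n (cnj s)"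
  by (cases "n = 0") (simp_all add: nps_exp exp_cnj)

lemma nps_holomorphic: "(\<lambda>s. nps n s) holomorphic_on S"
  by (cases "n = 0") (auto intro!: holomorphic_intros)

lemma higher_deriv_nps:
  "(deriv ^^ k) (\<lambda>s. a * nps n s) = (\<lambda>s. a * of_real (- ln (real n)) ^ k * nps n s)"
proof (cases "n = 0")
  case True
  then show ?thesis by (induction k) auto
next
  case False
  show ?thesis
  proof (induction k)
    case (Suc k)
    have "deriv (\<lambda>s. a * of_real (- ln (real n)) ^ k * nps n s) =
      (\<lambda>s. a * of_real (- ln (real n)) ^ Suc k * nps n s)"
    proof
      fix s
      have "((\<lambda>s. nps n s) has_field_derivative (of_real (- ln (real n)) * nps n s)) (at s)"
        using False by (auto simp: nps_exp intro!: derivative_eq_intros)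
      from DERIV_cmult[OF this, of "a * of_real (- ln (real n)) ^ k"]
      show "deriv (\<lambda>s. a * of_real (- ln (real n)) ^ k * nps n s) s =
         a * of_real (- ln (real n)) ^ Suc k * nps n s"
        by (simp add: DERIV_imp_deriv mult_ac)
    qed
    with Suc show ?case by simp
  qed simp
qed

definition DS :: "(nat \<Rightarrow> complex) \<Rightarrow> complex \<Rightarrow> complex" where
  "DS a s = (\<Sum>n. a n * nps n s)"

definition dsc :: "(nat \<Rightarrow> complex) \<Rightarrow> real \<Rightarrow> bool" where
  "dsc a \<sigma> \<longleftrightarrow> summable (\<lambda>n. cmod (a n) * real n powr - \<sigma>)"

lemma dsc_bounded:
  assumes "\<And>n. cmod (a n) \<le> B" "\<sigma> > 1"
  shows "dsc a \<sigma>"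
  unfolding dsc_def
proof (rule summable_comparison_test)
  show "summable (\<lambda>n. B * real n powr - \<sigma>)"
    using assms by (intro summable_mult) (simp add: summable_real_powr_iff)
  show "\<exists>N. \<forall>n\<ge>N. norm (cmod (a n) * real n powr - \<sigma>) \<le> B * real n powr - \<sigma>"
    using assms by (auto intro!: mult_right_mono)
qed

lemma norm_nps_le: "Re s \<ge> \<sigma> \<Longrightarrow> cmod (a * nps n s) \<le> cmod a * real n powr - \<sigma>"
  by (cases "n = 0") (auto simp: norm_mult norm_nps intro!: mult_left_mono powr_mono)

lemma DS_has_sum:
  assumes "dsc a \<sigma>" "Re s \<ge> \<sigma>"
  shows "((\<lambda>n. a n * nps n s) has_sum DS a s) UNIV"
proof (rule norm_summable_imp_has_sum)
  show sm: "summable (\<lambda>n. cmod (a n * nps n s))"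
    by (rule summable_comparison_test[OF _ assms(1)[unfolded dsc_def]])
       (use norm_nps_le[OF assms(2)] in auto)
  show "(\<lambda>n. a n * nps n s) sums DS a s"
    unfolding DS_def by (rule summable_sums, rule summable_norm_cancel) (rule sm)
qed

lemma DS_has_sum_pos:
  assumes "dsc a \<sigma>" "Re s \<ge> \<sigma>"
  shows "((\<lambda>n. a n * nps n s) has_sum DS a s) {0<..}"
proof -
  have "((\<lambda>n. a n * nps n s) has_sum DS a s) UNIV \<longleftrightarrow> ?thesis"
    by (rule has_sum_cong_neutral) auto
  then show ?thesis using DS_has_sum[OF assms] by blast
qed

lemma DS_sums_Suc:
  assumes "dsc a \<sigma>" "Re s \<ge> \<sigma>"
  shows "(\<lambda>n. a (Suc n) * nps (Suc n) s) sums DS a s"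
  using has_sum_imp_sums[OF DS_has_sum[OF assms]] by (subst sums_Suc_iff) simp

lemma
  assumes d: "dsc a \<sigma>"
  shows DS_holomorphic: "DS a holomorphic_on {s. Re s > \<sigma>}"
    and DS_higher_deriv: "Re s > \<sigma> \<Longrightarrow>
      (\<lambda>n. a n * of_real (- ln (real n)) ^ k * nps n s) sums (deriv ^^ k) (DS a) s"
proof -
  have dom: "\<exists>d>0. \<exists>M. summable M \<and> cball x d \<subseteq> {s. Re s > \<sigma>} \<and>
      (\<forall>n. \<forall>z\<in>cball x d. cmod (a n * nps n z) \<le> M n)" if x: "x \<in> {s. Re s > \<sigma>}" for x
  proof -
    obtain r where r: "r > 0" "cball x r \<subseteq> {s. Re s > \<sigma>}"
      using halfplane_open x open_contains_cball_eq by metis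
    then have "cmod (a n * nps n z) \<le> cmod (a n) * real n powr - \<sigma>" if "z \<in> cball x r" for n z
      using that by (intro norm_nps_le less_imp_le) auto
    then show ?thesis
      using d r unfolding dsc_def
      by (intro exI[of _ r] conjI exI[of _ "\<lambda>n. cmod (a n) * real n powr - \<sigma>"]) auto
  qed
  have hol: "(\<lambda>s. a n * nps n s) holomorphic_on {s. Re s > \<sigma>}" for n
    by (intro holomorphic_intros nps_holomorphic)
  show "DS a holomorphic_on {s. Re s > \<sigma>}"
    unfolding DS_def by (rule holomorphic_suminf[OF halfplane_open hol dom])
  assume "Re s > \<sigma>"
  then show "(\<lambda>n. a n * of_real (- ln (real n)) ^ k * nps n s) sums (deriv ^^ k) (DS a) s"
    using higher_deriv_suminf[OF halfplane_open hol dom, of s k]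
    by (simp add: higher_deriv_nps DS_def[abs_def])
qed

text \<open>Products are formed for unordered sums, so that index pairs can be rearranged by any
  bijection; the divisor regroupings below rely on this.\<close>

lemma has_sum_product_complex:
  fixes f :: "'a \<Rightarrow> complex" and g :: "'b \<Rightarrow> complex"
  assumes f: "(f has_sum a) A" and g: "(g has_sum b) B"
  shows "((\<lambda>(x, y). f x * g y) has_sum (a * b)) (A \<times> B)"
proof (rule has_sum_SigmaI)
  show "((\<lambda>y. case (x, y) of (x, y) \<Rightarrow> f x * g y) has_sum f x * b) B" for x
    using has_sum_cmult_right[OF g] by simp
  show "((\<lambda>x. f x * b) has_sum a * b) A"
    by (rule has_sum_cmult_left[OF f])
  have fa: "(\<lambda>x. norm (f x)) summable_on A" and ga: "(\<lambda>x. norm (g x)) summable_on B"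
    using has_sum_imp_summable[OF f] has_sum_imp_summable[OF g]
    by (simp_all add: summable_on_iff_abs_summable_on_complex)
  have "(\<lambda>z. norm (case z of (x, y) \<Rightarrow> f x * g y)) summable_on A \<times> B"
    unfolding Infinite_Sum.abs_summable_on_Sigma_iff
  proof (intro conjI ballI)
    show "(\<lambda>y. norm (case (x, y) of (x, y) \<Rightarrow> f x * g y)) summable_on B" for x
      using summable_on_cmult_right[OF ga, of "cmod (f x)"] by (simp add: norm_mult)
    have "(\<lambda>x. norm (cmod (f x) * infsum (\<lambda>y. cmod (g y)) B)) summable_on A"
      using summable_on_cmult_left[OF fa, of "\<bar>infsum (\<lambda>y. cmod (g y)) B\<bar>"] by (simp add: abs_mult)
    then show "(\<lambda>x. norm (\<Sum>\<^sub>\<infinity>y\<in>B. cmod (case (x, y) of (x, y) \<Rightarrow> f x * g y))) summable_on A"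
      by (simp add: norm_mult infsum_cmult_right')
  qed
  then show "(\<lambda>(x, y). f x * g y) summable_on A \<times> B"
    by (simp add: summable_on_iff_abs_summable_on_complex)
qed

definition mob :: "nat \<Rightarrow> real" where
  "mob n = (if squarefree n then (-1) ^ card (prime_factors n) else 0)"

lemma abs_mob_le: "\<bar>mob n\<bar> \<le> 1" by (simp add: mob_def)

lemma mob_prime_mult:
  assumes "prime p" "\<not> p dvd d" "d > 0"
  shows "mob (p * d) = - mob d"
proof -
  have c: "coprime p d" using assms by (simp add: prime_imp_coprime)
  have "squarefree (p * d) \<longleftrightarrow> squarefree d"
    using squarefree_mult_coprime[OF c] squarefree_prime[OF assms(1)] squarefree_mono[of d "p * d"] by auto
  moreover have "prime_factors (p * d) = insert p (prime_factors d)"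
    using assms by (subst prime_factorization_mult) (auto simp: prime_factorization_prime)
  moreover have "p \<notin> prime_factors d" using assms by (auto simp: in_prime_factors_iff)
  ultimately show ?thesis by (simp add: mob_def)
qed

text \<open>For n > 1 fix a prime p dividing n: the squarefree divisors d not divisible by p cancel
  against the divisors p * d.\<close>

lemma sum_mob_divisors:
  assumes "n > 0"
  shows "(\<Sum>d | d dvd n. mob d) = (if n = 1 then 1 else 0)"
proof (cases "n = 1")
  case True
  then show ?thesis by (simp add: mob_def)
next
  case False
  then obtain p where p: "prime p" "p dvd n" using prime_factor_nat by blast
  have fin: "finite {d. d dvd n}" using assms by simp
  define A where "A = {d. d dvd n \<and> squarefree d \<and> \<not> p dvd d}"
  define B where "B = {d. d dvd n \<and> squarefree d \<and> p dvd d}"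
  have finA: "finite A" "finite B" by (auto simp: A_def B_def intro: finite_subset[OF _ fin])
  have "(\<Sum>d | d dvd n. mob d) = (\<Sum>d\<in>A \<union> B. mob d)"
    by (rule sum.mono_neutral_right[OF fin]) (auto simp: A_def B_def mob_def)
  also have "\<dots> = (\<Sum>d\<in>A. mob d) + (\<Sum>d\<in>B. mob d)"
    by (rule sum.union_disjoint[OF finA]) (auto simp: A_def B_def)
  also have "(\<Sum>d\<in>B. mob d) = (\<Sum>d\<in>A. mob (p * d))"
  proof (rule sum.reindex_bij_witness[of _ "\<lambda>d. p * d" "\<lambda>d. d div p"])
    fix a assume a: "a \<in> B"
    then show "p * (a div p) = a" by (auto simp: B_def)
    from a obtain b where b: "a = p * b" by (auto simp: B_def)
    have p0: "p > 0" using p prime_gt_0_nat by blast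
    have "\<not> p dvd b"
    proof
      assume "p dvd b"
      then have "p ^ 2 dvd a" using b by (simp add: power2_eq_square)
      then have "p dvd 1" using a by (auto simp: B_def dest: squarefreeD)
      with p show False by simp
    qed
    moreover have "b dvd n" using a b by (auto simp: B_def intro: dvd_mult_right)
    moreover have "squarefree b" using a b squarefree_mono[of b a] by (auto simp: B_def)
    ultimately show "a div p \<in> A" using b p0 by (simp add: A_def)
  next
    fix d assume d: "d \<in> A"
    have p0: "p > 0" using p prime_gt_0_nat by blast
    then show "p * d div p = d" by simp
    have c: "coprime p d" using d p by (auto simp: A_def intro: prime_imp_coprime)
    then have "p * d dvd n" using d p by (auto simp: A_def intro: divides_mult)
    then show "p * d \<in> B" using d squarefree_mult_coprime[OF c] squarefree_prime[OF p(1)]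
      by (auto simp: A_def B_def)
  next
    fix a assume "a \<in> B"
    then show "mob (p * (a div p)) = mob a" by (auto simp: B_def)
  qed
  also have "\<dots> = (\<Sum>d\<in>A. - mob d)"
  proof (rule sum.cong)
    fix d assume "d \<in> A"
    moreover from this have "d > 0" by (auto simp: A_def intro!: Nat.gr0I)
    ultimately show "mob (p * d) = - mob d" using p by (intro mob_prime_mult) (auto simp: A_def)
  qed simp
  finally show ?thesis using False by (simp add: sum_negf)
qed

text \<open>Recording the pair (m, n) as (m * n, n) turns the product into a sum over N of
  \<open>f N\<close> times the divisor sum of \<open>mob\<close>.\<close>

lemma DS_mobius:
  fixes f :: "nat \<Rightarrow> complex"
  assumes cm: "\<And>m n. f (m * n) = f m * f n" "f 1 = 1" "\<And>n. cmod (f n) \<le> 1"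
    and s: "Re s > 1"
  shows "DS f s * DS (\<lambda>n. mob n * f n) s = 1"
proof -
  have b: "cmod (mob n * f n) \<le> 1" for n
    using abs_mob_le[of n] cm(3)[of n] mult_le_one by (simp add: norm_mult mult_le_one)
  have h1: "((\<lambda>n. f n * nps n s) has_sum DS f s) {0<..}"
    by (rule DS_has_sum_pos[OF dsc_bounded[OF cm(3) s]]) simp
  have h2: "((\<lambda>n. mob n * f n * nps n s) has_sum DS (\<lambda>n. mob n * f n) s) {0<..}"
    by (rule DS_has_sum_pos[OF dsc_bounded[OF b s]]) simp
  have "((\<lambda>(m, n). (f m * nps m s) * (mob n * f n * nps n s)) has_sum (DS f s * DS (\<lambda>n. mob n * f n) s))
      ({0<..} \<times> {0<..})"
    by (rule has_sum_product_complex[OF h1 h2])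
  also have "?this \<longleftrightarrow> ((\<lambda>(N, n). f N * nps N s * mob n) has_sum (DS f s * DS (\<lambda>n. mob n * f n) s))
      (SIGMA N:{0<..}. {n. n dvd N})"
    by (rule has_sum_reindex_bij_witness[of _ "\<lambda>(N, n). (N div n, n)" "\<lambda>(m, n). (m * n, n)"])
       (auto simp: cm(1) nps_mult simp del: of_nat_mult intro!: Nat.gr0I)
  finally have *: "((\<lambda>(N, n). f N * nps N s * mob n) has_sum (DS f s * DS (\<lambda>n. mob n * f n) s))
      (SIGMA N:{0<..}. {n. n dvd N})" .
  have "((\<lambda>N. if N = 1 then 1 else 0) has_sum (DS f s * DS (\<lambda>n. mob n * f n) s)) {0::nat<..}"
  proof (rule has_sum_SigmaD[OF *])
    fix N :: nat assume N: "N \<in> {0<..}"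
    have "(\<Sum>n | n dvd N. f N * nps N s * of_real (mob n)) = f N * nps N s * of_real (\<Sum>n | n dvd N. mob n)"
      by (simp add: sum_distrib_left)
    also have "\<dots> = (if N = 1 then 1 else 0)"
      using N cm(2) by (simp add: sum_mob_divisors)
    finally show "((\<lambda>y. case (N, y) of (N, n) \<Rightarrow> f N * nps N s * of_real (mob n)) has_sum (if N = 1 then 1 else 0)) {n. n dvd N}"
      using N by (intro has_sum_finiteI) auto
  qed
  moreover have "((\<lambda>N. if N = 1 then 1 else 0) has_sum (1::complex)) {0::nat<..}"
    by (rule has_sum_finite_neutralI[of "{1}"]) auto
  ultimately show ?thesis using has_sum_unique by blast
qed

section \<open>Nonvanishing on the line of real part one\<close>

text \<open>The product of four series is regrouped twice through quintuples (x, y, f, a, b) with a,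
  b coprime. Splitting off f = gcd z w gives (x, y, f * a, f * b); on the other hand x * a and x * b
  run over all pairs of divisors of n = x * y * a * b. The factor |psi(f)|^2 leaves a series in f at
  2s, and the sum over pairs of divisors is a squared modulus.\<close>

lemma ramanujan_has_sum:
  fixes \<psi> :: "nat \<Rightarrow> complex" and e :: "nat \<Rightarrow> complex"
  assumes cm: "\<And>m n. \<psi> (m * n) = \<psi> m * \<psi> n"
    and e: "\<And>n. e n = \<psi> n * cnj (\<psi> n)" "\<And>n. e n * e n = e n" "\<And>n. e n * \<psi> n = \<psi> n"
    and S: "((\<lambda>(x, y, z, w). (e x * nps x s) * ((e y * nps y s) * ((\<psi> z * nps z s) * (cnj (\<psi> w) * nps w s)))) has_sum S)
      ({0<..} \<times> {0<..} \<times> {0<..} \<times> {0<..})"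
  shows "((\<lambda>(f, n). (e f * nps f (2 * s)) * (e n * of_real ((cmod (\<Sum>a | a dvd n. \<psi> a))\<^sup>2) * nps n s)) has_sum S)
      ({0<..} \<times> {0<..})"
proof -
  let ?P = "{0::nat<..}"
  define T where "T = {(x, y, f, a, b). (x::nat) > 0 \<and> (y::nat) > 0 \<and> (f::nat) > 0 \<and> a > 0 \<and> b > 0 \<and> coprime a (b::nat)}"
  define t where "t = (\<lambda>(x, y, f, a, b). e x * e y * e f * \<psi> a * cnj (\<psi> b) * nps (x * y * (f * f) * (a * b)) s)"
  define u where "u = (\<lambda>(f, n, a, b). e f * nps f (2 * s) * (e n * nps n s) * (\<psi> a * cnj (\<psi> b)))"
  have ecm: "e (m * n) = e m * e n" for m n by (simp add: e(1) cm)
  have e': "e n * cnj (\<psi> n) = cnj (\<psi> n)" for n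
    using arg_cong[OF e(3)[of n], of cnj] by (simp add: e(1) mult_ac)
  have sq: "nps f (2 * s) = nps (f * f) s" for f
    using nps_shift[of f s s] by (simp add: nps_mult del: of_nat_mult)
  define j where "j = (\<lambda>(x, y, f, a, b). (x, y, f * a, f * b) :: nat \<times> nat \<times> nat \<times> nat)"
  define i where "i = (\<lambda>(x, y, z, w). (x, y, gcd z w, z div gcd z w, w div gcd z w) :: nat \<times> nat \<times> nat \<times> nat \<times> nat)"
  define j' where "j' = (\<lambda>(x, y, f, a, b). (f, x * y * (a * b), x * a, x * b) :: nat \<times> nat \<times> nat \<times> nat)"
  define i' where "i' = (\<lambda>(f, n, a, b). (gcd a b, n div lcm a b, f, a div gcd a b, b div gcd a b) :: nat \<times> nat \<times> nat \<times> nat \<times> nat)"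
  have "(t has_sum S) T \<longleftrightarrow> ((\<lambda>(x, y, z, w). (e x * nps x s) * ((e y * nps y s) * ((\<psi> z * nps z s) * (cnj (\<psi> w) * nps w s)))) has_sum S)
      (?P \<times> ?P \<times> ?P \<times> ?P)"
  proof (rule has_sum_reindex_bij_witness[of T i j])
    show "S = S" ..
    fix p assume "p \<in> T"
    then obtain x y f a b where p: "p = (x, y, f, a, b)" "x > 0" "y > 0" "f > 0" "a > 0" "b > 0" "coprime a b"
      by (auto simp: T_def)
    have g: "gcd (f * a) (f * b) = f" using p by (simp add: gcd_mult_distrib_nat[symmetric])
    show "i (j p) = p" using p g by (simp add: i_def j_def)
    show "j p \<in> ?P \<times> ?P \<times> ?P \<times> ?P" using p by (simp add: i_def j_def)
    show "(case j p of (x, y, z, w) \<Rightarrow> (e x * nps x s) * ((e y * nps y s) * ((\<psi> z * nps z s) * (cnj (\<psi> w) * nps w s)))) = t p"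
      using p by (simp add: j_def t_def cm e(1) nps_mult del: of_nat_mult)
  next
    fix p assume "p \<in> ?P \<times> ?P \<times> ?P \<times> ?P"
    then obtain x y z w where p: "p = (x, y, z, w)" "x > 0" "y > 0" "z > 0" "w > 0" by auto
    show "j (i p) = p" using p by (simp add: i_def j_def)
    show "i p \<in> T" using p by (simp add: i_def T_def div_gcd_coprime div_greater_zero_iff)
  qed
  with S have "(t has_sum S) T" by blast
  \<comment> \<open>The inverse map recovers x as the gcd of the two divisors and y as n divided by
    their lcm x * a * b. The idempotence of \<open>e\<close> and
    \<open>e n * \<psi> n = \<psi> n\<close> absorb the surplus factors \<open>e\<close>.\<close>
  also have "(t has_sum S) T \<longleftrightarrow> (u has_sum S) (?P \<times> (SIGMA n:?P. {a. a dvd n} \<times> {b. b dvd n}))"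
  proof (rule has_sum_reindex_bij_witness[of T i' j'])
    show "S = S" ..
    fix p assume "p \<in> T"
    then obtain x y f a b where p: "p = (x, y, f, a, b)" "x > 0" "y > 0" "f > 0" "a > 0" "b > 0" "coprime a b"
      by (auto simp: T_def)
    have g: "gcd (x * a) (x * b) = x" using p by (simp add: gcd_mult_distrib_nat[symmetric])
    have "x * lcm (x * a) (x * b) = x * a * (x * b)"
      using prod_gcd_lcm_nat[of "x * a" "x * b"] unfolding g by (rule sym)
    also have "\<dots> = x * (x * (a * b))" by (simp only: mult_ac)
    finally have "x * lcm (x * a) (x * b) = x * (x * (a * b))" .
    then have l: "lcm (x * a) (x * b) = x * (a * b)" using p by simp
    have "x * y * (a * b) div (x * (a * b)) = y"
      using p by (metis mult.assoc mult.commute nonzero_mult_div_cancel_left mult_eq_0_iff neq0_conv)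
    then show "i' (j' p) = p" using p g l by (simp add: i'_def j'_def)
    show "j' p \<in> ?P \<times> (SIGMA n:?P. {a. a dvd n} \<times> {b. b dvd n})" using p by (simp add: j'_def)
    have ab: "\<psi> (x * a) * cnj (\<psi> (x * b)) = e x * (\<psi> a * cnj (\<psi> b))"
      by (simp add: cm e(1) mult_ac)
    have "u (j' p) = e f * nps (f * f) s * (e (x * y * (a * b)) * nps (x * y * (a * b)) s) * (\<psi> (x * a) * cnj (\<psi> (x * b)))"
      using p by (simp only: j'_def u_def sq prod.case)
    also have "\<dots> = (e x * e x) * e y * e f * (e a * \<psi> a) * (e b * cnj (\<psi> b)) * (nps (x * y * (a * b)) s * nps (f * f) s)"
      unfolding ab ecm by (simp only: mult_ac)
    also have "nps (x * y * (a * b)) s * nps (f * f) s = nps (x * y * (f * f) * (a * b)) s"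
      by (simp only: nps_mult mult_ac)
    finally show "u (j' p) = t p"
      using p(1) unfolding e(2) e(3) e' by (simp only: t_def prod.case)
  next
    fix p assume "p \<in> ?P \<times> (SIGMA n:?P. {a. a dvd n} \<times> {b. b dvd n})"
    then obtain f n a b where p: "p = (f, n, a, b)" "f > 0" "n > 0" "a dvd n" "b dvd n" by auto
    have pos: "a > 0" "b > 0" using p by (auto intro!: Nat.gr0I)
    have l: "lcm a b dvd n" using p by (simp add: j'_def)
    have "gcd a b * (gcd a b * (a div gcd a b * (b div gcd a b)))
       = (gcd a b * (a div gcd a b)) * (gcd a b * (b div gcd a b))"
      by (simp only: mult_ac)
    also have "\<dots> = a * b" by simp
    also have "\<dots> = gcd a b * lcm a b" by (rule prod_gcd_lcm_nat)
    finally have "gcd a b * (a div gcd a b * (b div gcd a b)) = lcm a b"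
      by (rule mult_left_cancel[THEN iffD1, rotated]) (use pos in simp)
    then have "gcd a b * (n div lcm a b) * (a div gcd a b * (b div gcd a b)) = n div lcm a b * lcm a b"
      by (simp add: mult_ac)
    then show "j' (i' p) = p" using p l by (simp add: i'_def j'_def)
    have "lcm a b > 0" using pos by (intro Nat.gr0I) simp
    then have "n div lcm a b > 0" using p l by (simp add: div_greater_zero_iff dvd_imp_le)
    then show "i' p \<in> T" using p pos by (simp add: i'_def T_def div_gcd_coprime div_greater_zero_iff)
  qed
  finally have uS: "(u has_sum S) (?P \<times> (SIGMA n:?P. {a. a dvd n} \<times> {b. b dvd n}))" .
  show ?thesis
  proof (rule has_sum_SigmaD)
    show "((\<lambda>p. case p of ((f, n), (a, b)) \<Rightarrow> u (f, n, a, b)) has_sum S)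
       (SIGMA p:?P \<times> ?P. {a. a dvd snd p} \<times> {b. b dvd snd p})"
      using uS
      by (subst has_sum_reindex_bij_witness[of _ "\<lambda>(f, n, a, b). ((f, n), (a, b))"
            "\<lambda>((f, n), (a, b)). (f, n, a, b)" _ u _ S S]) auto
    fix p assume "p \<in> ?P \<times> ?P"
    then obtain f n where p: "p = (f, n)" "f > 0" "n > 0" by auto
    let ?D = "{a. a dvd n}"
    have "(\<Sum>y\<in>?D \<times> ?D. case y of (a, b) \<Rightarrow> \<psi> a * cnj (\<psi> b)) = (\<Sum>a\<in>?D. \<psi> a) * cnj (\<Sum>a\<in>?D. \<psi> a)"
      unfolding sum.cartesian_product[symmetric] sum_product cnj_sum by simp
    also have "\<dots> = of_real ((cmod (\<Sum>a\<in>?D. \<psi> a))\<^sup>2)"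
      by (simp only: complex_norm_square)
    finally have sq: "(\<Sum>y\<in>?D \<times> ?D. case y of (a, b) \<Rightarrow> \<psi> a * cnj (\<psi> b)) = of_real ((cmod (\<Sum>a\<in>?D. \<psi> a))\<^sup>2)" .
    have "(\<Sum>y\<in>?D \<times> ?D. case y of (a, b) \<Rightarrow> u (f, n, a, b)) =
        (e f * nps f (2 * s) * (e n * nps n s)) * (\<Sum>y\<in>?D \<times> ?D. case y of (a, b) \<Rightarrow> \<psi> a * cnj (\<psi> b))"
      unfolding u_def sum_distrib_left by (rule sum.cong) auto
    also have "\<dots> = (e f * nps f (2 * s)) * (e n * of_real ((cmod (\<Sum>a\<in>?D. \<psi> a))\<^sup>2) * nps n s)"
      unfolding sq by (simp only: mult_ac)
    finally have "(\<Sum>y\<in>?D \<times> ?D. case y of (a, b) \<Rightarrow> u (f, n, a, b)) =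
        (e f * nps f (2 * s)) * (e n * of_real ((cmod (\<Sum>a\<in>?D. \<psi> a))\<^sup>2) * nps n s)" .
    then show "((\<lambda>y. case (p, y) of ((f, n), (a, b)) \<Rightarrow> u (f, n, a, b)) has_sum
       (case p of (f, n) \<Rightarrow> (e f * nps f (2 * s)) * (e n * of_real ((cmod (\<Sum>a | a dvd n. \<psi> a))\<^sup>2) * nps n s)))
       ({a. a dvd snd p} \<times> {b. b dvd snd p})"
      using p by (intro has_sum_finiteI) (auto simp: case_prod_unfold)
  qed
qed

lemma sums_nonneg_ge_first:
  fixes f :: "nat \<Rightarrow> real"
  assumes "f sums S" "\<And>n. f n \<ge> 0"
  shows "f 0 \<le> S"
  using sum_le_suminf[of f "{0}"] assms by (auto simp: sums_iff)

text \<open>Non-principality is encoded as a vanishing sum over a period, the form in which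
  summation by parts uses it.\<close>

locale np_char =
  fixes q :: nat and chi :: "nat \<Rightarrow> complex"
  assumes dc: "dirichlet_char q chi"
    and unim: "\<And>n. coprime n q \<Longrightarrow> cmod (chi n) = 1"
    and sum0: "(\<Sum>j<q. chi j) = 0"
begin

lemma q_pos: "q > 0" and per: "chi (n + q) = chi n" and mult: "chi (m * n) = chi m * chi n"
  and one: "chi 1 = 1" and zero_iff: "chi n = 0 \<longleftrightarrow> \<not> coprime n q"
  using dc by (auto simp: dirichlet_char_def)

lemma norm_le: "cmod (chi n) \<le> 1"
  using unim[of n] zero_iff[of n] by (cases "coprime n q") auto

lemma np_char_cnj: "np_char q (\<lambda>n. cnj (chi n))"
proof
  show "dirichlet_char q (\<lambda>n. cnj (chi n))"
    using dc by (auto simp: dirichlet_char_def)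
  show "(\<Sum>j<q. cnj (chi j)) = 0" using sum0 by (simp flip: cnj_sum)
qed (simp add: unim)

definition e :: "nat \<Rightarrow> complex" where "e n = (if coprime n q then 1 else 0)"

lemma e_eq: "e n = chi n * cnj (chi n)"
  using unim[of n] zero_iff[of n] by (auto simp: e_def complex_norm_square[symmetric])

lemma mz: "mz_periodic q (\<lambda>n. chi (Suc n))"
proof -
  have "(\<Sum>j<Suc q. chi j) = chi 0 + (\<Sum>j<q. chi (Suc j))" by (rule sum.lessThan_Suc_shift)
  moreover have "chi q = chi 0" using per[of 0] by simp
  ultimately have "(\<Sum>j<q. chi (Suc j)) = 0" using sum0 by simp
  then show ?thesis using q_pos per[of "Suc n" for n] by (simp add: mz_periodic_def)
qed

definition L :: "complex \<Rightarrow> complex" where "L = Lent q (\<lambda>n. chi (Suc n))"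

lemma L_holomorphic: "L holomorphic_on S"
  unfolding L_def by (rule Lent_holomorphic[OF mz])

lemma L_sums: "Re s > 0 \<Longrightarrow> (\<lambda>n. chi (Suc n) * nps (Suc n) s) sums L s"
  unfolding L_def by (rule Lent_sums[OF mz])

lemma dsc_char: "\<sigma> > 1 \<Longrightarrow> dsc chi \<sigma>"
  by (rule dsc_bounded[OF norm_le])

lemma L_eq_DS: "Re s > 1 \<Longrightarrow> L s = DS chi s"
  using sums_unique2[OF L_sums DS_sums_Suc[OF dsc_char[of "Re s"]]] by simp

lemma L_mobius: "Re s > 1 \<Longrightarrow> L s * DS (\<lambda>n. mob n * chi n) s = 1"
  by (simp add: L_eq_DS DS_mobius[OF mult one norm_le])

definition ec :: complex where "ec = (\<Sum>j<q. e (Suc j)) / of_nat q"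

text \<open>This is s - 1 times the L-function of the principal character \<open>e\<close>: the
  coefficients split into their mean \<open>ec\<close>, carried by zeta, and a mean-zero periodic
  part. The value at 1 is \<open>ec\<close>, which is not 0.\<close>

definition W :: "complex \<Rightarrow> complex" where
  "W s = ec * zt s + (s - 1) * Lent q (\<lambda>n. e (Suc n) - ec) s"

lemma mz_e: "mz_periodic q (\<lambda>n. e (Suc n) - ec)"
proof -
  have "e (Suc (n + q)) = e (Suc n)" for n
    using per[of "Suc n"] unfolding e_eq by simp
  then show ?thesis using q_pos by (simp add: mz_periodic_def ec_def sum_subtractf)
qed

lemma ec_neq_0: "ec \<noteq> 0"
proof -
  define m :: nat where "m = (\<Sum>j<q. if coprime (Suc j) q then 1 else 0)"
  have "(\<Sum>j<q. e (Suc j)) = of_nat m"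
    unfolding of_nat_sum e_def m_def by (rule sum.cong) auto
  moreover have "m \<noteq> 0"
    unfolding m_def using q_pos by (auto simp: sum_eq_0_iff intro!: bexI[of _ 0])
  ultimately show ?thesis using q_pos by (simp add: ec_def)
qed

lemma W_1: "W 1 = ec" by (simp add: W_def zt_1)

lemma W_holomorphic: "W holomorphic_on {s. Re s > 0}"
  unfolding W_def by (intro holomorphic_intros zt_holomorphic Lent_holomorphic[OF mz_e])

lemma norm_e_le: "cmod (e n) \<le> 1" by (simp add: e_def)

lemma W_eq:
  assumes "Re s > 1"
  shows "W s = (s - 1) * DS e s"
proof -
  have d: "dsc (\<lambda>_. 1) (Re s)" by (rule dsc_bounded[of _ 1]) (use assms in auto)
  have z: "zt s = (s - 1) * DS (\<lambda>_. 1) s"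
    using zt_eq[OF assms] DS_sums_Suc[OF d, of s] by (simp add: sums_iff)
  have "(\<lambda>n. ec * (1 * nps (Suc n) s) + (e (Suc n) - ec) * nps (Suc n) s) sums
      (ec * DS (\<lambda>_. 1) s + Lent q (\<lambda>n. e (Suc n) - ec) s)"
    by (intro sums_add sums_mult DS_sums_Suc[OF d] Lent_sums[OF mz_e]) (use assms in auto)
  moreover have "ec * (1 * nps (Suc n) s) + (e (Suc n) - ec) * nps (Suc n) s = e (Suc n) * nps (Suc n) s" for n
    by (simp add: algebra_simps)
  ultimately have "(\<lambda>n. e (Suc n) * nps (Suc n) s) sums (ec * DS (\<lambda>_. 1) s + Lent q (\<lambda>n. e (Suc n) - ec) s)"
    by simp
  from sums_unique2[OF this DS_sums_Suc[OF dsc_bounded[OF norm_e_le assms]]]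
  have "DS e s = ec * DS (\<lambda>_. 1) s + Lent q (\<lambda>n. e (Suc n) - ec) s" by simp
  then show ?thesis by (simp add: W_def z algebra_simps)
qed

lemma e_mult: "e (m * n) = e m * e n" by (simp add: e_eq mult)

lemma e_1: "e 1 = 1" by (simp add: e_def)

end

text \<open>By conjugation a zero of L at 1 + it makes both \<open>A\<close> and \<open>B\<close>
  vanish at 1. These two zeros absorb the double pole of the square of \<open>DS e\<close>, for
  every t including 0, so real characters need no separate treatment. The contradiction sits at 1/2,
  where the reciprocal of \<open>DS e (2 * s)\<close> tends to 0 while positivity keeps the series
  at least 1.\<close>

lemma (in np_char) L_line_nonzero: "L (1 + \<i> * of_real t) \<noteq> 0"
proof
  assume L0: "L (1 + \<i> * of_real t) = 0"
  interpret c: np_char q "\<lambda>n. cnj (chi n)" by (rule np_char_cnj)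
  define u where "u = \<i> * of_real t"
  have Reu: "Re u = 0" and cu: "cnj u = - u" by (auto simp: u_def)
  define A where "A s = L (s + u)" for s
  define B where "B s = c.L (s - u)" for s
  have "(\<lambda>n. cnj (chi (Suc n) * nps (Suc n) (1 + u))) sums cnj (L (1 + u))"
    unfolding sums_cnj by (rule L_sums) (simp add: Reu)
  moreover have "(\<lambda>n. cnj (chi (Suc n)) * nps (Suc n) (1 - u)) sums c.L (1 - u)"
    by (rule c.L_sums) (simp add: Reu)
  ultimately have "c.L (1 - u) = cnj (L (1 + u))"
    using sums_unique2 by (simp only: complex_cnj_mult cnj_nps complex_cnj_add complex_cnj_one cu diff_conv_add_uminus)
  then have A1: "A 1 = 0" and B1: "B 1 = 0" using L0 by (simp_all add: A_def B_def u_def)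
  have holA: "A holomorphic_on S" for S
  proof -
    have "(L \<circ> (\<lambda>s. s + u)) holomorphic_on S"
      by (rule holomorphic_on_compose_gen[OF _ L_holomorphic[of UNIV]]) (intro holomorphic_intros, simp)
    then show ?thesis by (simp add: A_def[abs_def] o_def)
  qed
  have holB: "B holomorphic_on S" for S
  proof -
    have "(c.L \<circ> (\<lambda>s. s - u)) holomorphic_on S"
      by (rule holomorphic_on_compose_gen[OF _ c.L_holomorphic[of UNIV]]) (intro holomorphic_intros, simp)
    then show ?thesis by (simp add: B_def[abs_def] o_def)
  qed
  define A' where "A' = (\<lambda>z. if z = 1 then deriv A 1 else (A z - A 1) / (z - 1))"
  define B' where "B' = (\<lambda>z. if z = 1 then deriv B 1 else (B z - B 1) / (z - 1))"
  have holA': "A' holomorphic_on UNIV" and holB': "B' holomorphic_on UNIV"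
    unfolding A'_def B'_def by (rule pole_lemma_open[OF _ open_UNIV]; rule holA holB)+
  have AA: "(s - 1) * A' s = A s" and BB: "(s - 1) * B' s = B s" for s
    using A1 B1 by (auto simp: A'_def B'_def)
  define \<psi> where "\<psi> n = chi n * nps n u" for n
  define g where "g n = e n * of_real ((cmod (\<Sum>a | a dvd n. \<psi> a))\<^sup>2)" for n
  define M where "M = DS (\<lambda>n. mob n * e n)"
  have npsu: "nps n u * cnj (nps n u) = (if n = 0 then 0 else 1)" for n
    using norm_nps[of n u] by (simp add: complex_norm_square[symmetric] Reu)
  have e\<psi>: "e n = \<psi> n * cnj (\<psi> n)" for n
  proof -
    have "\<psi> n * cnj (\<psi> n) = e n * (nps n u * cnj (nps n u))"
      by (simp add: \<psi>_def e_eq mult_ac)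
    also have "\<dots> = e n"
    proof (cases "n = 0")
      case True
      \<comment> \<open>Index 0 is coprime to q only when q = 1, and \<open>sum0\<close> excludes
        that.\<close>
      have "e 0 = 0"
      proof (rule ccontr)
        assume "e 0 \<noteq> 0"
        then have "q = 1" by (simp add: e_def split: if_splits)
        then show False using sum0 zero_iff[of 0] by simp
      qed
      then show ?thesis using True by simp
    qed (simp add: npsu)
    finally show ?thesis by simp
  qed
  have ee: "e n * e n = e n" for n by (simp add: e_def)
  have e\<psi>2: "e n * \<psi> n = \<psi> n" for n
    using zero_iff[of n] by (simp add: e_def \<psi>_def)
  have \<psi>_mult: "\<psi> (m * n) = \<psi> m * \<psi> n" for m n
    by (simp add: \<psi>_def mult nps_mult del: of_nat_mult)
  have key: "dsc g (Re s)" "DS g s = (DS e s)\<^sup>2 * A s * B s * M (2 * s)" if s: "Re s > 1" for s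
  proof -
    have hA: "((\<lambda>n. \<psi> n * nps n s) has_sum A s) {0<..}"
    proof -
      have "((\<lambda>n. chi n * nps n (s + u)) has_sum L (s + u)) {0<..}"
        using DS_has_sum_pos[OF dsc_char[of "Re s"], of "s + u"] s Reu by (simp add: L_eq_DS)
      then show ?thesis unfolding nps_shift by (simp add: \<psi>_def A_def mult_ac)
    qed
    have hB: "((\<lambda>n. cnj (\<psi> n) * nps n s) has_sum B s) {0<..}"
    proof -
      have "((\<lambda>n. cnj (chi n) * nps n (s + (- u))) has_sum c.L (s + (- u))) {0<..}"
        using DS_has_sum_pos[OF c.dsc_char[of "Re s"], of "s - u"] s Reu by (simp add: c.L_eq_DS)
      then show ?thesis unfolding nps_shift by (simp add: \<psi>_def B_def mult_ac cnj_nps cu)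
    qed
    have he: "((\<lambda>n. e n * nps n s) has_sum DS e s) {0<..}"
      by (rule DS_has_sum_pos[OF dsc_bounded[OF norm_e_le s]]) simp
    have "((\<lambda>(x, y, z, w). (e x * nps x s) * ((e y * nps y s) * ((\<psi> z * nps z s) * (cnj (\<psi> w) * nps w s)))) has_sum
        (DS e s * (DS e s * (A s * B s)))) ({0<..} \<times> {0<..} \<times> {0<..} \<times> {0<..})"
      using has_sum_product_complex[OF he has_sum_product_complex[OF he has_sum_product_complex[OF hA hB]]]
      by (simp add: case_prod_unfold)
    from ramanujan_has_sum[OF \<psi>_mult e\<psi> ee e\<psi>2 this]
    have R: "((\<lambda>(f, n). (e f * nps f (2 * s)) * (g n * nps n s)) has_sum (DS e s * (DS e s * (A s * B s)))) ({0<..} \<times> {0<..})"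
      by (simp add: g_def)
    have "(\<lambda>(f, n). (e f * nps f (2 * s)) * (g n * nps n s)) summable_on ({0<..} \<times> {0<..})"
      using R by (rule has_sum_imp_summable)
    from summable_on_SigmaD1[OF this, of 1]
    have sg: "(\<lambda>n. g n * nps n s) summable_on {0<..}" by (simp add: e_def)
    also have "?this \<longleftrightarrow> (\<lambda>n. g n * nps n s) summable_on UNIV"
      by (rule summable_on_cong_neutral) auto
    finally have "(\<lambda>n. norm (g n * nps n s)) summable_on UNIV"
      by (simp add: summable_on_iff_abs_summable_on_complex)
    then show d: "dsc g (Re s)"
      unfolding dsc_def by (auto dest: summable_on_imp_summable simp: norm_mult norm_nps)
    have hg: "((\<lambda>n. g n * nps n s) has_sum DS g s) {0<..}"
      by (rule DS_has_sum_pos[OF d]) simp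
    have he2: "((\<lambda>n. e n * nps n (2 * s)) has_sum DS e (2 * s)) {0<..}"
      by (rule DS_has_sum_pos[OF dsc_bounded[OF norm_e_le s]]) (use s in simp)
    have "DS e (2 * s) * DS g s = DS e s * (DS e s * (A s * B s))"
      using has_sum_unique[OF has_sum_product_complex[OF he2 hg] R] .
    moreover have "DS e (2 * s) * M (2 * s) = 1"
      unfolding M_def by (rule DS_mobius[OF e_mult e_1 norm_e_le]) (use s in simp)
    ultimately show "DS g s = (DS e s)\<^sup>2 * A s * B s * M (2 * s)"
      by (metis (no_types, opaque_lifting) mult.assoc mult.commute mult.right_neutral power2_eq_square)
  qed
  \<comment> \<open>The factors s - 1 in the square of \<open>W\<close> cancel the denominators of
    \<open>A'\<close> and \<open>B'\<close>, so \<open>N\<close> continues \<open>DS g\<close>; the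
    new boundary 1/2 comes from \<open>M (2 * s)\<close>.\<close>
  define N where "N s = (W s)\<^sup>2 * A' s * B' s * M (2 * s)" for s
  have NDS: "N s = DS g s" if "Re s > 1" for s
    using that by (simp add: N_def key W_eq AA[symmetric] BB[symmetric] power2_eq_square)
  have holM: "M holomorphic_on {s. Re s > 1}"
  proof -
    have "cmod (mob n * e n) \<le> 1" for n
      using abs_mob_le[of n] norm_e_le[of n] by (simp add: norm_mult mult_le_one)
    then have "M holomorphic_on {s. Re s > \<sigma>}" if "\<sigma> > 1" for \<sigma>
      unfolding M_def by (intro DS_holomorphic dsc_bounded[of _ 1] that)
    then have "M field_differentiable at s" if "Re s > 1" for s
      by (rule holomorphic_on_imp_differentiable_at[OF _ halfplane_open, of _ "(1 + Re s) / 2"]) (use that in auto)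
    then show ?thesis by (auto intro: holomorphic_onI field_differentiable_at_within)
  qed
  have holN: "N holomorphic_on {s. Re s > 1/2}"
  proof -
    have "(M \<circ> (\<lambda>s. 2 * s)) holomorphic_on {s. Re s > 1/2}"
      by (rule holomorphic_on_compose_gen[OF _ holM]) (auto intro!: holomorphic_intros)
    then show ?thesis unfolding N_def o_def
      by (intro holomorphic_intros holomorphic_on_subset[OF W_holomorphic]
          holomorphic_on_subset[OF holA'] holomorphic_on_subset[OF holB']) auto
  qed
  have g1: "g 1 = 1" by (simp add: g_def \<psi>_def e_def one[simplified])
  have gge: "\<exists>r\<ge>0. g n = of_real r" for n
    by (rule exI[of _ "if coprime n q then (cmod (\<Sum>a | a dvd n. \<psi> a))\<^sup>2 else 0"]) (simp add: g_def e_def)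
  \<comment> \<open>The disc of radius 3/2 about 2 just reaches 1/2. Left of 2 the sign of (\<sigma>
    - 2)^k cancels that of (- ln n)^k, so every contribution to the Taylor series is nonnegative,
    and n = 1, k = 0 contributes 1.\<close>
  have Nge: "Re (N (of_real \<sigma>)) \<ge> 1" if \<sigma>: "1/2 < \<sigma>" "\<sigma> < 1" for \<sigma>
  proof -
    have dg: "dsc g (3/2)" using key(1)[of "3/2"] by simp
    have dN: "(deriv ^^ k) N 2 = (deriv ^^ k) (DS g) 2" for k
    proof (rule higher_deriv_transform_within_open[of _ "{s. Re s > 3/2}"])
      show "N holomorphic_on {s. Re s > 3/2}" by (rule holomorphic_on_subset[OF holN]) auto
      show "DS g holomorphic_on {s. Re s > 3/2}" by (rule DS_holomorphic[OF dg])
      show "open {s. Re s > 3/2}" by (rule halfplane_open)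
    qed (use NDS in auto)
    have sub: "ball 2 (3/2) \<subseteq> {s. Re s > 1/2}"
    proof
      fix z :: complex assume "z \<in> ball 2 (3/2)"
      then have "\<bar>Re (2 - z)\<bar> < 3/2" using abs_Re_le_cmod[of "2 - z"] by (simp add: dist_norm)
      then have "\<bar>2 - Re z\<bar> < 3/2" by simp
      then have "Re z > 1/2" by linarith
      then show "z \<in> {s. Re s > 1/2}" by simp
    qed
    have "(\<lambda>k. (deriv ^^ k) N 2 / fact k * (of_real \<sigma> - 2) ^ k) sums N (of_real \<sigma>)"
    proof (rule holomorphic_power_series)
      show "N holomorphic_on ball 2 (3/2)" by (rule holomorphic_on_subset[OF holN sub])
      have "dist 2 (complex_of_real \<sigma>) = \<bar>2 - \<sigma>\<bar>"
        by (metis dist_norm norm_of_real of_real_diff of_real_numeral real_norm_def)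
      then show "complex_of_real \<sigma> \<in> ball 2 (3/2)" using \<sigma> by simp
    qed
    then have sR: "(\<lambda>k. Re ((deriv ^^ k) N 2 / fact k * (of_real \<sigma> - 2) ^ k)) sums Re (N (of_real \<sigma>))"
      by (rule sums_Re)
    have pos: "(if k = 0 then 1 else 0) \<le> Re ((deriv ^^ k) N 2 / fact k * (of_real \<sigma> - 2) ^ k)" for k
    proof -
      define h where "h n = g n * of_real (- ln (real n)) ^ k * nps n 2 * ((of_real \<sigma> - 2) ^ k / fact k)" for n
      have "(\<lambda>n. g n * of_real (- ln (real n)) ^ k * nps n 2) sums (deriv ^^ k) N 2"
        unfolding dN by (rule DS_higher_deriv[OF dg]) simp
      from sums_mult2[OF this, of "(of_real \<sigma> - 2) ^ k / fact k"]
      have "h sums ((deriv ^^ k) N 2 / fact k * (of_real \<sigma> - 2) ^ k)"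
        by (simp add: h_def[abs_def])
      then have s: "(\<lambda>n. Re (h n)) sums Re ((deriv ^^ k) N 2 / fact k * (of_real \<sigma> - 2) ^ k)"
        by (rule sums_Re)
      have ge: "(if n = 1 then (if k = 0 then 1 else 0) else 0) \<le> Re (h n)" for n
      proof (cases "n = 0")
        case False
        obtain r where r: "r \<ge> 0" "g n = of_real r" using gge by blast
        define w where "w = real n powr - 2"
        have w: "w \<ge> 0" by (simp add: w_def)
        have n2: "nps n 2 = of_real w"
          unfolding w_def using powr_of_real[of "real n" "-2"] by simp
        have "h n = of_real (r * w * (((- ln (real n)) ^ k * (\<sigma> - 2) ^ k) / fact k))"
          unfolding h_def r n2 by simp
        also have "(- ln (real n)) ^ k * (\<sigma> - 2) ^ k = (ln (real n) * (2 - \<sigma>)) ^ k"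
          unfolding power_mult_distrib[symmetric] by (rule arg_cong[where f = "\<lambda>x. x ^ k"]) (simp add: algebra_simps)
        finally have hn: "Re (h n) = r * w * ((ln (real n) * (2 - \<sigma>)) ^ k / fact k)"
          by (metis Re_complex_of_real)
        show ?thesis
        proof (cases "n = 1 \<and> k = 0")
          case True
          then have "r = 1" using r g1 by simp
          then show ?thesis unfolding hn using True by (simp add: w_def)
        next
          case F: False
          have "0 \<le> ln (real n) * (2 - \<sigma>)" using False \<sigma> by (intro mult_nonneg_nonneg) auto
          then have "0 \<le> r * w * ((ln (real n) * (2 - \<sigma>)) ^ k / fact k)"
            using r w by simp
          then show ?thesis unfolding hn using F by auto
        qed
      qed (simp add: h_def)
      have "(\<lambda>n::nat. if n = 1 then (if k = 0 then 1 else 0) else 0 :: real) sums (if k = 0 then 1 else 0)"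
        using sums_single[of 1 "\<lambda>_. if k = 0 then 1 else 0 :: real"] by simp
      from sums_le[OF ge this s] show ?thesis .
    qed
    have "(\<lambda>k::nat. if k = 0 then 1 else 0 :: real) sums 1"
      using sums_single[of 0 "\<lambda>_. 1 :: real"] by simp
    from sums_le[OF pos this sR] show ?thesis .
  qed
  \<comment> \<open>\<open>N\<close> with \<open>M (2 * s)\<close> rewritten as
    \<open>(2 * s - 1) / W (2 * s)\<close>, an expression that is continuous at 1/2 and vanishes
    there.\<close>
  define f where "f s = (W s)\<^sup>2 * A' s * B' s * ((2 * s - 1) / W (2 * s))" for s
  have cW: "isCont W z" if "Re z > 0" for z
    using continuous_on_eq_continuous_at[OF halfplane_open[of 0]] holomorphic_on_imp_continuous_on[OF W_holomorphic] that
    by blast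
  have cA: "isCont A' z" and cB: "isCont B' z" for z
    using continuous_on_eq_continuous_at[OF open_UNIV] holomorphic_on_imp_continuous_on[OF holA']
      holomorphic_on_imp_continuous_on[OF holB'] by blast+
  have "isCont (\<lambda>s. W (2 * s)) (1/2)"
    using isCont_o2[of "1/2" "\<lambda>s. 2 * s" W] cW[of 1] by simp
  then have cf: "isCont f (1/2)"
    unfolding f_def by (intro continuous_intros cW cA cB) (auto simp: W_1 ec_neq_0)
  \<comment> \<open>Three successors keep \<open>\<sigma> m\<close> below 1; with two, the value at
    m = 0 would be 1.\<close>
  define \<sigma> where "\<sigma> m = 1/2 + inverse (real (Suc (Suc (Suc m))))" for m
  define X where "X m = complex_of_real (\<sigma> m)" for m
  have "X \<longlonglongrightarrow> of_real (1/2 + 0)" unfolding X_def \<sigma>_def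
    by (intro tendsto_of_real tendsto_add tendsto_const LIMSEQ_Suc[OF LIMSEQ_Suc[OF LIMSEQ_inverse_real_of_nat]])
  then have "X \<longlonglongrightarrow> 1/2" by simp
  from isCont_tendsto_compose[OF cf this] have "(\<lambda>m. f (X m)) \<longlonglongrightarrow> 0"
    by (simp add: f_def)
  then have lim: "(\<lambda>m. Re (f (X m))) \<longlonglongrightarrow> Re 0" by (rule tendsto_Re)
  have ge: "1 \<le> Re (f (X m))" for m
  proof -
    have \<sigma>: "1/2 < \<sigma> m" "\<sigma> m < 1" by (auto simp: \<sigma>_def field_simps)
    let ?w = "2 * X m"
    have w: "Re ?w > 1" using \<sigma> by (simp add: X_def)
    then have "?w \<noteq> 1" using one_complex.sel(1) by force
    then have w1: "?w - 1 \<noteq> 0" by simp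
    have DM: "DS e ?w * M ?w = 1"
      unfolding M_def by (rule DS_mobius[OF e_mult e_1 norm_e_le w])
    have "M ?w = (?w - 1) / W ?w"
      unfolding W_eq[OF w] using DM w1 by (auto simp: divide_simps mult_ac)
    then have "f (X m) = N (X m)" by (simp only: f_def N_def)
    then show ?thesis using Nge[OF \<sigma>] by (simp add: X_def)
  qed
  have "1 \<le> Re 0"
    by (rule tendsto_lowerbound[OF lim]) (use ge in auto)
  then show False by simp
qed

section \<open>Short approximations of the reciprocal under GRH\<close>

text \<open>The map w / (2A - w) sends the half plane Re w < A into the unit disc and fixes 0.
  Schwarz's lemma bounds its composite with f by |z - c| / R; solving for |f z| gives the
  claim.\<close>

lemma borel_caratheodory:
  assumes hol: "f holomorphic_on ball c R" and f0: "f c = 0"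
    and Re: "\<And>z. z \<in> ball c R \<Longrightarrow> Re (f z) < A"
    and z: "dist c z \<le> r" "r < R"
  shows "cmod (f z) * (R - r) \<le> 2 * A * r"
proof -
  have r: "0 \<le> r" using z zero_le_dist order_trans by blast
  then have R: "R > 0" using z by linarith
  have A: "A > 0" using Re[of c] R f0 by simp
  define g where "g w = f (c + of_real R * w) / (2 * of_real A - f (c + of_real R * w))" for w
  have mem: "c + of_real R * w \<in> ball c R" if "cmod w < 1" for w
    using that R by (simp add: dist_norm norm_mult)
  have nz: "2 * of_real A - f v \<noteq> 0" if "v \<in> ball c R" for v
    using Re[OF that] A by (auto simp: complex_eq_iff)
  have lt: "cmod (f v) < cmod (2 * of_real A - f v)" if "v \<in> ball c R" for v
  proof -
    have "(Re (f v))\<^sup>2 < (2 * A - Re (f v))\<^sup>2"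
      using Re[OF that] A by (simp add: power2_eq_square algebra_simps)
    then show ?thesis unfolding cmod_def by simp
  qed
  have "(f \<circ> (\<lambda>w. c + of_real R * w)) holomorphic_on ball 0 1"
    by (rule holomorphic_on_compose_gen[OF _ hol]) (use mem in \<open>auto intro!: holomorphic_intros\<close>)
  then have "(\<lambda>w. f (c + of_real R * w)) holomorphic_on ball 0 1" by (simp add: o_def)
  then have holg: "g holomorphic_on ball 0 1"
    unfolding g_def by (intro holomorphic_intros) (use nz mem in auto)
  have gn: "cmod (g w) < 1" if "cmod w < 1" for w
    using lt[OF mem[OF that]] nz[OF mem[OF that]] by (simp add: g_def norm_divide)
  define w where "w = (z - c) / of_real R"
  have cw: "c + of_real R * w = z" using R by (simp add: w_def)
  have wr: "cmod w * R \<le> r" using z(1) R by (simp add: w_def norm_divide dist_norm norm_minus_commute)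
  then have "cmod w * R < 1 * R" using z by linarith
  then have w1: "cmod w < 1" using R by simp
  have "cmod (g w) \<le> cmod w"
    by (rule Schwarz_Lemma(1)[OF holg _ gn w1]) (auto simp: g_def f0)
  then have "cmod (f z) \<le> cmod w * cmod (2 * of_real A - f z)"
    using nz[OF mem[OF w1]] unfolding cw by (simp add: g_def cw norm_divide divide_le_eq)
  also have "\<dots> \<le> cmod w * (2 * A + cmod (f z))"
    using norm_triangle_ineq4[of "2 * of_real A" "f z"] A by (intro mult_left_mono) auto
  finally have "cmod (f z) * R \<le> cmod w * (2 * A + cmod (f z)) * R"
    using R by (intro mult_right_mono) auto
  also have "\<dots> = (cmod w * R) * (2 * A + cmod (f z))" by simp
  also have "\<dots> \<le> r * (2 * A + cmod (f z))" using wr A by (intro mult_right_mono) auto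
  finally show ?thesis by (simp add: algebra_simps)
qed

text \<open>Rankin's trick: for k < K and y \<le> 1 every term may be multiplied by y^(k-K), which
  is at least 1.\<close>

lemma exp_partial_le:
  fixes x y :: real
  assumes "x \<ge> 0" "0 < y" "y \<le> 1"
  shows "(\<Sum>k<K. x ^ k / fact k) \<le> exp (y * x) / y ^ K"
proof -
  have "(\<Sum>k<K. x ^ k / fact k) \<le> (\<Sum>k<K. ((y * x) ^ k / fact k) / y ^ K)"
  proof (rule sum_mono)
    fix k assume k: "k \<in> {..<K}"
    have "y ^ K \<le> y ^ k" using assms k by (intro power_decreasing) auto
    then have "x ^ k / fact k * y ^ K \<le> x ^ k / fact k * y ^ k"
      using assms by (intro mult_left_mono) auto
    then show "x ^ k / fact k \<le> ((y * x) ^ k / fact k) / y ^ K"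
      using assms by (simp add: pos_le_divide_eq power_mult_distrib mult_ac)
  qed
  also have "\<dots> = (\<Sum>k<K. (y * x) ^ k / fact k) / y ^ K"
    by (simp add: sum_divide_distrib)
  also have "\<dots> \<le> exp (y * x) / y ^ K"
  proof (rule divide_right_mono)
    have "(\<lambda>k. (y * x) ^ k / fact k) sums exp (y * x)"
      using exp_converges[of "y * x"] by (simp add: divide_inverse mult_ac)
    then have "summable (\<lambda>k. (y * x) ^ k / fact k)" "(\<Sum>k. (y * x) ^ k / fact k) = exp (y * x)"
      by (simp_all add: sums_iff)
    then show "(\<Sum>k<K. (y * x) ^ k / fact k) \<le> exp (y * x)"
      using sum_le_suminf[of "\<lambda>k. (y * x) ^ k / fact k" "{..<K}"] assms by simp
  qed (use assms in auto)
  finally show ?thesis .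
qed

text \<open>The same trick on the tail: now k \<ge> K and y \<ge> 1 make y^(k-K) at least 1.\<close>

lemma exp_tail_le:
  fixes x y :: real
  assumes "x \<ge> 0" "y \<ge> 1"
  shows "exp x - (\<Sum>k<K. x ^ k / fact k) \<le> exp (y * x) / y ^ K"
proof -
  have s: "(\<lambda>k. x ^ k / fact k) sums exp x" for x :: real
    using exp_converges[of x] by (simp add: divide_inverse mult_ac)
  have 1: "(\<lambda>k. x ^ (k + K) / fact (k + K)) sums (exp x - (\<Sum>k<K. x ^ k / fact k))"
    by (rule sums_split_initial_segment[OF s])
  have 2: "(\<lambda>k. ((y * x) ^ (k + K) / fact (k + K)) / y ^ K) sums ((exp (y * x) - (\<Sum>k<K. (y * x) ^ k / fact k)) / y ^ K)"
    by (rule sums_divide[OF sums_split_initial_segment[OF s]])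
  have "exp x - (\<Sum>k<K. x ^ k / fact k) \<le> (exp (y * x) - (\<Sum>k<K. (y * x) ^ k / fact k)) / y ^ K"
  proof (rule sums_le[OF _ 1 2])
    fix k
    have "x ^ (k + K) / fact (k + K) * y ^ K \<le> x ^ (k + K) / fact (k + K) * y ^ (k + K)"
      using assms by (intro mult_left_mono power_increasing) auto
    then show "x ^ (k + K) / fact (k + K) \<le> ((y * x) ^ (k + K) / fact (k + K)) / y ^ K"
      using assms by (simp add: pos_le_divide_eq power_mult_distrib mult_ac)
  qed
  also have "\<dots> \<le> exp (y * x) / y ^ K"
    using assms by (intro divide_right_mono) (auto intro!: sum_nonneg)
  finally show ?thesis .
qed

text \<open>As n = exp (ln n), this is the share of the exponential series of ln n carried by its
  first K terms: nearly 1 while ln n is well below K, small far beyond. Division by zero makes it 0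
  at n = 0.\<close>

definition wt :: "nat \<Rightarrow> nat \<Rightarrow> real" where
  "wt K n = (\<Sum>k<K. ln (real n) ^ k / fact k) / real n"

definition uK :: "nat \<Rightarrow> nat \<Rightarrow> real" where
  "uK K n = mob n * wt K n / real n"

lemma wt_nonneg: "wt K n \<ge> 0"
proof (cases "n = 0")
  case False
  then have "ln (real n) \<ge> 0" by simp
  then show ?thesis unfolding wt_def by (intro divide_nonneg_nonneg sum_nonneg zero_le_power) auto
qed (simp add: wt_def)

lemma wt_le_powr:
  assumes "0 < y" "y \<le> 1"
  shows "wt K n \<le> real n powr (y - 1) / y ^ K"
proof (cases "n = 0")
  case False
  have "(\<Sum>k<K. ln (real n) ^ k / fact k) \<le> exp (y * ln (real n)) / y ^ K"
    by (rule exp_partial_le) (use False assms in auto)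
  also have "exp (y * ln (real n)) = real n powr y" using False by (simp add: powr_def)
  finally have "wt K n \<le> real n powr y / y ^ K / real n"
    unfolding wt_def by (intro divide_right_mono) auto
  also have "\<dots> = real n powr (y - 1) / y ^ K"
    using False by (simp add: powr_diff)
  finally show ?thesis .
qed (simp add: wt_def)

lemma wt_le_1: "wt K n \<le> 1"
  using wt_le_powr[of 1 K n] by (cases "n = 0") (auto simp: wt_def)

lemma one_minus_wt_le:
  assumes "n > 0" "y \<ge> 1"
  shows "1 - wt K n \<le> real n powr (y - 1) / y ^ K"
proof -
  have "exp (ln (real n)) - (\<Sum>k<K. ln (real n) ^ k / fact k) \<le> exp (y * ln (real n)) / y ^ K"
    by (rule exp_tail_le) (use assms in auto)
  then have "(real n - (\<Sum>k<K. ln (real n) ^ k / fact k)) / real n \<le> exp (y * ln (real n)) / y ^ K / real n"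
    using assms by (intro divide_right_mono) auto
  also have "exp (y * ln (real n)) = real n powr y" using assms by (simp add: powr_def)
  also have "real n powr y / y ^ K / real n = real n powr (y - 1) / y ^ K"
    using assms by (simp add: powr_diff)
  finally show ?thesis using assms by (simp add: wt_def diff_divide_distrib)
qed

lemma abs_uK_le:
  assumes "0 < y" "y \<le> 1"
  shows "\<bar>uK K n\<bar> \<le> real n powr - (2 - y) / y ^ K"
proof (cases "n = 0")
  case False
  have "\<bar>uK K n\<bar> = \<bar>mob n\<bar> * (wt K n / real n)"
    using wt_nonneg[of K n] by (simp add: uK_def abs_mult)
  also have "\<dots> \<le> 1 * (wt K n / real n)"
    using wt_nonneg[of K n] abs_mob_le[of n] by (intro mult_right_mono) auto
  also have "\<dots> \<le> real n powr (y - 1) / y ^ K / real n"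
    using divide_right_mono[OF wt_le_powr[OF assms, of K n], of "real n"] by simp
  also have "\<dots> = real n powr (y - 2) / y ^ K" using False powr_diff[of "real n" "y - 1" 1] by simp
  finally show ?thesis by (simp add: algebra_simps)
qed (simp add: uK_def)

section \<open>Nonvanishing to the right of 1/2\<close>

context np_char
begin

text \<open>\<open>GRH\<close> covers the open strip, the Moebius series \<open>Re s > 1\<close>,
  and the unconditional result the line between them. \<open>L\<close> qualifies as an f in
  \<open>GRH\<close> because it is entire and given by the series for
  \<open>Re s > 1\<close>.\<close>

lemma L_nonzero:
  assumes GRH and s: "Re s > 1/2"
  shows "L s \<noteq> 0"
proof -
  consider "Re s > 1" | "Re s = 1" | "1/2 < Re s" "Re s < 1" using s by linarith
  then show ?thesis
  proof cases
    case 1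
    then show ?thesis using L_mobius[of s] by auto
  next
    case 2
    then have "s = 1 + \<i> * of_real (Im s)" by (simp add: complex_eq_iff)
    then show ?thesis using L_line_nonzero by metis
  next
    case 3
    have "L s = (\<Sum>n. chi (Suc n) / of_nat (Suc n) powr s)" if "Re s > 1" for s
      using L_sums[of s] that by (simp add: sums_iff powr_minus divide_inverse)
    then have "\<forall>s. 0 < Re s \<and> Re s < 1 \<and> L s = 0 \<longrightarrow> Re s = 1/2"
      using \<open>GRH\<close> dc L_holomorphic[of "- {1}"] unfolding GRH_def by blast
    then show ?thesis using 3 by force
  qed
qed

lemma inverse_L_eq: "Re s > 1 \<Longrightarrow> inverse (L s) = DS (\<lambda>n. mob n * chi n) s"
  using L_mobius[of s] by (metis inverse_unique)

lemma norm_mob_chi: "cmod (mob n * chi n) \<le> 1"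
  using abs_mob_le[of n] norm_le[of n] by (simp add: norm_mult mult_le_one)

lemma L_1_nonzero: "L 1 \<noteq> 0" using L_line_nonzero[of 0] by simp

end

definition Z2 :: real where "Z2 = (\<Sum>n. real n powr - 2)"

text \<open>Belongs to the bound for L on the disc of radius 11/8 about 2: there Re s > 5/8, whence
  the exponent 13/8 = 1 + 5/8, and |s| < 4, whence 8 = 2 * 4.\<close>

definition C0 :: real where "C0 = 1 + 8 * (\<Sum>n. real (Suc n) powr - (13/8))"

lemma Z2_ge: "Z2 \<ge> 1"
proof -
  have "summable (\<lambda>n. real n powr - 2)" by (simp add: summable_real_powr_iff)
  from sum_le_suminf[OF this, of "{1}"] show ?thesis by (simp add: Z2_def)
qed

lemma C0_ge: "C0 \<ge> 1"
proof -
  have "0 \<le> (\<Sum>n. real (Suc n) powr - (13/8))"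
    by (intro suminf_nonneg summable_Suc_powr) auto
  then show ?thesis by (simp add: C0_def)
qed

text \<open>The exponent 20 is 2r / (R - r) from Borel-Caratheodory with R = 11/8 and r = 5/4; the
  base bounds |L / L(2)| on the larger disc.\<close>

definition Bq :: "nat \<Rightarrow> real" where "Bq q = Z2 * (2 * Z2 * C0 * real q) ^ 20"

lemma ball_2_Re: "z \<in> ball 2 r \<Longrightarrow> Re z > 2 - r" "z \<in> ball 2 r \<Longrightarrow> cmod z < 2 + r"
proof -
  assume "z \<in> ball 2 r"
  then have d: "cmod (2 - z) < r" by (simp add: dist_norm)
  then show "Re z > 2 - r" using abs_Re_le_cmod[of "2 - z"] by simp
  show "cmod z < 2 + r" using d norm_triangle_ineq4[of 2 "2 - z"] by simp
qed

section \<open>Size and Taylor expansion of the reciprocal about 2\<close>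

context np_char
begin

lemma inverse_L_2: "cmod (inverse (L 2)) \<le> Z2"
proof -
  have d: "dsc (\<lambda>n. mob n * chi n) 2" by (rule dsc_bounded[OF norm_mob_chi]) simp
  have sm: "summable (\<lambda>n. real n powr - 2)" by (simp add: summable_real_powr_iff)
  have "inverse (L 2) = DS (\<lambda>n. mob n * chi n) 2" by (rule inverse_L_eq) simp
  also have "cmod \<dots> \<le> Z2"
    unfolding DS_def Z2_def
  proof (rule norm_suminf_le[OF _ sm])
    fix n
    have "cmod (mob n * chi n * nps n 2) \<le> cmod (mob n * chi n) * real n powr - 2"
      by (rule norm_nps_le) simp
    also have "\<dots> \<le> 1 * real n powr - 2" by (intro mult_right_mono norm_mob_chi) auto
    finally show "cmod (mob n * chi n * nps n 2) \<le> real n powr - 2" by simp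
  qed
  finally show ?thesis .
qed

lemma L_bound:
  assumes "z \<in> ball 2 (11/8)"
  shows "cmod (L z) \<le> C0 * real q"
proof -
  have "cmod (L z) \<le> real q * (1 + 2 * 4 * (\<Sum>n. real (Suc n) powr - (1 + 5/8)))"
    unfolding L_def by (rule Lent_bound[OF mz norm_le]) (use ball_2_Re[OF assms] in auto)
  then show ?thesis by (simp add: C0_def mult.commute)
qed

text \<open>On a disc without zeros L has a logarithm. Normalised to be 0 at 2, its real part is ln
  |L / L(2)|, bounded above by ln q plus a constant; Borel-Caratheodory turns this one-sided bound
  into one for the modulus, and hence for |L(2) / L|.\<close>

lemma inverse_L_bound:
  assumes GRH and z: "dist 2 z \<le> 5/4"
  shows "cmod (inverse (L z)) \<le> Bq q"
proof -
  have nz: "L v \<noteq> 0" if "v \<in> ball 2 (11/8)" for v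
    by (rule L_nonzero[OF \<open>GRH\<close>]) (use ball_2_Re(1)[OF that] in simp)
  have "contractible (ball (2::complex) (11/8))" by (intro convex_imp_contractible convex_ball)
  then obtain g where g: "g holomorphic_on ball 2 (11/8)" "\<And>v. v \<in> ball 2 (11/8) \<Longrightarrow> L v = exp (g v)"
    using contractible_imp_holomorphic_log[OF L_holomorphic _ nz] by metis
  \<comment> \<open>The factor 2 is slack that makes the bound on the real part strict.\<close>
  define Q where "Q = 2 * Z2 * C0 * real q"
  define f where "f v = g v - g 2" for v
  have q1: "real q \<ge> 1" using q_pos by simp
  have "1 * 1 \<le> Z2 * C0" using Z2_ge C0_ge by (intro mult_mono) auto
  then have "1 * 1 \<le> (Z2 * C0) * real q" using q1 by (intro mult_mono) auto
  then have Q: "Q \<ge> 2" by (simp add: Q_def)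
  have expf: "exp (f v) = L v * inverse (L 2)" if "v \<in> ball 2 (11/8)" for v
  proof -
    have g2: "L 2 = exp (g 2)" by (rule g(2)) simp
    show ?thesis unfolding f_def g2 g(2)[OF that] exp_diff divide_inverse ..
  qed
  have Ref: "Re (f v) < ln Q" if "v \<in> ball 2 (11/8)" for v
  proof -
    have "exp (Re (f v)) = cmod (L v) * cmod (inverse (L 2))"
      by (simp only: norm_exp_eq_Re[symmetric] expf[OF that] norm_mult)
    also have "\<dots> \<le> (C0 * real q) * Z2"
      using L_bound[OF that] inverse_L_2 C0_ge by (intro mult_mono) auto
    also have "\<dots> < Q" using Q by (simp add: Q_def mult_ac)
    finally have "ln (exp (Re (f v))) < ln Q" using Q by (subst ln_less_cancel_iff) auto
    then show ?thesis by simp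
  qed
  have "cmod (f z) * (11/8 - 5/4) \<le> 2 * ln Q * (5/4)"
  proof (rule borel_caratheodory[OF _ _ Ref z])
    show "f holomorphic_on ball 2 (11/8)"
      unfolding f_def[abs_def] by (intro holomorphic_intros g(1))
  qed (simp_all add: f_def)
  then have fz: "cmod (f z) \<le> 20 * ln Q" by simp
  have zb: "z \<in> ball 2 (11/8)" using z by simp
  have "inverse (L z) = inverse (L 2) * exp (- f z)"
    unfolding exp_minus expf[OF zb] using nz[of 2] by simp
  then have "cmod (inverse (L z)) = cmod (inverse (L 2)) * exp (Re (- f z))"
    by (simp only: norm_mult norm_exp_eq_Re)
  also have "\<dots> \<le> Z2 * exp (20 * ln Q)"
    using fz abs_Re_le_cmod[of "f z"] Z2_ge by (intro mult_mono inverse_L_2) auto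
  also have "exp (20 * ln Q) = Q ^ 20"
    using Q exp_of_nat_mult[of 20 "ln Q"] by simp
  finally show ?thesis by (simp add: Bq_def Q_def)
qed

text \<open>The expansion at 2 is evaluated at 1, at distance 1 < 5/4. Cauchy's estimate bounds the
  k-th term by \<open>Bq q * (4/5) ^ k\<close>, and 5 is the sum of the geometric series. The sign
  of (1 - 2)^k cancels that of (- ln n)^k, so the first K terms add up to the coefficients
  \<open>uK\<close>.\<close>

lemma inverse_L_approx:
  assumes GRH
  obtains P where "(\<lambda>n. chi n * uK K n) sums P" "cmod (inverse (L 1) - P) \<le> 5 * Bq q * (4/5) ^ K"
proof -
  define M where "M s = inverse (L s)" for s
  have holM: "M holomorphic_on {s. Re s > 1/2}"
    unfolding M_def by (intro holomorphic_intros L_holomorphic) (use L_nonzero[OF \<open>GRH\<close>] in auto)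
  define c where "c k = (deriv ^^ k) M 2 / fact k * (1 - 2) ^ k" for k
  have d: "dsc (\<lambda>n. mob n * chi n) (3/2)" by (rule dsc_bounded[OF norm_mob_chi]) simp
  have dM: "(deriv ^^ k) M 2 = (deriv ^^ k) (DS (\<lambda>n. mob n * chi n)) 2" for k
  proof (rule higher_deriv_transform_within_open[of _ "{s. Re s > 3/2}"])
    show "M holomorphic_on {s. Re s > 3/2}" by (rule holomorphic_on_subset[OF holM]) auto
    show "DS (\<lambda>n. mob n * chi n) holomorphic_on {s. Re s > 3/2}" by (rule DS_holomorphic[OF d])
    show "open {s. Re s > 3/2}" by (rule halfplane_open)
  qed (auto simp: M_def inverse_L_eq)
  have cs: "(\<lambda>n. chi n * of_real (mob n * (ln (real n) ^ k / fact k) / (real n)\<^sup>2)) sums c k" for k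
  proof -
    have "(\<lambda>n. mob n * chi n * of_real (- ln (real n)) ^ k * nps n 2) sums (deriv ^^ k) M 2"
      unfolding dM by (rule DS_higher_deriv[OF d]) simp
    from sums_mult2[OF this, of "(-1) ^ k / fact k"]
    have "(\<lambda>n. mob n * chi n * of_real (- ln (real n)) ^ k * nps n 2 * ((-1) ^ k / fact k)) sums c k"
      by (simp add: c_def)
    moreover have "mob n * chi n * of_real (- ln (real n)) ^ k * nps n 2 * ((-1) ^ k / fact k) =
        chi n * of_real (mob n * (ln (real n) ^ k / fact k) / (real n)\<^sup>2)" for n
    proof (cases "n = 0")
      case False
      have "nps n 2 = of_real (real n powr - 2)"
        using powr_of_real[of "real n" "-2"] by simp
      also have "real n powr - 2 = 1 / (real n)\<^sup>2"
        using False by (simp add: powr_minus_divide)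
      finally have n2: "nps n 2 = of_real (1 / (real n)\<^sup>2)" .
      have "(- ln (real n)) ^ k * (-1) ^ k = ln (real n) ^ k"
        unfolding power_mult_distrib[symmetric] by simp
      then have sgn: "of_real (- ln (real n)) ^ k * (-1) ^ k = (of_real (ln (real n)) ^ k :: complex)"
        by (metis of_real_1 of_real_minus of_real_mult of_real_power)
      have "mob n * chi n * of_real (- ln (real n)) ^ k * nps n 2 * ((-1) ^ k / fact k) =
        mob n * chi n * (of_real (- ln (real n)) ^ k * (-1) ^ k) * nps n 2 / fact k" by simp
      also have "\<dots> = chi n * of_real (mob n * (ln (real n) ^ k / fact k) / (real n)\<^sup>2)"
        unfolding sgn n2 by (simp add: mult_ac)
      finally show ?thesis .
    qed simp
    ultimately show ?thesis by simp
  qed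
  define P where "P = (\<Sum>k<K. c k)"
  have "(\<lambda>n. \<Sum>k<K. chi n * of_real (mob n * (ln (real n) ^ k / fact k) / (real n)\<^sup>2)) sums P"
    unfolding P_def by (rule sums_sum) (rule cs)
  moreover have "(\<Sum>k<K. chi n * of_real (mob n * (ln (real n) ^ k / fact k) / (real n)\<^sup>2)) = chi n * uK K n" for n
    unfolding sum_distrib_left[symmetric] of_real_sum[symmetric] sum_divide_distrib[symmetric]
    by (simp add: uK_def wt_def power2_eq_square)
  ultimately have 1: "(\<lambda>n. chi n * uK K n) sums P" by simp
  have cont: "continuous_on (cball 2 (5/4)) M"
  proof -
    have "cball (2::complex) (5/4) \<subseteq> {s. Re s > 1/2}"
      using ball_2_Re(1)[of _ "3/2"] by auto
    then show ?thesis
      using holM holomorphic_on_imp_continuous_on continuous_on_subset by blast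
  qed
  have cb: "cmod (c k) \<le> Bq q * (4/5) ^ k" for k
  proof -
    have "cmod ((deriv ^^ k) M 2) \<le> fact k * Bq q / (5/4) ^ k"
    proof (rule Cauchy_inequality[OF _ cont])
      show "M holomorphic_on ball 2 (5/4)"
        by (rule holomorphic_on_subset[OF holM]) (use ball_2_Re(1)[of _ "5/4"] in fastforce)
      fix x :: complex assume "cmod (2 - x) = 5/4"
      then show "cmod (M x) \<le> Bq q"
        unfolding M_def by (intro inverse_L_bound[OF \<open>GRH\<close>]) (simp add: dist_norm)
    qed simp
    then show ?thesis
      by (simp add: c_def norm_mult norm_divide norm_power divide_le_eq power_divide mult_ac)
  qed
  have "c sums M 1"
    unfolding c_def
  proof (rule holomorphic_power_series)
    show "M holomorphic_on ball 2 (3/2)"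
      by (rule holomorphic_on_subset[OF holM]) (use ball_2_Re(1)[of _ "3/2"] in fastforce)
    show "1 \<in> ball (2::complex) (3/2)" by (simp add: dist_norm)
  qed
  from sums_split_initial_segment[OF this, of K]
  have tail: "(\<lambda>k. c (k + K)) sums (M 1 - P)" by (simp add: P_def)
  have geo: "(\<lambda>k. Bq q * (4/5) ^ K * (4/5) ^ k) sums (Bq q * (4/5) ^ K * (1 / (1 - 4/5)))"
    by (intro sums_mult geometric_sums) simp
  have "cmod (M 1 - P) \<le> (\<Sum>k. Bq q * (4/5) ^ K * (4/5) ^ k)"
    unfolding sums_unique[OF tail]
  proof (rule norm_suminf_le)
    show "cmod (c (k + K)) \<le> Bq q * (4/5) ^ K * (4/5) ^ k" for k
      using cb[of "k + K"] unfolding power_add by (simp only: mult_ac)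
  qed (rule sums_summable[OF geo])
  also have "\<dots> = 5 * Bq q * (4/5) ^ K"
    using geo by (simp add: sums_iff)
  finally show ?thesis using that 1 by (simp add: M_def)
qed

end

section \<open>The dual system of the translates of a function on a cyclic group\<close>

definition om :: "nat \<Rightarrow> int \<Rightarrow> complex" where
  "om N a = cis (2 * pi * of_int a / of_nat N)"

lemma om_add: "om N (a + b) = om N a * om N b"
  by (simp add: om_def cis_mult ring_distribs add_divide_distrib)

lemma om_0 [simp]: "om N 0 = 1" by (simp add: om_def)

lemma cnj_om: "cnj (om N a) = om N (- a)"
  by (simp add: om_def cis_cnj)

lemma norm_om [simp]: "cmod (om N a) = 1" by (simp add: om_def)

lemma om_power: "om N (a * int k) = om N a ^ k"
  by (simp add: om_def Complex.DeMoivre mult_ac)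

lemma om_eq_1_iff:
  assumes "N > 0"
  shows "om N a = 1 \<longleftrightarrow> int N dvd a"
proof
  assume "om N a = 1"
  then have "cos (2 * pi * of_int a / of_nat N) = 1" by (simp add: om_def complex_eq_iff)
  then obtain m :: int where "2 * pi * of_int a / of_nat N = of_int m * 2 * pi"
    using cos_one_2pi_int by blast
  then have "of_int a = real N * of_int m" using assms by (simp add: field_simps)
  then have "real_of_int a = real_of_int (int N * m)" by simp
  then have "a = int N * m" by (simp only: of_int_eq_iff)
  then show "int N dvd a" by simp
next
  assume "int N dvd a"
  then obtain m where "a = int N * m" by blast
  then have "2 * pi * of_int a / of_nat N = 2 * pi * of_int m" using assms by simp
  then show "om N a = 1" unfolding om_def by (simp add: cis_multiple_2pi)
qed

lemma om_cong:
  assumes "N > 0" "[a = b] (mod int N)"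
  shows "om N a = om N b"
proof -
  have "int N dvd a - b" using assms by (simp add: cong_iff_dvd_diff)
  then have "om N (a - b) = 1" using assms by (simp add: om_eq_1_iff)
  then show ?thesis using om_add[of N "a - b" b] by simp
qed

lemma om_sum:
  assumes "N > 0"
  shows "(\<Sum>k<N. om N (a * int k)) = (if int N dvd a then of_nat N else 0)"
proof (cases "int N dvd a")
  case True
  then have "om N a = 1" using assms by (simp add: om_eq_1_iff)
  then show ?thesis using True by (simp add: om_power)
next
  case False
  then have 1: "om N a \<noteq> 1" using assms by (simp add: om_eq_1_iff)
  have "om N a ^ N = 1"
    unfolding om_power[symmetric] using assms by (subst om_eq_1_iff) auto
  then show ?thesis using False 1 by (simp add: om_power geometric_sum)
qed

lemma dvd_int_diff_iff:
  assumes "k < N" "l < N"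
  shows "int N dvd int k - int l \<longleftrightarrow> k = l"
proof
  assume "int N dvd int k - int l"
  then have "[k = l] (mod N)" by (simp add: cong_iff_dvd_diff flip: cong_int_iff)
  then show "k = l" using assms by (simp add: cong_def)
qed simp

lemma om_parseval:
  fixes c :: "nat \<Rightarrow> complex"
  assumes "N > 0"
  shows "(\<Sum>a<N. (cmod (\<Sum>k<N. c k * om N (int a * int k)))\<^sup>2) = real N * (\<Sum>k<N. (cmod (c k))\<^sup>2)"
proof -
  have "complex_of_real (\<Sum>a<N. (cmod (\<Sum>k<N. c k * om N (int a * int k)))\<^sup>2)
     = (\<Sum>a<N. (\<Sum>k<N. c k * om N (int a * int k)) * (\<Sum>l<N. cnj (c l) * om N (- (int a * int l))))"
    unfolding of_real_sum complex_norm_square cnj_sum complex_cnj_mult cnj_om ..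
  also have "\<dots> = (\<Sum>a<N. \<Sum>k<N. \<Sum>l<N. c k * cnj (c l) * om N ((int k - int l) * int a))"
    unfolding sum_product
  proof (intro sum.cong refl)
    fix a k l
    have "(int k - int l) * int a = int a * int k + (- (int a * int l))" by (simp add: algebra_simps)
    then show "c k * om N (int a * int k) * (cnj (c l) * om N (- (int a * int l))) =
       c k * cnj (c l) * om N ((int k - int l) * int a)"
      by (simp only: om_add mult_ac)
  qed
  also have "\<dots> = (\<Sum>k<N. \<Sum>l<N. \<Sum>a<N. c k * cnj (c l) * om N ((int k - int l) * int a))"
    by (subst sum.swap, rule sum.cong[OF refl], subst sum.swap, rule refl)
  also have "\<dots> = (\<Sum>k<N. \<Sum>l<N. if l = k then of_nat N * (c k * cnj (c k)) else 0)"
    unfolding sum_distrib_left[symmetric] om_sum[OF assms]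
    by (intro sum.cong refl) (auto simp: dvd_int_diff_iff)
  also have "\<dots> = (\<Sum>k<N. of_nat N * (c k * cnj (c k)))"
    by (intro sum.cong refl) simp
  also have "\<dots> = complex_of_real (real N * (\<Sum>k<N. (cmod (c k))\<^sup>2))"
    by (simp add: sum_distrib_left complex_norm_square[symmetric])
  finally show ?thesis unfolding of_real_eq_iff .
qed

lemma sum_periodic_shift:
  fixes G :: "nat \<Rightarrow> 'a :: ab_group_add"
  assumes "\<And>k. G (k + N) = G k"
  shows "(\<Sum>k<N. G (k + z)) = (\<Sum>k<N. G k)"
proof (induction z)
  case (Suc z)
  have "(\<Sum>k<Suc N. G (k + z)) = G (0 + z) + (\<Sum>k<N. G (Suc k + z))"
    by (rule sum.lessThan_Suc_shift)
  moreover have "G (N + z) = G z" using assms[of z] by (simp add: add.commute)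
  ultimately have "(\<Sum>k<N. G (Suc k + z)) = (\<Sum>k<N. G (k + z))" by simp
  then show ?case using Suc by simp
qed simp

text \<open>The dual system of the translates of a function \<open>F\<close> on a cyclic group, modulo constants:
  in Fourier space the Gram matrix of the translates is diagonal with entries \<open>cmod (dft a) ^ 2\<close>,
  and \<open>Cc\<close> is its inverse off the trivial character.\<close>

locale cyclic_function =
  fixes n :: nat and F :: "nat \<Rightarrow> real"
  assumes n_pos: "n > 0" and F_per: "F (k + n) = F k"
begin

definition dft :: "nat \<Rightarrow> complex" where
  "dft a = (\<Sum>k<n. of_real (F k) * om n (int a * int k))"

definition Cc :: "int \<Rightarrow> complex" where
  "Cc x = (\<Sum>a\<in>{1..<n}. om n (int a * x) / of_real ((cmod (dft a))\<^sup>2)) / of_nat n"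

text \<open>As F is real, taking real parts commutes with the sums of \<open>Cc\<close> against
  translates of F.\<close>

definition C :: "int \<Rightarrow> real" where "C x = Re (Cc x)"

text \<open>As functions of z these are the future dual vectors: combinations of translates of F
  with the coefficients of the inverse Gram matrix.\<close>

definition D :: "nat \<Rightarrow> nat \<Rightarrow> real" where
  "D x z = (\<Sum>y<n. C (int x - int y) * F (y + z))"

lemma C_0: "C 0 = (\<Sum>a\<in>{1..<n}. 1 / (cmod (dft a))\<^sup>2) / real n"
  unfolding C_def Cc_def by (simp add: Re_divide_of_nat flip: of_real_power)

lemma om_shift:
  "(\<Sum>y<n. of_real (F (y + z)) * om n (a * int y)) = om n (- (a * int z)) * (\<Sum>y<n. of_real (F y) * om n (a * int y))"
proof -
  have per: "of_real (F (y + n)) * om n (a * int (y + n)) = of_real (F y) * om n (a * int y)" for y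
  proof -
    have "om n (a * int (y + n)) = om n (a * int y)"
      by (rule om_cong[OF n_pos]) (simp add: cong_iff_dvd_diff algebra_simps)
    then show ?thesis by (simp add: F_per)
  qed
  have "(\<Sum>y<n. of_real (F (y + z)) * om n (a * int y)) =
      (\<Sum>y<n. om n (- (a * int z)) * (of_real (F (y + z)) * om n (a * int (y + z))))"
  proof (intro sum.cong refl)
    fix y
    have "om n (a * int y) = om n (- (a * int z)) * om n (a * int (y + z))"
      unfolding om_add[symmetric] by (simp add: algebra_simps)
    then show "of_real (F (y + z)) * om n (a * int y) =
        om n (- (a * int z)) * (of_real (F (y + z)) * om n (a * int (y + z)))" by simp
  qed
  also have "\<dots> = om n (- (a * int z)) * (\<Sum>y<n. of_real (F (y + z)) * om n (a * int (y + z)))"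
    by (simp add: sum_distrib_left)
  also have "(\<Sum>y<n. of_real (F (y + z)) * om n (a * int (y + z))) = (\<Sum>y<n. of_real (F y) * om n (a * int y))"
    by (rule sum_periodic_shift[where G = "\<lambda>y. of_real (F y) * om n (a * int y)", OF per])
  finally show ?thesis .
qed

text \<open>The frequency a = 0 is left out of \<open>Cc\<close>. This places the dual vectors in
  the span of differences of translates.\<close>

lemma sum_C: "(\<Sum>y<n. C (int x - int y)) = 0"
proof -
  have "(\<Sum>y<n. Cc (int x - int y)) =
      (\<Sum>y<n. \<Sum>a\<in>{1..<n}. om n (int a * int x) * om n (- int a * int y) / of_real ((cmod (dft a))\<^sup>2)) / of_nat n"
    unfolding Cc_def sum_divide_distrib[symmetric] om_add[symmetric]
    by (simp add: algebra_simps)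
  also have "\<dots> = (\<Sum>a\<in>{1..<n}. om n (int a * int x) * (\<Sum>y<n. om n (- int a * int y)) / of_real ((cmod (dft a))\<^sup>2)) / of_nat n"
    by (subst sum.swap) (simp add: sum_distrib_left sum_divide_distrib)
  also have "\<dots> = 0"
  proof -
    have "(\<Sum>y<n. om n (- int a * int y)) = 0" if "a \<in> {1..<n}" for a
      using that n_pos by (subst om_sum) (auto dest: nat_dvd_not_less)
    then show ?thesis by simp
  qed
  finally have "Re (\<Sum>y<n. Cc (int x - int y)) = 0" by simp
  then show ?thesis by (simp add: C_def Re_sum)
qed

lemma Dc_eq:
  assumes "\<And>a. a \<in> {1..<n} \<Longrightarrow> dft a \<noteq> 0"
  shows "(\<Sum>y<n. Cc (int x - int y) * of_real (F (y + z))) =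
     (\<Sum>a\<in>{1..<n}. om n (int a * int x) * om n (int a * int z) / dft a) / of_nat n"
proof -
  have "(\<Sum>y<n. Cc (int x - int y) * of_real (F (y + z))) =
     (\<Sum>y<n. \<Sum>a\<in>{1..<n}. om n (int a * int x) * (of_real (F (y + z)) * om n (- int a * int y)) / of_real ((cmod (dft a))\<^sup>2)) / of_nat n"
  proof -
    have "(\<Sum>a\<in>{1..<n}. om n (int a * (int x - int y)) / of_real ((cmod (dft a))\<^sup>2)) * of_real (F (y + z)) =
      (\<Sum>a\<in>{1..<n}. om n (int a * int x) * (of_real (F (y + z)) * om n (- int a * int y)) / of_real ((cmod (dft a))\<^sup>2))" for y
      unfolding sum_distrib_right
    proof (rule sum.cong[OF refl])
      fix a
      have "om n (int a * (int x - int y)) = om n (int a * int x) * om n (- int a * int y)"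
        unfolding om_add[symmetric] by (simp add: algebra_simps)
      then show "om n (int a * (int x - int y)) / complex_of_real ((cmod (dft a))\<^sup>2) * of_real (F (y + z)) =
         om n (int a * int x) * (of_real (F (y + z)) * om n (- int a * int y)) / complex_of_real ((cmod (dft a))\<^sup>2)"
        by simp
    qed
    then have "Cc (int x - int y) * of_real (F (y + z)) =
      (\<Sum>a\<in>{1..<n}. om n (int a * int x) * (of_real (F (y + z)) * om n (- int a * int y)) / of_real ((cmod (dft a))\<^sup>2)) / of_nat n" for y
      unfolding Cc_def times_divide_eq_left by (simp only:)
    then show ?thesis by (simp only: sum_divide_distrib[where r = "of_nat n :: complex", symmetric])
  qed
  also have "\<dots> = (\<Sum>a\<in>{1..<n}. om n (int a * int x) * (\<Sum>y<n. of_real (F (y + z)) * om n (- int a * int y)) / of_real ((cmod (dft a))\<^sup>2)) / of_nat n"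
    by (subst sum.swap) (simp add: sum_distrib_left sum_divide_distrib)
  also have "\<dots> = (\<Sum>a\<in>{1..<n}. om n (int a * int x) * om n (int a * int z) / dft a) / of_nat n"
  proof (rule arg_cong2[where f = divide, OF sum.cong[OF refl] refl])
    fix a assume a: "a \<in> {1..<n}"
    have "(\<Sum>y<n. of_real (F y) * om n (- int a * int y)) = cnj (dft a)"
      by (simp add: dft_def cnj_om)
    then have "(\<Sum>y<n. of_real (F (y + z)) * om n (- int a * int y)) = om n (int a * int z) * cnj (dft a)"
      by (subst om_shift) simp
    moreover have "cnj (dft a) / of_real ((cmod (dft a))\<^sup>2) = 1 / dft a"
      unfolding complex_norm_square using assms[OF a] by (simp add: field_simps)
    ultimately show "om n (int a * int x) * (\<Sum>y<n. of_real (F (y + z)) * om n (- int a * int y)) / of_real ((cmod (dft a))\<^sup>2)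
       = om n (int a * int x) * om n (int a * int z) / dft a"
      by (metis (no_types, lifting) mult.assoc times_divide_eq_right mult.right_neutral)
  qed
  finally show ?thesis .
qed

text \<open>All frequencies but 0 contribute as in a full orthogonality relation. The missing one
  accounts for - 1 / n, which depends on neither x nor y and so drops out against differences of
  translates.\<close>

lemma D_F_inner:
  assumes nz: "\<And>a. a \<in> {1..<n} \<Longrightarrow> dft a \<noteq> 0" and xy: "x < n" "y < n"
  shows "(\<Sum>z<n. D x z * F (y + z)) = (if x = y then 1 else 0) - 1 / real n"
proof -
  have D: "D x z = Re (\<Sum>y<n. Cc (int x - int y) * of_real (F (y + z)))" for z
    by (simp add: D_def C_def Re_sum)
  have "(\<Sum>z<n. (\<Sum>y<n. Cc (int x - int y) * of_real (F (y + z))) * of_real (F (y + z))) =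
     (\<Sum>z<n. \<Sum>a\<in>{1..<n}. om n (int a * int x) / dft a * (of_real (F (z + y)) * om n (int a * int z))) / of_nat n"
  proof -
    have "(\<Sum>y<n. Cc (int x - int y) * of_real (F (y + z))) * of_real (F (y + z)) =
      (\<Sum>a\<in>{1..<n}. om n (int a * int x) / dft a * (of_real (F (z + y)) * om n (int a * int z))) / of_nat n" for z
    proof -
      have "(\<Sum>a\<in>{1..<n}. om n (int a * int x) * om n (int a * int z) / dft a) * of_real (F (y + z)) =
        (\<Sum>a\<in>{1..<n}. om n (int a * int x) / dft a * (of_real (F (z + y)) * om n (int a * int z)))"
        unfolding sum_distrib_right by (rule sum.cong[OF refl]) (simp add: add.commute)
      moreover have "(\<Sum>y<n. Cc (int x - int y) * of_real (F (y + z))) =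
        (\<Sum>a\<in>{1..<n}. om n (int a * int x) * om n (int a * int z) / dft a) / of_nat n"
        by (rule Dc_eq) (rule nz)
      ultimately show ?thesis by (simp only: times_divide_eq_left[of _ "of_nat n"])
    qed
    then show ?thesis by (simp only: sum_divide_distrib[where r = "of_nat n :: complex", symmetric])
  qed
  also have "\<dots> = (\<Sum>a\<in>{1..<n}. om n (int a * int x) / dft a * (\<Sum>z<n. of_real (F (z + y)) * om n (int a * int z))) / of_nat n"
    by (subst sum.swap) (simp add: sum_distrib_left)
  also have "\<dots> = (\<Sum>a\<in>{1..<n}. om n ((int x - int y) * int a)) / of_nat n"
  proof (rule arg_cong2[where f = divide, OF sum.cong[OF refl] refl])
    fix a assume a: "a \<in> {1..<n}"
    have "om n ((int x - int y) * int a) = om n (int a * int x) * om n (- (int a * int y))"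
      unfolding om_add[symmetric] by (simp add: algebra_simps)
    then show "om n (int a * int x) / dft a * (\<Sum>z<n. of_real (F (z + y)) * om n (int a * int z)) = om n ((int x - int y) * int a)"
      using nz[OF a] by (subst om_shift) (simp add: dft_def)
  qed
  also have "(\<Sum>a\<in>{1..<n}. om n ((int x - int y) * int a)) = (\<Sum>a<n. om n ((int x - int y) * int a)) - 1"
  proof -
    have "{..<n} = insert 0 {1..<n}" using n_pos by auto
    then show ?thesis by simp
  qed
  also have "((\<Sum>a<n. om n ((int x - int y) * int a)) - 1) / of_nat n = of_real ((if x = y then 1 else 0) - 1 / real n)"
    unfolding om_sum[OF n_pos] dvd_int_diff_iff[OF xy] using n_pos by (simp add: field_simps)
  finally have "Re (\<Sum>z<n. (\<Sum>y<n. Cc (int x - int y) * of_real (F (y + z))) * of_real (F (y + z)))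
     = (if x = y then 1 else 0) - 1 / real n" by (simp only: Re_complex_of_real)
  then show ?thesis by (simp add: Re_sum D)
qed

text \<open>Expanding one factor into translates and pairing them with the other leaves the
  coefficient at y = x; the constant - 1 / n is killed by \<open>sum_C\<close>. Nothing depends on
  x, which is why all dual norms agree.\<close>

lemma D_D_inner:
  assumes nz: "\<And>a. a \<in> {1..<n} \<Longrightarrow> dft a \<noteq> 0" and x: "x < n"
  shows "(\<Sum>z<n. D x z * D x z) = C 0"
proof -
  have "(\<Sum>z<n. D x z * D x z) = (\<Sum>z<n. \<Sum>y<n. C (int x - int y) * (D x z * F (y + z)))"
    unfolding D_def[of x] by (simp add: sum_distrib_left sum_distrib_right mult_ac)
  also have "\<dots> = (\<Sum>y<n. C (int x - int y) * (\<Sum>z<n. D x z * F (y + z)))"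
    by (subst sum.swap) (simp add: sum_distrib_left)
  also have "\<dots> = (\<Sum>y<n. C (int x - int y) * ((if x = y then 1 else 0) - 1 / real n))"
  proof (rule sum.cong[OF refl])
    fix y assume "y \<in> {..<n}"
    then have "(\<Sum>z<n. D x z * F (y + z)) = (if x = y then 1 else 0) - 1 / real n"
      by (intro D_F_inner nz x) auto
    then show "C (int x - int y) * (\<Sum>z<n. D x z * F (y + z)) = C (int x - int y) * ((if x = y then 1 else 0) - 1 / real n)"
      by (simp only:)
  qed
  also have "\<dots> = (\<Sum>y<n. (if y = x then C 0 else 0)) - (\<Sum>y<n. C (int x - int y)) / real n"
    unfolding sum_divide_distrib sum_subtractf[symmetric] by (intro sum.cong refl) (auto simp: algebra_simps)
  finally show ?thesis using x by (simp add: sum_C)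
qed

end

section \<open>Even characters and Gauss sums modulo an odd prime\<close>

text \<open>A bound uniform in x up to and including 1 supplies the majorant for the logarithm
  series after summation by parts.\<close>

lemma geometric_step_bound:
  fixes x :: real
  assumes "0 \<le> x" "x \<le> 1"
  shows "0 \<le> x ^ Suc j / real (Suc j) - x ^ Suc (Suc j) / real (Suc (Suc j))"
    and "x ^ Suc j / real (Suc j) - x ^ Suc (Suc j) / real (Suc (Suc j)) \<le> 2 * real (Suc j) powr - 2"
proof -
  have "x ^ Suc (Suc j) \<le> x ^ Suc j" using assms by (intro power_decreasing) auto
  then have "x ^ Suc (Suc j) / real (Suc (Suc j)) \<le> x ^ Suc j / real (Suc j)"
    using assms by (intro frac_le) auto
  then show "0 \<le> x ^ Suc j / real (Suc j) - x ^ Suc (Suc j) / real (Suc (Suc j))" by simp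
  \<comment> \<open>Each power x^i with i \<le> j + 1 is at least x^(j+1), so j + 2 copies of
    x^(j+1) (1 - x) are dominated by a sum that telescopes to at most 1.\<close>
  have "real (Suc (Suc j)) * (x ^ Suc j * (1 - x)) = (\<Sum>i<Suc (Suc j). x ^ Suc j * (1 - x))" by simp
  also have "\<dots> \<le> (\<Sum>i<Suc (Suc j). x ^ i * (1 - x))"
    using assms by (intro sum_mono mult_right_mono power_decreasing) auto
  also have "\<dots> = 1 - x ^ Suc (Suc j)"
    unfolding sum_distrib_right[symmetric] by (metis mult.commute one_diff_power_eq)
  also have "\<dots> \<le> 1" using assms by simp
  finally have 1: "x ^ Suc j * (1 - x) \<le> 1 / real (Suc (Suc j))"
    by (simp add: pos_le_divide_eq mult.commute del: of_nat_Suc)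
  have "y / a - x * y / b = y * (1 / a - 1 / b) + y * (1 - x) / b" for y a b :: real
    by (simp add: right_diff_distrib diff_divide_distrib mult.commute)
  then have "x ^ Suc j / real (Suc j) - x ^ Suc (Suc j) / real (Suc (Suc j)) =
      x ^ Suc j * (1 / real (Suc j) - 1 / real (Suc (Suc j))) + x ^ Suc j * (1 - x) / real (Suc (Suc j))"
    unfolding power_Suc[of x "Suc j"] .
  also have "\<dots> \<le> 1 * (1 / real (Suc j) - 1 / real (Suc (Suc j))) + (1 / real (Suc (Suc j))) / real (Suc (Suc j))"
    using assms 1 by (intro add_mono mult_right_mono divide_right_mono power_le_one) (auto simp: field_simps)
  also have "\<dots> \<le> 2 / (real (Suc j))\<^sup>2"
  proof -
    have "1 / real (Suc j) - 1 / real (Suc (Suc j)) = 1 / (real (Suc j) * real (Suc (Suc j)))"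
      by (simp add: field_simps)
    also have "\<dots> \<le> 1 / (real (Suc j) * real (Suc j))" by (intro divide_left_mono mult_left_mono) auto
    finally have "1 / real (Suc j) - 1 / real (Suc (Suc j)) \<le> 1 / (real (Suc j))\<^sup>2"
      by (simp add: power2_eq_square)
    moreover have "(1 / real (Suc (Suc j))) / real (Suc (Suc j)) \<le> 1 / (real (Suc j))\<^sup>2"
      by (simp add: power2_eq_square, intro divide_left_mono mult_mono) auto
    ultimately show ?thesis by simp
  qed
  also have "\<dots> = 2 * real (Suc j) powr - 2"
    by (simp add: powr_minus_divide del: of_nat_Suc)
  finally show "x ^ Suc j / real (Suc j) - x ^ Suc (Suc j) / real (Suc (Suc j)) \<le> 2 * real (Suc j) powr - 2" .
qed

text \<open>Abel's limit theorem in uniform form: summed by parts, the series converges uniformly on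
  the closed interval. Continuity at 1 later carries an identity from radius x < 1 to the unit
  circle.\<close>

lemma abel_continuous:
  assumes mz: "mz_periodic q h"
  obtains T :: "real \<Rightarrow> complex" where "continuous_on {0..1} T"
    "\<And>x. x \<in> {0..1} \<Longrightarrow> (\<lambda>j. h j * of_real (x ^ Suc j / real (Suc j))) sums T x"
proof -
  obtain B where B: "\<And>n. cmod (psum h n - pmean q h) \<le> B"
    using mz_periodic_bound[OF mz_periodic_step[OF mz]] by blast
  define B' where "B' = B + cmod (pmean q h)"
  have p: "cmod (psum h n) \<le> B'" for n
    using B[of n] norm_triangle_sub[of "psum h n" "pmean q h"] by (simp add: B'_def)
  then have B'0: "B' \<ge> 0" using norm_ge_zero order_trans by blast
  define \<phi> where "\<phi> x j = complex_of_real (x ^ Suc j / real (Suc j))" for x j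
  define t where "t j x = psum h j * (\<phi> x j - \<phi> x (Suc j))" for j x
  define T where "T x = (\<Sum>j. t j x)" for x
  have tb: "cmod (t j x) \<le> B' * (2 * real (Suc j) powr - 2)" if "x \<in> {0..1}" for j x
  proof -
    have "cmod (\<phi> x j - \<phi> x (Suc j)) = \<bar>x ^ Suc j / real (Suc j) - x ^ Suc (Suc j) / real (Suc (Suc j))\<bar>"
      unfolding \<phi>_def of_real_diff[symmetric] norm_of_real ..
    also have "\<dots> \<le> 2 * real (Suc j) powr - 2"
      using geometric_step_bound[of x j] that by (simp del: power_Suc of_nat_Suc)
    finally show ?thesis unfolding t_def norm_mult using p[of j] B'0 by (intro mult_mono) auto
  qed
  have sm: "summable (\<lambda>j. B' * (2 * real (Suc j) powr - 2))"
    by (intro summable_mult summable_Suc_powr) simp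
  have ul: "uniform_limit {0..1} (\<lambda>N x. \<Sum>j<N. t j x) T sequentially"
    unfolding T_def by (rule Weierstrass_m_test[OF tb sm])
  have "continuous_on {0..1} T"
  proof (rule uniform_limit_theorem[OF _ ul])
    show "\<forall>\<^sub>F N in sequentially. continuous_on {0..1} (\<lambda>x. \<Sum>j<N. t j x)"
      unfolding t_def \<phi>_def by (intro always_eventually allI continuous_intros) auto
  qed simp
  moreover have "(\<lambda>j. h j * of_real (x ^ Suc j / real (Suc j))) sums T x" if x: "x \<in> {0..1}" for x
  proof -
    have "summable (\<lambda>j. t j x)"
      by (rule summable_comparison_test[OF _ sm]) (use tb[OF x] in auto)
    then have 1: "(\<lambda>N. \<Sum>j<N. t j x) \<longlonglongrightarrow> T x"
      unfolding T_def by (rule summable_LIMSEQ)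
    have 2: "(\<lambda>N. psum h N * \<phi> x N) \<longlonglongrightarrow> 0"
    proof (rule Lim_null_comparison)
      show "\<forall>\<^sub>F N in sequentially. cmod (psum h N * \<phi> x N) \<le> B' * inverse (real (Suc N))"
      proof (intro always_eventually allI)
        fix N
        have "x ^ Suc N \<le> 1" using x by (intro power_le_one) auto
        then have "x ^ Suc N / real (Suc N) \<le> 1 / real (Suc N)" by (intro divide_right_mono) auto
        moreover have "cmod (\<phi> x N) = x ^ Suc N / real (Suc N)"
          unfolding \<phi>_def norm_of_real using x by (intro abs_of_nonneg) auto
        ultimately have "cmod (\<phi> x N) \<le> inverse (real (Suc N))" by (simp add: divide_inverse del: of_nat_Suc)
        then show "cmod (psum h N * \<phi> x N) \<le> B' * inverse (real (Suc N))"
          unfolding norm_mult using p[of N] B'0 by (intro mult_mono) auto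
      qed
      show "(\<lambda>N. B' * inverse (real (Suc N))) \<longlonglongrightarrow> 0"
        using tendsto_mult_right_zero[OF LIMSEQ_inverse_real_of_nat] .
    qed
    have "(\<Sum>j\<le>N. h j * \<phi> x j) = (\<Sum>j<N. t j x) + psum h N * \<phi> x N" for N
      using abel_step[of h "\<phi> x" N 0] by (simp add: t_def)
    then have "(\<lambda>N. \<Sum>j\<le>N. h j * \<phi> x j) \<longlonglongrightarrow> T x + 0"
      using tendsto_add[OF 1 2] by simp
    then show ?thesis by (simp add: sums_def_le \<phi>_def)
  qed
  ultimately show ?thesis by (rule that)
qed

text \<open>The primitive root turns the units into exponents modulo 2n, and the units up to sign
  into exponents modulo n.\<close>

locale odd_prime_root =
  fixes q g :: nat
  assumes prime_q: "prime q" and odd_q: "odd q" and root: "residue_primroot q g"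
begin

definition n :: nat where "n = (q - 1) div 2"

lemma q_eq: "q = 2 * n + 1" and n_pos: "n > 0" and q_gt: "q > 2"
proof -
  have "q \<noteq> 2" "q \<ge> 2" using odd_q prime_q prime_ge_2_nat by auto
  then show "q > 2" by simp
  from odd_q obtain k where k: "q = 2 * k + 1" by (rule oddE)
  then have "n = k" unfolding n_def by simp
  with k \<open>q > 2\<close> show "q = 2 * n + 1" "n > 0" by linarith+
qed

lemma q_minus_1: "q - 1 = 2 * n"
  using q_eq by linarith

lemma coprime_g: "coprime q g" and ord_g: "ord q g = 2 * n"
proof -
  have r: "q > 0 \<and> coprime q g \<and> ord q g = totient q"
    using root unfolding residue_primroot_def .
  then show "coprime q g" by (elim conjE)
  have "totient q = 2 * n" using totient_prime[OF prime_q] q_minus_1 by (rule trans)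
  with r show "ord q g = 2 * n" by (elim conjE) (rule trans)
qed

lemma pow_cong_iff: "[g ^ i = g ^ j] (mod q) \<longleftrightarrow> [i = j] (mod 2 * n)"
  unfolding ord_g[symmetric] by (rule order_divides_expdiff[OF coprime_g])

lemma bij_pow: "bij_betw (\<lambda>i. g ^ i mod q) {..<2 * n} {1..<q}"
proof -
  have "{0<..<q} = {1..<q}" by (rule Set.set_eqI) (simp add: Suc_le_eq)
  with totatives_prime[OF prime_q] have "totatives q = {1..<q}" by (rule trans)
  moreover have "totient q = 2 * n" unfolding totient_prime[OF prime_q] by (rule q_minus_1)
  moreover have "bij_betw (\<lambda>i. g ^ i mod q) {..<totient q} (totatives q)"
    by (rule residue_primroot_is_generator[OF _ root]) (use q_gt in simp)
  ultimately show ?thesis by (simp only:)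
qed

lemma coprime_q_iff: "coprime m q \<longleftrightarrow> \<not> q dvd m"
proof
  show "coprime m q" if "\<not> q dvd m"
    using prime_imp_coprime[OF prime_q that] by (simp add: coprime_commute)
  show "\<not> q dvd m" if "coprime m q"
  proof
    assume "q dvd m"
    then have "q = 1" using that by (simp add: coprime_absorb_right)
    then show False using q_gt by simp
  qed
qed

lemma ex_ind: "coprime m q \<Longrightarrow> \<exists>k. [g ^ k = m] (mod q)"
proof -
  assume "coprime m q"
  then have "\<not> q dvd m" by (simp add: coprime_q_iff)
  then have "m mod q \<in> {1..<q}" using q_gt by (simp add: Suc_le_eq mod_greater_zero_iff_not_dvd)
  then have "m mod q \<in> (\<lambda>i. g ^ i mod q) ` {..<2 * n}"
    using bij_betw_imp_surj_on[OF bij_pow] by (simp only:)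
  then obtain k where "g ^ k mod q = m mod q" by auto
  then show ?thesis by (auto simp: cong_def)
qed

text \<open>A discrete logarithm, determined only modulo 2n; no range is fixed, so it is handled
  through congruences.\<close>

definition ind :: "nat \<Rightarrow> nat" where "ind m = (SOME k. [g ^ k = m] (mod q))"

lemma ind: "coprime m q \<Longrightarrow> [g ^ ind m = m] (mod q)"
  unfolding ind_def by (rule someI_ex) (rule ex_ind)

lemma coprime_pow: "[g ^ k = m] (mod q) \<Longrightarrow> coprime m q"
  using cong_imp_coprime[of "g ^ k" m q] coprime_g by (simp add: coprime_commute)

lemma ind_unique: "[g ^ k = m] (mod q) \<Longrightarrow> [ind m = k] (mod 2 * n)"
  by (rule pow_cong_iff[THEN iffD1], rule cong_trans[OF ind[OF coprime_pow] cong_sym])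

text \<open>g^n is a square root of 1 modulo a prime and differs from 1, hence is -1. A shift of the
  exponent by n is therefore negation, and even functions have period n in the exponent.\<close>

lemma pow_half: "q dvd g ^ (k + n) + g ^ k"
proof -
  have "[g ^ (2 * n) = g ^ 0] (mod q)" by (subst pow_cong_iff) (simp add: cong_def)
  then have "[int (g ^ (2 * n)) = int 1] (mod int q)" by (simp only: cong_int_iff power_0)
  then have "int q dvd int (g ^ (2 * n)) - 1" by (simp add: cong_iff_dvd_diff)
  also have "int (g ^ (2 * n)) - 1 = (int (g ^ n) - 1) * (int (g ^ n) + 1)"
  proof -
    have "g ^ (2 * n) = g ^ n * g ^ n" by (simp only: mult_2 power_add)
    then show ?thesis by (simp add: algebra_simps)
  qed
  finally have "int q dvd int (g ^ n) - 1 \<or> int q dvd int (g ^ n) + 1"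
    using prime_q by (simp add: prime_dvd_mult_iff)
  moreover have "\<not> int q dvd int (g ^ n) - 1"
  proof
    assume "int q dvd int (g ^ n) - 1"
    then have "[int (g ^ n) = int (g ^ 0)] (mod int q)" by (simp add: cong_iff_dvd_diff)
    then have "[n = 0] (mod 2 * n)" unfolding cong_int_iff pow_cong_iff .
    then show False using n_pos by (simp add: cong_def)
  qed
  ultimately have "int q dvd int (g ^ n) + 1" by blast
  then have "int q dvd int (g ^ n + 1)" by (simp add: add.commute)
  then have "q dvd g ^ n + 1" by (simp only: int_dvd_int_iff)
  then have "q dvd g ^ k * (g ^ n + 1)" by (rule dvd_mult)
  then show ?thesis by (simp add: power_add algebra_simps)
qed

text \<open>The root of unity has order dividing n rather than 2n, so the value at -1 is 1: a < n
  enumerates the even characters, with a = 0 the principal one.\<close>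

definition X :: "nat \<Rightarrow> nat \<Rightarrow> complex" where
  "X a m = (if coprime m q then om n (int a * int (ind m)) else 0)"

lemma om_n_cong: "[i = j] (mod 2 * n) \<Longrightarrow> om n (int a * int i) = om n (int a * int j)"
proof -
  assume "[i = j] (mod 2 * n)"
  then have "[i = j] (mod n)" by (rule cong_modulus_mult_nat[of _ _ n 2, unfolded mult.commute[of n 2]])
  then have "[int i = int j] (mod int n)" by (simp add: cong_int_iff)
  then show ?thesis by (intro om_cong n_pos cong_scalar_left)
qed

lemma X_pow: "[g ^ k = m] (mod q) \<Longrightarrow> X a m = om n (int a * int k)"
  using coprime_pow[of k m] om_n_cong[OF ind_unique] by (simp add: X_def)

lemma X_0: "q dvd m \<Longrightarrow> X a m = 0" by (simp add: X_def coprime_q_iff)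

lemma X_cong:
  assumes "[m = m'] (mod q)"
  shows "X a m = X a m'"
proof (cases "coprime m' q")
  case True
  then have "[g ^ ind m' = m] (mod q)" using ind assms by (meson cong_sym cong_trans)
  from X_pow[OF this] X_pow[OF ind[OF True]] show ?thesis by simp
next
  case False
  then have "\<not> coprime m q" using assms by (metis cong_imp_coprime)
  then show ?thesis using False by (simp add: X_def)
qed

lemma X_mult: "X a (m * m') = X a m * X a m'"
proof (cases "coprime m q \<and> coprime m' q")
  case True
  then have "[g ^ ind m * g ^ ind m' = m * m'] (mod q)" by (intro cong_mult ind) auto
  then have "[g ^ (ind m + ind m') = m * m'] (mod q)" by (simp add: power_add)
  from X_pow[OF this, of a] True show ?thesis by (simp add: X_def om_add[symmetric] algebra_simps)
qed (auto simp: X_def)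

lemma X_char: "dirichlet_char q (X a)"
  unfolding dirichlet_char_def
proof (intro conjI allI)
  show "X a (m + q) = X a m" for m by (rule X_cong) (simp add: cong_def)
  have "[g ^ 0 = 1] (mod q)" by simp
  from X_pow[OF this] show "X a 1 = 1" by simp
  show "(X a m = 0) = (\<not> coprime m q)" for m
    by (simp add: X_def om_def)
qed (use q_gt in \<open>auto simp: X_mult\<close>)

lemma sum_units: "(\<Sum>m\<in>{1..<q}. \<phi> m) = (\<Sum>k<2 * n. \<phi> (g ^ k mod q))"
  using sum.reindex_bij_betw[OF bij_pow, of \<phi>] by simp

lemma X_pow_mod: "X a (g ^ k mod q) = om n (int a * int k)"
  by (rule X_pow) (simp add: cong_def)

lemma sum_double: "(\<Sum>k<2 * n. h k) = (\<Sum>k<n. h k) + (\<Sum>k<n. h (k + n :: nat) :: 'a :: comm_monoid_add)"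
proof -
  have "(\<Sum>k<2 * n. h k) = (\<Sum>k<n. h k) + (\<Sum>k\<in>{n..<n + n}. h k)"
    by (simp add: lessThan_atLeast0 sum.atLeastLessThan_concat mult_2)
  also have "(\<Sum>k\<in>{n..<n + n}. h k) = (\<Sum>k<n. h (k + n))"
    using sum.shift_bounds_nat_ivl[of h 0 n n] by (simp add: lessThan_atLeast0)
  finally show ?thesis .
qed

lemma om_n_shift: "om n (int a * int (k + n)) = om n (int a * int k)"
  by (rule om_cong[OF n_pos]) (simp add: cong_iff_dvd_diff algebra_simps)

lemma sum_below_q: "\<phi> 0 = 0 \<Longrightarrow> (\<Sum>m<q. \<phi> m) = (\<Sum>m\<in>{1..<q}. \<phi> m :: complex)"
proof -
  assume "\<phi> 0 = 0"
  moreover have "{..<q} = insert 0 {1..<q}" using q_gt by auto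
  ultimately show ?thesis by simp
qed

lemma X_np_char:
  assumes a: "a \<in> {1..<n}"
  shows "np_char q (X a)"
proof
  show "dirichlet_char q (X a)" by (rule X_char)
  show "cmod (X a m) = 1" if "coprime m q" for m using that by (simp add: X_def)
  have "(\<Sum>j<q. X a j) = (\<Sum>j\<in>{1..<q}. X a j)" by (rule sum_below_q) (simp add: X_0)
  also have "\<dots> = (\<Sum>k<2 * n. om n (int a * int k))" unfolding sum_units X_pow_mod ..
  also have "\<dots> = 0"
    unfolding sum_double om_n_shift om_sum[OF n_pos] using a by (auto dest: nat_dvd_not_less)
  finally show "(\<Sum>j<q. X a j) = 0" .
qed

lemma X_neg:
  assumes "q dvd m + m'"
  shows "X a m' = X a m"
proof (cases "coprime m q")
  case True
  have "q dvd g ^ (ind m + n) + g ^ ind m" by (rule pow_half)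
  then have "int q dvd int (g ^ (ind m + n)) + int (g ^ ind m)" by (metis int_dvd_int_iff of_nat_add)
  moreover have "int q dvd int m + int m'" using assms by (metis int_dvd_int_iff of_nat_add)
  moreover have "int q dvd int (g ^ ind m) - int m" using ind[OF True] by (simp add: cong_iff_dvd_diff flip: cong_int_iff)
  ultimately have "int q dvd (int (g ^ (ind m + n)) + int (g ^ ind m)) - (int m + int m') - (int (g ^ ind m) - int m)"
    by (rule dvd_diff[OF dvd_diff])
  also have "(int (g ^ (ind m + n)) + int (g ^ ind m)) - (int m + int m') - (int (g ^ ind m) - int m) = int (g ^ (ind m + n)) - int m'"
    by (simp only: algebra_simps)
  finally have "[g ^ (ind m + n) = m'] (mod q)"
    by (simp add: cong_iff_dvd_diff flip: cong_int_iff)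
  from X_pow[OF this, of a] show ?thesis using True om_n_shift[of a "ind m"] by (simp add: X_def)
next
  case False
  then have "q dvd m" by (simp add: coprime_q_iff)
  then have "q dvd m'" using assms by (simp add: dvd_add_right_iff)
  then show ?thesis using \<open>q dvd m\<close> by (simp add: X_0)
qed

lemma zq_power: "zq q ^ m = om q (int m)"
proof -
  have "zq q = om q 1" by (simp add: zq_def om_def)
  then show ?thesis using om_power[of q 1 m] by simp
qed

lemma q_pos: "q > 0" using q_gt by simp

lemma om_q_cong: "[m = m'] (mod q) \<Longrightarrow> om q (int m) = om q (int m')"
  by (rule om_cong[OF q_pos]) (simp add: cong_int_iff)

lemma om_q_eq_1_iff: "om q (int m) = 1 \<longleftrightarrow> q dvd m"
  by (simp add: om_eq_1_iff[OF q_pos])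

lemma om_q_neg: "q dvd m + m' \<Longrightarrow> om q (int m') = cnj (om q (int m))"
proof -
  assume "q dvd m + m'"
  then have "int q dvd int m + int m'" by (metis int_dvd_int_iff of_nat_add)
  then have "[int m' = - int m] (mod int q)" by (simp add: cong_iff_dvd_diff add.commute)
  then show ?thesis unfolding cnj_om by (rule om_cong[OF q_pos])
qed

text \<open>Equal to ln (2 |sin (pi m / q)|) when q does not divide m; even and q-periodic, hence a
  function on exponents modulo n.\<close>

definition lsin :: "nat \<Rightarrow> real" where "lsin m = ln (cmod (zq q ^ m - 1))"

lemma lsin_cong: "[m = m'] (mod q) \<Longrightarrow> lsin m = lsin m'"
  using om_q_cong[of m m'] by (simp add: lsin_def zq_power)

lemma lsin_neg: "q dvd m + m' \<Longrightarrow> lsin m' = lsin m"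
proof -
  assume "q dvd m + m'"
  then have "zq q ^ m' - 1 = cnj (zq q ^ m - 1)" by (simp add: zq_power om_q_neg)
  then show ?thesis unfolding lsin_def by (simp only: complex_mod_cnj)
qed

definition Fl :: "nat \<Rightarrow> real" where "Fl k = lsin (g ^ k)"

lemma Fl_per: "Fl (k + n) = Fl k"
  unfolding Fl_def by (rule lsin_neg) (use pow_half[of k] in \<open>simp add: add.commute\<close>)

lemma lsin_eq_Fl: "[g ^ k = m] (mod q) \<Longrightarrow> lsin m = Fl k"
  unfolding Fl_def by (rule lsin_cong) (rule cong_sym)

end

sublocale odd_prime_root \<subseteq> cyc: cyclic_function n Fl
  by unfold_locales (simp_all add: n_pos Fl_per)

section \<open>Gauss sums and the Fourier coefficients of the logarithms\<close>

context odd_prime_root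
begin

lemma sum_units_neg: "(\<Sum>m\<in>{1..<q}. \<phi> (q - m)) = (\<Sum>m\<in>{1..<q}. \<phi> m :: complex)"
  by (rule sum.reindex_bij_witness[of _ "\<lambda>m. q - m" "\<lambda>m. q - m"]) auto

definition gauss :: "nat \<Rightarrow> complex" where "gauss a = (\<Sum>m\<in>{1..<q}. X a m * om q (int m))"

text \<open>Multiplication by j shifts exponents by the discrete logarithm of j. When q divides j
  both sides are 0, the left one because the character is not principal.\<close>

lemma gauss_twist:
  assumes a: "a \<in> {1..<n}"
  shows "(\<Sum>m\<in>{1..<q}. X a m * om q (int (m * j))) = cnj (X a j) * gauss a"
proof (cases "q dvd j")
  case True
  then have "om q (int (m * j)) = 1" for m by (subst om_q_eq_1_iff) simp
  moreover have "(\<Sum>m\<in>{1..<q}. X a m) = 0"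
    using np_char.sum0[OF X_np_char[OF a]] sum_below_q[of "X a"] by (simp add: X_0)
  ultimately show ?thesis using True by (simp add: X_0)
next
  case False
  then have c: "coprime j q" by (simp add: coprime_q_iff)
  define i where "i = ind j"
  have i: "[g ^ i = j] (mod q)" unfolding i_def by (rule ind[OF c])
  define G where "G k = om n (int a * int k) * om q (int (g ^ k))" for k
  have Gper: "G (k + 2 * n) = G k" for k
  proof -
    have "om n (int a * int (k + 2 * n)) = om n (int a * int k)"
      by (rule om_n_cong) (simp add: cong_def)
    moreover have "om q (int (g ^ (k + 2 * n))) = om q (int (g ^ k))"
      by (rule om_q_cong) (subst pow_cong_iff, simp add: cong_def)
    ultimately show ?thesis by (simp only: G_def)
  qed
  have "(\<Sum>m\<in>{1..<q}. X a m * om q (int (m * j))) = (\<Sum>k<2 * n. om n (- (int a * int i)) * G (k + i))"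
    unfolding sum_units
  proof (rule sum.cong[OF refl])
    fix k
    have "[g ^ k mod q * j = g ^ k * g ^ i] (mod q)"
      by (intro cong_mult) (use i in \<open>auto simp: cong_def\<close>)
    then have 1: "om q (int (g ^ k mod q * j)) = om q (int (g ^ (k + i)))"
      unfolding power_add by (rule om_q_cong)
    have 2: "om n (int a * int k) = om n (- (int a * int i)) * om n (int a * int (k + i))"
      unfolding om_add[symmetric] by (simp add: algebra_simps)
    show "X a (g ^ k mod q) * om q (int (g ^ k mod q * j)) = om n (- (int a * int i)) * G (k + i)"
      unfolding 1 X_pow_mod G_def 2 by (simp only: mult.assoc)
  qed
  also have "\<dots> = om n (- (int a * int i)) * (\<Sum>k<2 * n. G (k + i))" by (simp add: sum_distrib_left)
  also have "(\<Sum>k<2 * n. G (k + i)) = (\<Sum>k<2 * n. G k)" by (rule sum_periodic_shift) (rule Gper)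
  also have "(\<Sum>k<2 * n. G k) = gauss a"
    unfolding gauss_def sum_units G_def X_pow_mod
    by (rule sum.cong[OF refl]) (simp add: om_q_cong[of "g ^ k mod q" "g ^ k" for k] cong_def)
  also have "om n (- (int a * int i)) = cnj (X a j)"
    by (simp add: X_pow[OF i] cnj_om)
  finally show ?thesis .
qed

text \<open>By \<open>gauss_twist\<close> the j-th Fourier coefficient of the character modulo q has
  modulus |X(j)| times that of the Gauss sum, so Parseval's identity has the same positive sum
  \<open>E\<close> on both sides.\<close>

lemma norm_gauss:
  assumes a: "a \<in> {1..<n}"
  shows "(cmod (gauss a))\<^sup>2 = real q"
proof -
  define E where "E = (\<Sum>j<q. (cmod (X a j))\<^sup>2)"
  have "(cmod (X a 1))\<^sup>2 \<le> E" unfolding E_def using q_gt by (intro member_le_sum) auto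
  moreover have "X a 1 = 1" using X_char[of a] by (simp add: dirichlet_char_def)
  ultimately have E: "E > 0" by simp
  have "(\<Sum>j<q. (cmod (\<Sum>m<q. X a m * om q (int j * int m)))\<^sup>2) = real q * E"
    unfolding E_def by (rule om_parseval[OF q_pos])
  moreover have "(\<Sum>m<q. X a m * om q (int j * int m)) = cnj (X a j) * gauss a" for j
  proof -
    have "(\<Sum>m<q. X a m * om q (int j * int m)) = (\<Sum>m\<in>{1..<q}. X a m * om q (int j * int m))"
      by (rule sum_below_q) (simp add: X_0)
    then show ?thesis using gauss_twist[OF a, of j] by (simp add: mult.commute)
  qed
  ultimately have "E * (cmod (gauss a))\<^sup>2 = real q * E"
    by (simp add: E_def norm_mult power_mult_distrib sum_distrib_right)
  then show ?thesis using E by simp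
qed

lemma two_dft: "2 * cyc.dft a = (\<Sum>m\<in>{1..<q}. X a m * of_real (lsin m))"
proof -
  have "(\<Sum>m\<in>{1..<q}. X a m * of_real (lsin m)) = (\<Sum>k<2 * n. of_real (Fl k) * om n (int a * int k))"
    unfolding sum_units X_pow_mod
    by (rule sum.cong[OF refl]) (simp add: lsin_eq_Fl[of k "g ^ k mod q" for k] cong_def mult.commute)
  also have "\<dots> = 2 * cyc.dft a"
    unfolding sum_double cyc.dft_def Fl_per om_n_shift by simp
  finally show ?thesis by simp
qed

lemma ln_cmod_sums:
  assumes w: "cmod w < 1"
  shows "(\<lambda>j. - (w ^ Suc j + cnj w ^ Suc j) / (2 * of_nat (Suc j))) sums of_real (ln (cmod (1 - w)))"
proof -
  have "(\<lambda>j. - (w ^ j) / of_nat j) sums ln (1 - w)" using Ln_series'[of "- w"] w by simp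
  then have 1: "(\<lambda>j. - (w ^ Suc j) / of_nat (Suc j)) sums ln (1 - w)"
    by (subst sums_Suc_iff) simp
  then have "(\<lambda>j. cnj (- (w ^ Suc j) / of_nat (Suc j))) sums cnj (ln (1 - w))"
    by (simp only: sums_cnj)
  from sums_divide[OF sums_add[OF 1 this], of 2]
  have "(\<lambda>j. (- (w ^ Suc j) / of_nat (Suc j) + cnj (- (w ^ Suc j) / of_nat (Suc j))) / 2) sums
      ((ln (1 - w) + cnj (ln (1 - w))) / 2)" .
  moreover have "(ln (1 - w) + cnj (ln (1 - w))) / 2 = of_real (ln (cmod (1 - w)))"
  proof -
    have "1 - w \<noteq> 0" using w by auto
    then show ?thesis by (simp add: complex_add_cnj)
  qed
  moreover have "(- (w ^ Suc j) / of_nat (Suc j) + cnj (- (w ^ Suc j) / of_nat (Suc j))) / 2 =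
     - (w ^ Suc j + cnj w ^ Suc j) / (2 * of_nat (Suc j))" for j
    by (simp add: add_divide_distrib diff_divide_distrib mult.commute del: of_nat_Suc power_Suc)
  ultimately show ?thesis by (simp only:)
qed

text \<open>The series of ln |1 - w| is used at modulus x < 1, where the Gauss sum can be pulled out
  of each term. Both sides are continuous on [0, 1], so x may tend to 1, where T becomes the
  conjugate of L(1, chi). With the squared Gauss sum q and the 2 of \<open>two_dft\<close> this
  gives q / 4.\<close>

lemma dft_L:
  assumes a: "a \<in> {1..<n}"
  shows "(cmod (cyc.dft a))\<^sup>2 = real q / 4 * (cmod (np_char.L q (X a) 1))\<^sup>2"
proof -
  interpret \<chi>: np_char q "X a" by (rule X_np_char[OF a])
  interpret c: np_char q "\<lambda>m. cnj (X a m)" by (rule \<chi>.np_char_cnj)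
  obtain T where T: "continuous_on {0..1} T"
    "\<And>x. x \<in> {0..1} \<Longrightarrow> (\<lambda>j. cnj (X a (Suc j)) * of_real (x ^ Suc j / real (Suc j))) sums T x"
    using abel_continuous[OF c.mz] by metis
  define S where "S x = (\<Sum>m\<in>{1..<q}. X a m * of_real (ln (cmod (1 - of_real x * om q (int m)))))" for x :: real
  have eq: "S x = - gauss a * T x" if x: "0 \<le> x" "x < 1" for x
  proof -
    have "(\<lambda>j. \<Sum>m\<in>{1..<q}. X a m * (- ((of_real x * om q (int m)) ^ Suc j + cnj (of_real x * om q (int m)) ^ Suc j) / (2 * of_nat (Suc j)))) sums S x"
      unfolding S_def by (intro sums_sum sums_mult ln_cmod_sums) (use x in \<open>simp add: norm_mult\<close>)
    moreover have "(\<Sum>m\<in>{1..<q}. X a m * (- ((of_real x * om q (int m)) ^ Suc j + cnj (of_real x * om q (int m)) ^ Suc j) / (2 * of_nat (Suc j))))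
       = - gauss a * (cnj (X a (Suc j)) * of_real (x ^ Suc j / real (Suc j)))" for j
    proof -
      have p: "om q (int m) ^ Suc j = om q (int (m * Suc j))" for m
        by (simp only: om_power of_nat_mult)
      \<comment> \<open>Evenness enters here: substituting q - m for m shows that conjugate powers
        contribute as much as the powers, cancelling the 2 in the denominator.\<close>
      have "(\<Sum>m\<in>{1..<q}. X a m * cnj (om q (int (m * Suc j)))) = (\<Sum>m\<in>{1..<q}. X a (q - m) * om q (int ((q - m) * Suc j)))"
      proof (rule sum.cong[OF refl])
        fix m assume m: "m \<in> {1..<q}"
        then have "q dvd m + (q - m)" by simp
        moreover have "m * Suc j + (q - m) * Suc j = q * Suc j" using m by (simp flip: add_mult_distrib)
        then have "q dvd m * Suc j + (q - m) * Suc j" by simp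
        ultimately show "X a m * cnj (om q (int (m * Suc j))) = X a (q - m) * om q (int ((q - m) * Suc j))"
          using X_neg[of m "q - m" a] om_q_neg[of "m * Suc j" "(q - m) * Suc j"] by simp
      qed
      also have "\<dots> = cnj (X a (Suc j)) * gauss a"
        using sum_units_neg[of "\<lambda>m. X a m * om q (int (m * Suc j))"] gauss_twist[OF a, of "Suc j"] by simp
      finally have neg: "(\<Sum>m\<in>{1..<q}. X a m * cnj (om q (int (m * Suc j)))) = cnj (X a (Suc j)) * gauss a" .
      have "X a m * (- ((of_real x * om q (int m)) ^ Suc j + cnj (of_real x * om q (int m)) ^ Suc j) / (2 * of_nat (Suc j)))
        = - (of_real x ^ Suc j / (2 * of_nat (Suc j))) * (X a m * om q (int (m * Suc j)) + X a m * cnj (om q (int (m * Suc j))))" for m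
        unfolding complex_cnj_mult complex_cnj_complex_of_real power_mult_distrib complex_cnj_power[symmetric] p
        by (simp add: field_simps del: of_nat_Suc power_Suc)
      then have "(\<Sum>m\<in>{1..<q}. X a m * (- ((of_real x * om q (int m)) ^ Suc j + cnj (of_real x * om q (int m)) ^ Suc j) / (2 * of_nat (Suc j))))
        = - (of_real x ^ Suc j / (2 * of_nat (Suc j))) * (2 * (cnj (X a (Suc j)) * gauss a))"
        by (simp only: sum_distrib_left[symmetric] sum.distrib neg gauss_twist[OF a] mult_2)
      then show ?thesis by (simp add: field_simps del: of_nat_Suc power_Suc)
    qed
    ultimately have "(\<lambda>j. - gauss a * (cnj (X a (Suc j)) * of_real (x ^ Suc j / real (Suc j)))) sums S x"
      by (simp only:)
    moreover have "(\<lambda>j. - gauss a * (cnj (X a (Suc j)) * of_real (x ^ Suc j / real (Suc j)))) sums (- gauss a * T x)"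
      by (intro sums_mult T(2)) (use x in auto)
    ultimately show ?thesis by (rule sums_unique2)
  qed
  have nz: "1 - of_real x * om q (int m) \<noteq> 0" if "x \<in> {0..1}" "m \<in> {1..<q}" for x m
  proof
    assume "1 - of_real x * om q (int m) = 0"
    then have e: "of_real x * om q (int m) = 1" by simp
    then have "cmod (of_real x * om q (int m)) = 1" by simp
    then have "x = 1" using that by (simp add: norm_mult)
    then have "om q (int m) = 1" using e by simp
    then show False using that unfolding om_q_eq_1_iff by (auto dest: nat_dvd_not_less)
  qed
  have "continuous_on {0..1} S"
    unfolding S_def by (intro continuous_intros) (use nz in auto)
  then have contD: "continuous_on {0..1} (\<lambda>x. S x + gauss a * T x)"
    by (intro continuous_intros T(1))
  have lim: "(\<lambda>k. 1 - inverse (real (Suc k))) \<longlonglongrightarrow> 1 - 0"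
    by (intro tendsto_diff tendsto_const LIMSEQ_inverse_real_of_nat)
  have "(\<lambda>k. S (1 - inverse (real (Suc k))) + gauss a * T (1 - inverse (real (Suc k)))) \<longlonglongrightarrow> S 1 + gauss a * T 1"
    by (rule continuous_on_tendsto_compose[OF contD]) (use lim in \<open>auto simp: field_simps\<close>)
  moreover have "S (1 - inverse (real (Suc k))) + gauss a * T (1 - inverse (real (Suc k))) = 0" for k
    by (subst eq) (auto simp: field_simps)
  ultimately have "S 1 + gauss a * T 1 = 0"
    using LIMSEQ_unique[OF _ tendsto_const] by fastforce
  moreover have "S 1 = 2 * cyc.dft a"
    unfolding S_def two_dft lsin_def zq_power by (simp add: norm_minus_commute)
  ultimately have "2 * cyc.dft a = - (gauss a * T 1)" by (simp add: eq_neg_iff_add_eq_0)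
  then have "cmod (2 * cyc.dft a) = cmod (gauss a) * cmod (T 1)" by (simp add: norm_mult)
  then have "(cmod (2 * cyc.dft a))\<^sup>2 = real q * (cmod (T 1))\<^sup>2"
    by (simp add: power_mult_distrib norm_gauss[OF a])
  moreover have "cmod (T 1) = cmod (\<chi>.L 1)"
  proof -
    have "(\<lambda>j. cnj (X a (Suc j) * nps (Suc j) 1)) sums cnj (\<chi>.L 1)"
      unfolding sums_cnj by (rule \<chi>.L_sums) simp
    moreover have "(\<lambda>j. cnj (X a (Suc j) * nps (Suc j) 1)) sums T 1"
      using T(2)[of 1] by (simp add: powr_minus divide_inverse del: of_nat_Suc)
    ultimately have "cnj (\<chi>.L 1) = T 1" by (rule sums_unique2)
    then show ?thesis by (metis complex_mod_cnj)
  qed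
  ultimately show ?thesis by (simp add: norm_mult power_mult_distrib)
qed

text \<open>Here the nonvanishing of L(1, chi) enters the unconditional half of the theorem: the
  Gram matrix is invertible off the trivial character.\<close>

lemma dft_nonzero: "a \<in> {1..<n} \<Longrightarrow> cyc.dft a \<noteq> 0"
  using dft_L[of a] np_char.L_1_nonzero[OF X_np_char[of a]] q_pos by auto

end

section \<open>The dual basis of the logarithms of cyclotomic units\<close>

lemma cong_double_cases:
  fixes i j n :: nat
  assumes "[i = j] (mod n)"
  shows "[i = j] (mod 2 * n) \<or> [i = j + n] (mod 2 * n)"
proof -
  have "int n dvd int i - int j" using assms by (simp add: cong_iff_dvd_diff flip: cong_int_iff)
  then obtain t where t: "int i - int j = int n * t" by blast
  have half: "int (2 * n) = 2 * int n" by simp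
  show ?thesis
  proof (cases "even t")
    case True
    then obtain s where "t = 2 * s" by blast
    then have "int i - int j = int (2 * n) * s" using t by simp
    then have "[int i = int j] (mod int (2 * n))" unfolding cong_iff_dvd_diff by simp
    then show ?thesis unfolding cong_int_iff by (rule disjI1)
  next
    case False
    then obtain s where "t = 2 * s + 1" by (rule oddE)
    then have "int i - int (j + n) = int (2 * n) * s" using t by (simp add: algebra_simps)
    then have "[int i = int (j + n)] (mod int (2 * n))" unfolding cong_iff_dvd_diff by simp
    then show ?thesis unfolding cong_int_iff by (rule disjI2)
  qed
qed

section \<open>Discrete logarithms as coordinates on the representatives\<close>

context odd_prime_root
begin

definition idx :: "nat \<Rightarrow> nat" where "idx k = ind k mod n"

lemma idx_lt: "idx k < n" using n_pos by (simp add: idx_def)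

lemma coprime_below: "m \<in> {1..<q} \<Longrightarrow> coprime m q"
  by (auto simp: coprime_q_iff dest: nat_dvd_not_less)

lemma idx_pow: "[g ^ k = m] (mod q) \<Longrightarrow> idx m = k mod n"
proof -
  assume "[g ^ k = m] (mod q)"
  then have "[ind m = k] (mod 2 * n)" by (rule ind_unique)
  then have "[ind m = k] (mod n)" by (rule cong_modulus_mult_nat[of _ _ n 2, unfolded mult.commute[of n 2]])
  then show ?thesis by (simp add: idx_def cong_def)
qed

lemma idx_1: "idx 1 = 0"
  using idx_pow[of 0 1] by simp

lemma pow_neg:
  assumes "[g ^ k = m] (mod q)" "m \<le> q"
  shows "[g ^ (k + n) = q - m] (mod q)"
proof -
  have "int q dvd int (g ^ (k + n)) + int (g ^ k)" using pow_half[of k] by (metis int_dvd_int_iff of_nat_add)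
  moreover have "int q dvd int (g ^ k) - int m" using assms(1) by (simp add: cong_iff_dvd_diff flip: cong_int_iff)
  moreover have "int q dvd int q" by simp
  ultimately have "int q dvd (int (g ^ (k + n)) + int (g ^ k)) - (int (g ^ k) - int m) - int q"
    by (rule dvd_diff[OF dvd_diff])
  also have "(int (g ^ (k + n)) + int (g ^ k)) - (int (g ^ k) - int m) - int q = int (g ^ (k + n)) - int (q - m)"
    using assms(2) by (simp add: of_nat_diff)
  finally have "[int (g ^ (k + n)) = int (q - m)] (mod int q)" by (simp only: cong_iff_dvd_diff)
  then show ?thesis by (simp only: cong_int_iff)
qed

text \<open>Exponents congruent modulo n belong to residues that are equal or negatives of each
  other, and R contains exactly one of a and q - a. The choice of representatives disappears at this
  point.\<close>

lemma idx_bij: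
  assumes R: "reps q R"
  shows "bij_betw idx R {..<n}"
proof (rule bij_betwI')
  have sub: "R \<subseteq> {1..<q}" and flip: "\<And>a. a \<in> {1..<q} \<Longrightarrow> a \<in> R \<longleftrightarrow> q - a \<notin> R"
    using R by (auto simp: reps_def)
  fix j k assume j: "j \<in> R" and k: "k \<in> R"
  then have jq: "j \<in> {1..<q}" and kq: "k \<in> {1..<q}" using sub by blast+
  have ij: "[g ^ ind j = j] (mod q)" and ik: "[g ^ ind k = k] (mod q)"
    by (intro ind coprime_below jq kq)+
  show "(idx j = idx k) \<longleftrightarrow> (j = k)"
  proof
    assume "idx j = idx k"
    then have "[ind j = ind k] (mod n)" by (simp add: idx_def cong_def)
    then consider "[ind j = ind k] (mod 2 * n)" | "[ind j = ind k + n] (mod 2 * n)"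
      using cong_double_cases by blast
    then show "j = k"
    proof cases
      case 1
      then have "[g ^ ind j = g ^ ind k] (mod q)" by (simp only: pow_cong_iff)
      then have "[j = k] (mod q)" using ij ik by (meson cong_sym cong_trans)
      then show ?thesis using jq kq by (simp add: cong_def)
    next
      case 2
      then have "[g ^ ind j = g ^ (ind k + n)] (mod q)" by (simp only: pow_cong_iff)
      moreover have "[g ^ (ind k + n) = q - k] (mod q)" using ik kq by (intro pow_neg) auto
      ultimately have "[j = q - k] (mod q)" using ij by (meson cong_sym cong_trans)
      then have "j = q - k" using jq kq by (simp add: cong_def)
      then show ?thesis using flip[OF kq] j k by simp
    qed
  qed simp
next
  fix k show "idx k \<in> {..<n}" using idx_lt by simp
next
  have sub: "R \<subseteq> {1..<q}" and flip: "\<And>a. a \<in> {1..<q} \<Longrightarrow> a \<in> R \<longleftrightarrow> q - a \<notin> R"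
    using R by (auto simp: reps_def)
  fix z assume z: "z \<in> {..<n}"
  define m where "m = g ^ z mod q"
  have zm: "[g ^ z = m] (mod q)" by (simp add: m_def cong_def)
  have "m \<noteq> 0" using coprime_pow[OF zm] unfolding coprime_q_iff by (metis dvd_0_right)
  moreover have "m < q" using q_pos by (simp add: m_def)
  ultimately have mq: "m \<in> {1..<q}" by simp
  show "\<exists>x\<in>R. z = idx x"
  proof (cases "m \<in> R")
    case True
    then show ?thesis using idx_pow[OF zm] z by auto
  next
    case False
    then have "q - m \<in> R" using flip[OF mq] by blast
    moreover have "idx (q - m) = (z + n) mod n"
      by (intro idx_pow pow_neg zm) (use mq in simp)
    ultimately show ?thesis using z by auto
  qed
qed

lemma sum_R:
  assumes "reps q R"
  shows "(\<Sum>k\<in>R. \<phi> (idx k)) = (\<Sum>z<n. \<phi> z)"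
  using sum.reindex_bij_betw[OF idx_bij[OF assms], of \<phi>] .

lemma finite_R: "reps q R \<Longrightarrow> finite R"
  by (auto simp: reps_def intro: finite_subset)

lemma Fl_mod: "Fl (k mod n) = Fl k"
  by (rule periodic_mod) (rule Fl_per)

lemma logb_eq:
  assumes R: "reps q R" and j: "j \<in> R" and k: "k \<in> R"
  shows "logb q R j k = Fl (idx j + idx k) - Fl (idx k)"
proof -
  have cj: "coprime j q" and ck: "coprime k q"
    using R j k by (auto simp: reps_def intro!: coprime_below)
  then have "coprime (j * k) q" by simp
  then have nz: "zq q ^ (j * k) - 1 \<noteq> 0" "zq q ^ k - 1 \<noteq> 0"
    using ck om_q_eq_1_iff[of "j * k"] om_q_eq_1_iff[of k] by (auto simp: zq_power coprime_q_iff)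
  have "logb q R j k = ln (cmod (zq q ^ (j * k) - 1) / cmod (zq q ^ k - 1))"
    using k by (simp add: logb_def sigma_b_def norm_divide)
  also have "\<dots> = lsin (j * k) - lsin k"
    using nz by (simp add: ln_div lsin_def)
  also have "lsin k = Fl (idx k)"
    using lsin_eq_Fl[OF ind[OF ck]] by (simp add: idx_def Fl_mod)
  also have "lsin (j * k) = Fl (ind j + ind k)"
    by (rule lsin_eq_Fl) (unfold power_add, intro cong_mult ind cj ck)
  also have "\<dots> = Fl (idx j + idx k)"
    using Fl_mod[of "ind j + ind k"] Fl_mod[of "idx j + idx k"] by (simp add: idx_def mod_add_eq)
  finally show ?thesis .
qed

definition v0 :: "nat set \<Rightarrow> nat \<Rightarrow> nat \<Rightarrow> real" where
  "v0 R j k = (if k \<in> R then cyc.D (idx j) (idx k) else 0)"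

text \<open>The coefficient at j' is \<open>C\<close> at the difference of indices. The term j' = 1
  may be added since its logarithm vector is 0, and the subtracted translate disappears because the
  coefficients sum to 0. In the pairing the two constants - 1 / n cancel, and j \<noteq> 1 gives
  \<open>idx j\<close> \<noteq> 0.\<close>

lemma v0_dual:
  assumes R: "reps q R"
  shows "dual_basis q R (v0 R)"
  unfolding dual_basis_def
proof (intro conjI ballI)
  have R1: "1 \<in> R" using R by (simp add: reps_def)
  fix j assume j: "j \<in> R - {1}"
  show "\<exists>c. \<forall>k. v0 R j k = (\<Sum>j'\<in>R - {1}. c j' * logb q R j' k)"
  proof (intro exI allI)
    fix k
    show "v0 R j k = (\<Sum>j'\<in>R - {1}. cyc.C (int (idx j) - int (idx j')) * logb q R j' k)"
    proof (cases "k \<in> R")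
      case True
      define h where "h y = cyc.C (int (idx j) - int y) * (Fl (y + idx k) - Fl (idx k))" for y
      have "(\<Sum>j'\<in>R - {1}. cyc.C (int (idx j) - int (idx j')) * logb q R j' k) = (\<Sum>j'\<in>R - {1}. h (idx j'))"
        unfolding h_def using logb_eq[OF R _ True] by (intro sum.cong refl) auto
      also have "\<dots> = (\<Sum>j'\<in>R. h (idx j'))"
        using sum.remove[OF finite_R[OF R] R1, of "\<lambda>j'. h (idx j')"] by (simp add: h_def idx_1[unfolded One_nat_def] idx_1)
      also have "\<dots> = (\<Sum>y<n. h y)" by (rule sum_R[OF R])
      also have "\<dots> = cyc.D (idx j) (idx k) - Fl (idx k) * (\<Sum>y<n. cyc.C (int (idx j) - int y))"
        unfolding h_def cyc.D_def sum_distrib_left sum_subtractf[symmetric]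
        by (intro sum.cong refl) (simp add: algebra_simps)
      finally show ?thesis using True by (simp add: v0_def cyc.sum_C)
    qed (simp add: v0_def logb_def)
  qed
  fix j' assume j': "j' \<in> R - {1}"
  have inj: "inj_on idx R" using idx_bij[OF R] by (rule bij_betw_imp_inj_on)
  have "innerG R (v0 R j) (logb q R j') = (\<Sum>k\<in>R. cyc.D (idx j) (idx k) * (Fl (idx j' + idx k) - Fl (idx k)))"
    unfolding innerG_def v0_def using logb_eq[OF R] j' by (intro sum.cong refl) auto
  also have "\<dots> = (\<Sum>z<n. cyc.D (idx j) z * (Fl (idx j' + z) - Fl z))"
    by (rule sum_R[OF R])
  also have "\<dots> = (\<Sum>z<n. cyc.D (idx j) z * Fl (idx j' + z)) - (\<Sum>z<n. cyc.D (idx j) z * Fl (0 + z))"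
    by (simp add: sum_subtractf right_diff_distrib)
  also have "(\<Sum>z<n. cyc.D (idx j) z * Fl (idx j' + z)) = (if idx j = idx j' then 1 else 0) - 1 / real n"
    by (intro cyc.D_F_inner dft_nonzero idx_lt)
  also have "(\<Sum>z<n. cyc.D (idx j) z * Fl (0 + z)) = (if idx j = 0 then 1 else 0) - 1 / real n"
    by (intro cyc.D_F_inner dft_nonzero idx_lt n_pos)
  also have "idx j \<noteq> 0" using j R1 inj idx_1 by (metis DiffD1 DiffD2 inj_onD singletonI)
  then have "(if idx j = 0 then 1 else 0) = (0::real)" by simp
  also have "(idx j = idx j') = (j = j')" using inj j j' by (auto dest: inj_onD)
  finally show "innerG R (v0 R j) (logb q R j') = (if j = j' then 1 else 0)" by simp
qed

text \<open>The difference of two dual vectors lies in the span of the \<open>logb\<close> and is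
  orthogonal to it, so it vanishes on R; every dual basis has the norms of
  \<open>v0\<close>.\<close>

lemma dual_basis_norm:
  assumes R: "reps q R" and v: "dual_basis q R v" and j: "j \<in> R - {1}"
  shows "innerG R (v j) (v j) = cyc.C 0"
proof -
  define w where "w k = v j k - v0 R j k" for k
  obtain c where c: "\<And>k. v j k = (\<Sum>j'\<in>R - {1}. c j' * logb q R j' k)"
    using v j unfolding dual_basis_def by blast
  obtain c0 where c0: "\<And>k. v0 R j k = (\<Sum>j'\<in>R - {1}. c0 j' * logb q R j' k)"
    using v0_dual[OF R] j unfolding dual_basis_def by blast
  have w: "w k = (\<Sum>j'\<in>R - {1}. (c j' - c0 j') * logb q R j' k)" for k
    unfolding w_def c c0 by (simp add: sum_subtractf left_diff_distrib)
  have orth: "(\<Sum>k\<in>R. w k * logb q R j' k) = 0" if "j' \<in> R - {1}" for j'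
  proof -
    have "innerG R (v j) (logb q R j') = innerG R (v0 R j) (logb q R j')"
      using v v0_dual[OF R] j that unfolding dual_basis_def by simp
    then show ?thesis by (simp add: innerG_def w_def left_diff_distrib sum_subtractf)
  qed
  have "(\<Sum>k\<in>R. w k * w k) = (\<Sum>k\<in>R. \<Sum>j'\<in>R - {1}. (c j' - c0 j') * (w k * logb q R j' k))"
  proof (rule sum.cong[OF refl])
    fix k
    have "w k * w k = w k * (\<Sum>j'\<in>R - {1}. (c j' - c0 j') * logb q R j' k)" by (simp only: w[symmetric])
    then show "w k * w k = (\<Sum>j'\<in>R - {1}. (c j' - c0 j') * (w k * logb q R j' k))"
      by (simp add: sum_distrib_left mult_ac)
  qed
  also have "\<dots> = (\<Sum>j'\<in>R - {1}. (c j' - c0 j') * (\<Sum>k\<in>R. w k * logb q R j' k))"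
    by (subst sum.swap) (simp add: sum_distrib_left)
  also have "\<dots> = 0" using orth by simp
  finally have "w k = 0" if "k \<in> R" for k
    using that finite_R[OF R] by (simp add: sum_nonneg_eq_0_iff)
  then have "innerG R (v j) (v j) = innerG R (v0 R j) (v0 R j)"
    unfolding innerG_def by (intro sum.cong refl) (simp add: w_def)
  also have "\<dots> = (\<Sum>k\<in>R. cyc.D (idx j) (idx k) * cyc.D (idx j) (idx k))"
    unfolding innerG_def v0_def by (intro sum.cong refl) simp
  also have "\<dots> = (\<Sum>z<n. cyc.D (idx j) z * cyc.D (idx j) z)" by (rule sum_R[OF R])
  also have "\<dots> = cyc.C 0" by (intro cyc.D_D_inner dft_nonzero idx_lt)
  finally show ?thesis .
qed

lemma C_0_eq: "cyc.C 0 = 4 / (real q * real n) * (\<Sum>a\<in>{1..<n}. (cmod (inverse (np_char.L q (X a) 1)))\<^sup>2)"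
proof -
  have "cyc.C 0 = (\<Sum>a\<in>{1..<n}. 1 / (real q / 4 * (cmod (np_char.L q (X a) 1))\<^sup>2)) / real n"
    unfolding cyc.C_0
    by (rule arg_cong2[where f = divide, OF sum.cong[OF refl] refl]) (simp only: dft_L)
  also have "\<dots> = (\<Sum>a\<in>{1..<n}. 4 / real q * (cmod (inverse (np_char.L q (X a) 1)))\<^sup>2) / real n"
  proof (rule arg_cong2[where f = divide, OF sum.cong[OF refl] refl])
    have "1 / (real q / 4 * t\<^sup>2) = 4 / real q * (inverse t)\<^sup>2" for t :: real
      by (simp add: inverse_eq_divide power_divide)
    then show "1 / (real q / 4 * (cmod (np_char.L q (X a) 1))\<^sup>2) = 4 / real q * (cmod (inverse (np_char.L q (X a) 1)))\<^sup>2" for a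
      unfolding norm_inverse .
  qed
  finally show ?thesis unfolding sum_distrib_left[symmetric] by simp
qed

end

text \<open>Writing \<open>n = a b\<^sup>2\<close> with \<open>a\<close> squarefree gives \<open>\<zeta>(2) = (\<Sum>\<mu>(a)\<^sup>2 a powr - 2) \<zeta>(4)\<close>.\<close>

lemma rzeta_has_sum:
  assumes "s > 1"
  shows "((\<lambda>n. real n powr - s) has_sum rzeta s) {0<..}" "rzeta s > 0"
proof -
  have sm: "summable (\<lambda>n. real (Suc n) powr - s)" by (rule summable_Suc_powr[OF assms])
  have eq: "1 / real (Suc n) powr s = real (Suc n) powr - s" for n by (simp add: powr_minus_divide)
  then have "rzeta s = (\<Sum>n. real (Suc n) powr - s)" by (simp add: rzeta_def)
  with sm have s: "(\<lambda>n. real (Suc n) powr - s) sums rzeta s" by (simp add: sums_iff)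
  then have "((\<lambda>n. real (Suc n) powr - s) has_sum rzeta s) UNIV"
    using sm by (intro norm_summable_imp_has_sum) auto
  also have "?this \<longleftrightarrow> ((\<lambda>n. real n powr - s) has_sum rzeta s) {0<..}"
    by (rule has_sum_reindex_bij_witness[of _ "\<lambda>n. n - 1" Suc]) auto
  finally show "((\<lambda>n. real n powr - s) has_sum rzeta s) {0<..}" .
  have "rzeta s \<ge> real (Suc 0) powr - s"
    using s sums_nonneg_ge_first[of "\<lambda>n. real (Suc n) powr - s"] by simp
  then show "rzeta s > 0" by simp
qed

lemma square_dvd_squarefree_mult:
  fixes a b x :: nat
  assumes a: "squarefree a" and b: "b > 0" and x: "x\<^sup>2 dvd a * b\<^sup>2"
  shows "x dvd b"
proof -
  have d: "gcd x b \<noteq> 0" using b by simp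
  obtain e x' b' where e: "e = gcd x b" and xe: "x = x' * e" "b = b' * e" "coprime x' b'"
    using gcd_coprime_exists[OF d] by metis
  have e0: "e > 0" using e d by simp
  have "x'\<^sup>2 * e\<^sup>2 dvd (a * b'\<^sup>2) * e\<^sup>2"
    using x unfolding xe(1,2) power_mult_distrib mult.assoc .
  then have "x'\<^sup>2 dvd a * b'\<^sup>2" using e0 by simp
  moreover have "coprime (x'\<^sup>2) (b'\<^sup>2)" using xe(3) by simp
  ultimately have "x'\<^sup>2 dvd a" by (simp add: coprime_dvd_mult_left_iff)
  then have "x' = 1" using a by (auto dest: squarefreeD)
  then show ?thesis unfolding xe(1,2) by simp
qed

lemma squarefree_decomposition_parts:
  fixes a b :: nat
  assumes "squarefree a" "b > 0"
  shows "square_part (a * b\<^sup>2) = b" "squarefree_part (a * b\<^sup>2) = a"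
proof -
  have "square_part (a * b\<^sup>2) dvd b"
    by (rule square_dvd_squarefree_mult[OF assms]) (rule square_part_square_dvd)
  moreover have "b dvd square_part (a * b\<^sup>2)" by (simp add: dvd_square_part_iff)
  ultimately show b: "square_part (a * b\<^sup>2) = b" by (rule dvd_antisym)
  have "a * b\<^sup>2 = squarefree_part (a * b\<^sup>2) * b\<^sup>2"
    using squarefree_decompose[of "a * b\<^sup>2"] unfolding b .
  then show "squarefree_part (a * b\<^sup>2) = a" using assms(2) by simp
qed

lemma mob_square_sums: "(\<lambda>n. (mob n)\<^sup>2 / (real n)\<^sup>2) sums (rzeta 2 / rzeta 4)"
proof -
  define f where "f n = (mob n)\<^sup>2 * real n powr - 2" for n
  have f_eq: "f n = (mob n)\<^sup>2 / (real n)\<^sup>2" for n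
    by (cases "n = 0") (simp_all add: f_def powr_minus_divide)
  have "(mob n)\<^sup>2 \<le> 1" for n using abs_mob_le[of n] by (simp add: abs_square_le_1)
  then have fle: "norm (f n) \<le> real n powr - 2" for n
    by (simp add: f_def abs_mult mult_left_le_one_le)
  have sm: "summable (\<lambda>n. norm (f n))"
    by (rule summable_comparison_test[of _ "\<lambda>n. real n powr - 2"]) (use fle in \<open>auto simp: summable_real_powr_iff\<close>)
  then obtain \<rho> where \<rho>: "f sums \<rho>" using summable_norm_cancel summable_sums by blast
  have "(f has_sum \<rho>) UNIV" by (rule norm_summable_imp_has_sum[OF sm \<rho>])
  also have "?this \<longleftrightarrow> (f has_sum \<rho>) {a. a > 0 \<and> squarefree a}"
    by (rule has_sum_cong_neutral) (auto simp: f_def mob_def intro!: Nat.gr0I)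
  finally have "((\<lambda>n. complex_of_real (f n)) has_sum of_real \<rho>) {a. a > 0 \<and> squarefree a}"
    by (rule has_sum_of_real)
  from has_sum_product_complex[OF this has_sum_of_real[OF rzeta_has_sum(1)[of 4]]]
  have "((\<lambda>(a, b). complex_of_real (f a) * of_real (real b powr - 4)) has_sum (of_real \<rho> * of_real (rzeta 4)))
     ({a. a > 0 \<and> squarefree a} \<times> {0<..})" by simp
  also have "?this \<longleftrightarrow> ((\<lambda>n. complex_of_real (real n powr - 2)) has_sum (of_real \<rho> * of_real (rzeta 4))) {0<..}"
  proof -
    define i where "i n = (squarefree_part n, square_part n)" for n :: nat
    define j where "j = (\<lambda>(a, b). a * b\<^sup>2 :: nat)"
    show ?thesis
    proof (rule has_sum_reindex_bij_witness[of _ i j])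
      fix p assume "p \<in> {a::nat. a > 0 \<and> squarefree a} \<times> {0::nat<..}"
      then obtain a b where p: "p = (a, b)" "a > 0" "squarefree a" "b > 0" by auto
      show "i (j p) = p"
        using p squarefree_decomposition_parts[of a b] by (simp add: i_def j_def)
      show "j p \<in> {0<..}" using p by (simp add: j_def)
      have "((-1::real) ^ card (prime_factors a))\<^sup>2 = 1"
        by (simp only: power_mult[symmetric] mult.commute[of _ 2] power_mult power2_eq_square) simp
      then have m: "(mob a)\<^sup>2 = 1" using p by (simp add: mob_def)
      have "real (j p) powr - 2 = 1 / (real a * (real b)\<^sup>2)\<^sup>2"
        using p by (simp add: j_def powr_minus_divide)
      also have "\<dots> = (1 / (real a)\<^sup>2) * (1 / (real b) ^ 4)"
        by (simp add: power_mult_distrib flip: power_mult)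
      also have "\<dots> = f a * real b powr - 4"
        using p by (simp add: f_def m powr_minus_divide)
      finally show "complex_of_real (real (j p) powr - 2) =
          (case p of (a, b) \<Rightarrow> complex_of_real (f a) * of_real (real b powr - 4))"
        using p by simp
    next
      fix n :: nat assume n: "n \<in> {0<..}"
      show "j (i n) = n" using squarefree_decompose[of n] by (simp add: i_def j_def)
      show "i n \<in> {a. a > 0 \<and> squarefree a} \<times> {0<..}"
        using n by (auto simp: i_def intro!: Nat.gr0I)
    qed simp
  qed
  finally have "((\<lambda>n. complex_of_real (real n powr - 2)) has_sum (of_real \<rho> * of_real (rzeta 4))) {0<..}" .
  from has_sum_unique[OF this has_sum_of_real[OF rzeta_has_sum(1)[of 2]]]
  have "complex_of_real (\<rho> * rzeta 4) = of_real (rzeta 2)" by simp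
  then have "\<rho> * rzeta 4 = rzeta 2" by (simp only: of_real_eq_iff)
  then have "\<rho> = rzeta 2 / rzeta 4" using rzeta_has_sum(2)[of 4] by (simp add: field_simps)
  then show ?thesis using \<rho> by (simp add: f_eq[abs_def])
qed

section \<open>The mean square of the reciprocal and the asymptotic formula\<close>

lemma norm_square_diff_le:
  fixes x y :: "'a :: real_normed_vector"
  shows "\<bar>(norm x)\<^sup>2 - (norm y)\<^sup>2\<bar> \<le> norm (x - y) * (2 * norm y + norm (x - y))"
proof -
  have a: "\<bar>norm x - norm y\<bar> \<le> norm (x - y)" by (rule norm_triangle_ineq3)
  have b: "norm x + norm y \<le> 2 * norm y + norm (x - y)" using norm_triangle_sub[of x y] by simp
  have "\<bar>(norm x)\<^sup>2 - (norm y)\<^sup>2\<bar> = \<bar>norm x - norm y\<bar> * (norm x + norm y)"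
    by (simp add: power2_eq_square square_diff_square_factored abs_mult mult.commute)
  also have "\<dots> \<le> norm (x - y) * (2 * norm y + norm (x - y))"
    by (intro mult_mono a b) auto
  finally show ?thesis .
qed

lemma inverse_squares_tail:
  assumes "n > 0"
  shows "summable (\<lambda>j. 1 / (real (j + Suc n))\<^sup>2)" "(\<Sum>j. 1 / (real (j + Suc n))\<^sup>2) \<le> 1 / real n"
proof -
  have "(\<lambda>j. 1 / real (j + n)) \<longlonglongrightarrow> 0"
    using LIMSEQ_ignore_initial_segment[OF lim_1_over_n, of n] by simp
  from telescope_sums'[OF this]
  have t: "(\<lambda>j. 1 / real (j + n) - 1 / real (Suc j + n)) sums (1 / real n)" by simp
  have le: "1 / (real (j + Suc n))\<^sup>2 \<le> 1 / real (j + n) - 1 / real (Suc j + n)" for j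
  proof -
    have "1 / real (j + n) - 1 / real (Suc j + n) = 1 / (real (j + n) * real (j + Suc n))"
      using assms by (simp add: field_simps)
    also have "\<dots> \<ge> 1 / (real (j + Suc n) * real (j + Suc n))"
      using assms by (intro divide_left_mono mult_right_mono) auto
    finally show ?thesis by (simp add: power2_eq_square)
  qed
  show sm: "summable (\<lambda>j. 1 / (real (j + Suc n))\<^sup>2)"
    by (rule summable_comparison_test[OF _ sums_summable[OF t]]) (use le in auto)
  show "(\<Sum>j. 1 / (real (j + Suc n))\<^sup>2) \<le> 1 / real n"
    using sums_le[OF le summable_sums[OF sm] t] .
qed

definition Zy :: "real \<Rightarrow> real" where "Zy y = (\<Sum>m. real m powr - (2 - y))"

lemma Zy:
  assumes "y < 1"
  shows "summable (\<lambda>m. real m powr - (2 - y))" "Zy y \<ge> 1"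
    "(\<lambda>j. real (Suc j) powr - (2 - y)) sums Zy y"
proof -
  show sm: "summable (\<lambda>m. real m powr - (2 - y))"
    using assms by (simp add: summable_real_powr_iff)
  then have "(\<lambda>m. real m powr - (2 - y)) sums Zy y" by (simp add: Zy_def summable_sums)
  then show "(\<lambda>j. real (Suc j) powr - (2 - y)) sums Zy y" by (subst sums_Suc_iff) simp
  from sum_le_suminf[OF sm, of "{1}"] show "Zy y \<ge> 1" by (simp add: Zy_def)
qed

section \<open>Absolute bounds for the weighted coefficients\<close>

context
  fixes y :: real and K :: nat
  assumes y: "0 < y" "y < 1"
begin

definition UB :: real where "UB = Zy y / y ^ K"

lemma UB_ge: "UB \<ge> 1"
proof -
  have "y ^ K \<le> 1" "y ^ K > 0" using y by (auto intro: power_le_one)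
  then have "y ^ K \<le> Zy y" using Zy(2)[of y] y by linarith
  then show ?thesis using \<open>y ^ K > 0\<close> by (simp add: UB_def le_divide_eq)
qed

lemma uK_abs: "\<bar>uK K m\<bar> \<le> real m powr - (2 - y) / y ^ K"
  by (rule abs_uK_le) (use y in auto)

lemma uK_summable: "summable (\<lambda>m. \<bar>uK K m\<bar>)"
  by (rule summable_comparison_test[OF _ summable_divide[OF Zy(1)[OF y(2)], of "y ^ K"]])
     (use uK_abs in auto)

lemma uK_sum_le: "(\<Sum>m. \<bar>uK K m\<bar>) \<le> UB"
proof -
  have "(\<Sum>m. \<bar>uK K m\<bar>) \<le> (\<Sum>m. real m powr - (2 - y) / y ^ K)"
    by (rule suminf_le[OF uK_abs uK_summable summable_divide[OF Zy(1)[OF y(2)]]])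
  also have "\<dots> = UB" unfolding UB_def Zy_def by (rule suminf_divide[OF Zy(1)[OF y(2)]])
  finally show ?thesis .
qed

text \<open>Spacing q / 2 suffices: since y < 1, (q / 2)^(-(2 - y)) is at most 2 / q, and what
  remains sums to \<open>Zy y\<close>. Both r + (j + 1) q, and q - r + j q with r \<le> q / 2, are
  of this kind.\<close>

lemma uK_progression:
  assumes q: "real q \<ge> 2" and m: "\<And>j. real (m j) \<ge> real (Suc j) * (real q / 2)"
  shows "summable (\<lambda>j. uK K (m j))" "\<bar>\<Sum>j. uK K (m j)\<bar> \<le> 2 * UB / real q"
proof -
  define b where "b j = real (Suc j) powr - (2 - y) * (2 / real q / y ^ K)" for j
  have b: "b sums (Zy y * (2 / real q / y ^ K))"
    unfolding b_def by (rule sums_mult2[OF Zy(3)[OF y(2)]])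
  have le: "norm (uK K (m j)) \<le> b j" for j
  proof -
    have "\<bar>uK K (m j)\<bar> \<le> real (m j) powr - (2 - y) / y ^ K" by (rule uK_abs)
    also have "\<dots> \<le> (real (Suc j) * (real q / 2)) powr - (2 - y) / y ^ K"
      by (intro divide_right_mono powr_mono2' m) (use y q in auto)
    also have "(real (Suc j) * (real q / 2)) powr - (2 - y) = real (Suc j) powr - (2 - y) * (real q / 2) powr - (2 - y)"
      by (rule powr_mult)
    also have "real (Suc j) powr - (2 - y) * (real q / 2) powr - (2 - y) / y ^ K
        \<le> real (Suc j) powr - (2 - y) * (real q / 2) powr - 1 / y ^ K"
      by (intro divide_right_mono mult_left_mono powr_mono) (use y q in auto)
    also have "(real q / 2) powr - 1 = 2 / real q" using q by (simp add: powr_minus_divide)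
    finally show ?thesis by (simp add: b_def)
  qed
  show "summable (\<lambda>j. uK K (m j))"
    by (rule summable_comparison_test[OF _ sums_summable[OF b]]) (use le in auto)
  have "\<bar>\<Sum>j. uK K (m j)\<bar> \<le> suminf b"
    using norm_suminf_le[OF le sums_summable[OF b]] by simp
  also have "suminf b = 2 * UB / real q" using b by (simp add: sums_iff UB_def mult_ac)
  finally show "\<bar>\<Sum>j. uK K (m j)\<bar> \<le> 2 * UB / real q" .
qed

end

section \<open>Mean square over the even characters\<close>

context odd_prime_root
begin

lemma pow_half_mod: "g ^ (k + n) mod q = q - g ^ k mod q" "g ^ k mod q \<in> {1..<q}"
proof -
  define m where "m = g ^ k mod q"
  have zm: "[g ^ k = m] (mod q)" by (simp add: m_def cong_def)
  have "m \<noteq> 0" using coprime_pow[OF zm] unfolding coprime_q_iff by (metis dvd_0_right)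
  moreover have mq: "m < q" using q_pos by (simp add: m_def)
  ultimately show "g ^ k mod q \<in> {1..<q}" by (simp add: m_def[symmetric])
  have "[g ^ (k + n) = q - m] (mod q)" using zm mq by (intro pow_neg) auto
  then show "g ^ (k + n) mod q = q - g ^ k mod q"
    unfolding m_def[symmetric] cong_def using \<open>m \<noteq> 0\<close> q_pos by simp
qed

lemma n_le: "real n \<le> real q / 2" "real q \<le> 3 * real n"
proof -
  have "real q = 2 * real n + 1" using arg_cong[OF q_eq, of real] by simp
  then show "real n \<le> real q / 2" "real q \<le> 3 * real n" using n_pos by auto
qed

text \<open>The residues of g^k for k < n contain one member of each pair r, q - r, in general not
  the smaller one. For an even summand the choice is immaterial, so the sum moves to 1..n, where r
  is the least positive integer in the two classes.\<close>

lemma sum_even_fold: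
  fixes \<phi> :: "nat \<Rightarrow> real"
  assumes "\<And>r. r \<in> {1..<q} \<Longrightarrow> \<phi> (q - r) = \<phi> r"
  shows "(\<Sum>k<n. \<phi> (g ^ k mod q)) = (\<Sum>r\<in>{1..n}. \<phi> r)"
proof -
  have "(\<Sum>m\<in>{1..<q}. \<phi> m) = 2 * (\<Sum>k<n. \<phi> (g ^ k mod q))"
    unfolding sum_units sum_double pow_half_mod(1) using assms[OF pow_half_mod(2)] by simp
  moreover have "(\<Sum>m\<in>{1..<q}. \<phi> m) = 2 * (\<Sum>r\<in>{1..n}. \<phi> r)"
  proof -
    have "{1..<q} = {1..n} \<union> {Suc n..<q}" "{1..n} \<inter> {Suc n..<q} = {}" using q_eq n_pos by auto
    then have "(\<Sum>m\<in>{1..<q}. \<phi> m) = (\<Sum>r\<in>{1..n}. \<phi> r) + (\<Sum>r\<in>{Suc n..<q}. \<phi> r)"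
      by (simp add: sum.union_disjoint)
    also have "(\<Sum>r\<in>{Suc n..<q}. \<phi> r) = (\<Sum>r\<in>{1..n}. \<phi> r)"
    proof (rule sum.reindex_bij_witness[of _ "\<lambda>r. q - r" "\<lambda>r. q - r"])
      fix r assume r: "r \<in> {Suc n..<q}"
      then show "q - (q - r) = r" by auto
      show "q - r \<in> {1..n}" using r q_eq by auto
      show "\<phi> (q - r) = \<phi> r" using r by (intro assms) auto
    next
      fix r assume r: "r \<in> {1..n}"
      then show "q - (q - r) = r" using q_eq by auto
      show "q - r \<in> {Suc n..<q}" using r q_eq by auto
    qed
    finally show ?thesis by simp
  qed
  ultimately show ?thesis by simp
qed

context
  fixes y :: real and K :: nat
  assumes y: "0 < y" "y < 1"
begin

abbreviation "U \<equiv> UB y K"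

definition Ur :: "nat \<Rightarrow> real" where "Ur r = (\<Sum>j. uK K (r + j * q))"

definition B :: "nat \<Rightarrow> real" where "B r = Ur r + Ur (q - r)"

lemma Ur_sums: "(\<lambda>j. uK K (r + j * q)) sums Ur r"
proof -
  have "(\<lambda>j. uK K (r + (j + 1) * q)) sums (\<Sum>j. uK K (r + (j + 1) * q))"
  proof (rule summable_sums, rule uK_progression(1)[OF y, of q])
    fix j
    have "real (Suc j) * (real q / 2) \<le> real (Suc j) * real q" by (intro mult_left_mono) auto
    also have "\<dots> \<le> real (r + (j + 1) * q)" unfolding of_nat_add of_nat_mult by (simp add: algebra_simps)
    finally show "real (Suc j) * (real q / 2) \<le> real (r + (j + 1) * q)" .
  qed (use q_gt in simp)
  then have "summable (\<lambda>j. uK K (r + Suc j * q))" by (simp add: sums_iff)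
  then have "summable (\<lambda>j. uK K (r + j * q))" by (subst (asm) summable_Suc_iff)
  then show ?thesis unfolding Ur_def by (rule summable_sums)
qed

text \<open>The short sum P of \<open>inverse_L_approx\<close>, grouped by residue classes modulo
  q.\<close>

definition Pv :: "nat \<Rightarrow> complex" where "Pv a = (\<Sum>r<q. X a r * of_real (Ur r))"

lemma Pv_sums: "(\<lambda>m. X a m * of_real (uK K m)) sums Pv a" and Pv_le: "cmod (Pv a) \<le> U"
proof -
  have Xle: "cmod (X a m) \<le> 1" for m by (simp add: X_def)
  have le: "cmod (X a m * of_real (uK K m)) \<le> \<bar>uK K m\<bar>" for m
    using mult_right_mono[OF Xle, of "\<bar>uK K m\<bar>"] by (simp add: norm_mult)
  have "summable (\<lambda>m. X a m * of_real (uK K m))"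
    by (rule summable_comparison_test[OF _ uK_summable[OF y]]) (use le in auto)
  then obtain S where S: "(\<lambda>m. X a m * of_real (uK K m)) sums S" using summable_sums by blast
  have "(\<lambda>k. \<Sum>m\<in>{k * q..<k * q + q}. X a m * of_real (uK K m)) sums S"
    by (rule sums_group[OF S q_pos])
  moreover have "(\<Sum>m\<in>{k * q..<k * q + q}. X a m * of_real (uK K m)) = (\<Sum>r<q. X a r * of_real (uK K (r + k * q)))" for k
  proof -
    have "(\<Sum>m\<in>{k * q..<k * q + q}. X a m * of_real (uK K m)) = (\<Sum>r<q. X a (r + k * q) * of_real (uK K (r + k * q)))"
      using sum.shift_bounds_nat_ivl[of "\<lambda>m. X a m * of_real (uK K m)" 0 "k * q" q]
      by (simp add: lessThan_atLeast0 add.commute)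
    moreover have "X a (r + k * q) = X a r" for r by (rule X_cong) (simp add: cong_def)
    ultimately show ?thesis by (simp only:)
  qed
  moreover have "(\<lambda>k. \<Sum>r<q. X a r * of_real (uK K (r + k * q))) sums Pv a"
    unfolding Pv_def by (intro sums_sum sums_mult sums_of_real Ur_sums)
  ultimately have "S = Pv a" using sums_unique2 by simp
  with S show sP: "(\<lambda>m. X a m * of_real (uK K m)) sums Pv a" by simp
  have "cmod (Pv a) \<le> (\<Sum>m. \<bar>uK K m\<bar>)"
    unfolding sums_unique[OF sP] by (rule norm_suminf_le[OF le uK_summable[OF y]])
  also have "\<dots> \<le> U" by (rule uK_sum_le[OF y])
  finally show "cmod (Pv a) \<le> U" .
qed

text \<open>Parseval's identity wants all n frequencies, so the principal character a = 0 is
  included here and removed again in the mean square.\<close>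

lemma Pv_parseval: "(\<Sum>a<n. (cmod (Pv a))\<^sup>2) = real n * (\<Sum>r\<in>{1..n}. (B r)\<^sup>2)"
proof -
  have "Pv a = (\<Sum>k<n. of_real (B (g ^ k mod q)) * om n (int a * int k))" for a
  proof -
    have "Pv a = (\<Sum>r\<in>{1..<q}. X a r * of_real (Ur r))"
      unfolding Pv_def by (rule sum_below_q) (simp add: X_0)
    also have "\<dots> = (\<Sum>k<n. om n (int a * int k) * of_real (Ur (g ^ k mod q)))
        + (\<Sum>k<n. om n (int a * int k) * of_real (Ur (q - g ^ k mod q)))"
      unfolding sum_units X_pow_mod sum_double om_n_shift pow_half_mod(1) ..
    also have "\<dots> = (\<Sum>k<n. of_real (B (g ^ k mod q)) * om n (int a * int k))"
      unfolding sum.distrib[symmetric] by (intro sum.cong refl) (simp add: B_def algebra_simps)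
    finally show ?thesis .
  qed
  then have "(\<Sum>a<n. (cmod (Pv a))\<^sup>2) = real n * (\<Sum>k<n. (cmod (of_real (B (g ^ k mod q))))\<^sup>2)"
    using om_parseval[OF n_pos, of "\<lambda>k. of_real (B (g ^ k mod q))"] by simp
  also have "(\<Sum>k<n. (cmod (of_real (B (g ^ k mod q))))\<^sup>2) = (\<Sum>k<n. (B (g ^ k mod q))\<^sup>2)"
    by simp
  also have "\<dots> = (\<Sum>r\<in>{1..n}. (B r)\<^sup>2)"
    by (rule sum_even_fold[of "\<lambda>r. (B r)\<^sup>2"]) (simp add: B_def add.commute)
  finally show ?thesis .
qed

text \<open>Among the positive integers congruent to r or -r only r itself lies below q / 2; the
  others form two progressions covered by \<open>uK_progression\<close>.\<close>

lemma B_approx: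
  assumes r: "r \<in> {1..n}"
  shows "\<bar>B r - uK K r\<bar> \<le> 4 * U / real q"
proof -
  have q2: "real q \<ge> 2" using q_gt by simp
  have half: "real r \<le> real q / 2" using r n_le(1) by simp
  have 1: "Ur r - uK K r = (\<Sum>j. uK K (r + Suc j * q))"
    using suminf_split_head[OF sums_summable[OF Ur_sums[of r]]] by (simp add: Ur_def)
  have "\<bar>\<Sum>j. uK K (r + Suc j * q)\<bar> \<le> 2 * U / real q"
  proof (rule uK_progression(2)[OF y q2])
    fix j
    have "real (Suc j) * (real q / 2) \<le> real (Suc j) * real q" by (intro mult_left_mono) auto
    also have "\<dots> \<le> real (r + Suc j * q)" unfolding of_nat_add of_nat_mult by (simp add: algebra_simps)
    finally show "real (Suc j) * (real q / 2) \<le> real (r + Suc j * q)" .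
  qed
  moreover have "\<bar>Ur (q - r)\<bar> \<le> 2 * U / real q"
    unfolding Ur_def
  proof (rule uK_progression(2)[OF y q2])
    fix j
    have "real (Suc j) * (real q / 2) \<le> real q / 2 + real j * real q"
      by (simp add: algebra_simps)
    also have "\<dots> \<le> (real q - real r) + real j * real q" using half by simp
    also have "\<dots> = real (q - r + j * q)" using half q2 by (subst of_nat_add) (simp add: of_nat_diff)
    finally show "real (Suc j) * (real q / 2) \<le> real (q - r + j * q)" .
  qed
  moreover have "B r - uK K r = (Ur r - uK K r) + Ur (q - r)" by (simp add: B_def)
  ultimately show ?thesis unfolding 1 by linarith
qed

lemma sum_uK_le: "(\<Sum>r\<in>{1..n}. \<bar>uK K r\<bar>) \<le> U"
proof -
  have "(\<Sum>r\<in>{1..n}. \<bar>uK K r\<bar>) \<le> (\<Sum>m. \<bar>uK K m\<bar>)"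
    by (rule sum_le_suminf[OF uK_summable[OF y]]) auto
  also have "\<dots> \<le> U" by (rule uK_sum_le[OF y])
  finally show ?thesis .
qed

text \<open>Each square changes by at most T (2 |uK| + T). The l1 part sums to at most 2U and n T is
  at most 2U, so the total is at most n T * 4U \<le> 8U^2.\<close>

lemma B_square_sum: "\<bar>real n * (\<Sum>r\<in>{1..n}. (B r)\<^sup>2) - real n * (\<Sum>r\<in>{1..n}. (uK K r)\<^sup>2)\<bar> \<le> 8 * U\<^sup>2"
proof -
  define T where "T = 4 * U / real q"
  have q0: "real q > 0" using q_pos by simp
  have U1: "U \<ge> 1" by (rule UB_ge[OF y])
  have T0: "T \<ge> 0" using U1 by (simp add: T_def)
  have nT: "real n * T \<le> 2 * U"
  proof -
    have "real n * T \<le> real q / 2 * T" by (rule mult_right_mono[OF n_le(1) T0])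
    also have "\<dots> = 2 * U" using q0 by (simp add: T_def)
    finally show ?thesis .
  qed
  have "\<bar>(\<Sum>r\<in>{1..n}. (B r)\<^sup>2) - (\<Sum>r\<in>{1..n}. (uK K r)\<^sup>2)\<bar> \<le> (\<Sum>r\<in>{1..n}. \<bar>(B r)\<^sup>2 - (uK K r)\<^sup>2\<bar>)"
    unfolding sum_subtractf[symmetric] by (rule sum_abs)
  also have "\<dots> \<le> (\<Sum>r\<in>{1..n}. T * (2 * \<bar>uK K r\<bar> + T))"
  proof (rule sum_mono)
    fix r assume r: "r \<in> {1..n}"
    have "\<bar>(B r)\<^sup>2 - (uK K r)\<^sup>2\<bar> \<le> \<bar>B r - uK K r\<bar> * (2 * \<bar>uK K r\<bar> + \<bar>B r - uK K r\<bar>)"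
      using norm_square_diff_le[of "B r" "uK K r"] by simp
    also have "\<dots> \<le> T * (2 * \<bar>uK K r\<bar> + T)"
      using B_approx[OF r] T0 unfolding T_def[symmetric] by (intro mult_mono) auto
    finally show "\<bar>(B r)\<^sup>2 - (uK K r)\<^sup>2\<bar> \<le> T * (2 * \<bar>uK K r\<bar> + T)" .
  qed
  also have "\<dots> = T * (2 * (\<Sum>r\<in>{1..n}. \<bar>uK K r\<bar>) + real n * T)"
    by (simp add: sum_distrib_left[symmetric] sum.distrib)
  also have "\<dots> \<le> T * (2 * U + 2 * U)"
    using sum_uK_le nT T0 by (intro mult_left_mono add_mono) auto
  finally have "real n * \<bar>(\<Sum>r\<in>{1..n}. (B r)\<^sup>2) - (\<Sum>r\<in>{1..n}. (uK K r)\<^sup>2)\<bar> \<le> real n * (T * (2 * U + 2 * U))"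
    by (intro mult_left_mono) auto
  also have "\<dots> = (real n * T) * (4 * U)" by simp
  also have "\<dots> \<le> (2 * U) * (4 * U)" using nT U1 by (intro mult_right_mono) auto
  finally show ?thesis by (simp add: right_diff_distrib[symmetric] abs_mult power2_eq_square)
qed

text \<open>Two errors of at most 1 each: the tail of the full series beyond n, and the defect 1 -
  wt^2 of the weights up to n. The defect is at most 2 q (4/5)^K per term; n terms and the outer
  factor n account for q^3 in the hypothesis.\<close>

lemma uK_square_sum:
  assumes K: "real q ^ 3 * (4/5) ^ K \<le> 1"
  shows "\<bar>real n * (\<Sum>r\<in>{1..n}. (uK K r)\<^sup>2) - real n * (rzeta 2 / rzeta 4)\<bar> \<le> 2"
proof -
  define f where "f r = (mob r)\<^sup>2 / (real r)\<^sup>2" for r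
  have q1: "real q \<ge> 1" using q_pos by simp
  have f0: "f r \<ge> 0" for r by (simp add: f_def)
  have mob2: "(mob r)\<^sup>2 \<le> 1" for r using abs_mob_le[of r] by (simp add: abs_square_le_1)
  have s: "f sums (rzeta 2 / rzeta 4)" unfolding f_def by (rule mob_square_sums)
  have sp: "rzeta 2 / rzeta 4 = (\<Sum>j. f (j + Suc n)) + (\<Sum>r<Suc n. f r)"
    using suminf_split_initial_segment[OF sums_summable[OF s], of "Suc n"] s by (simp add: sums_iff)
  have "{..<Suc n} = insert 0 {1..n}" by auto
  then have fs: "(\<Sum>r<Suc n. f r) = (\<Sum>r\<in>{1..n}. f r)" by (simp add: f_def)
  have smt: "summable (\<lambda>j. f (j + Suc n))" by (rule summable_ignore_initial_segment[OF sums_summable[OF s]])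
  have t0: "0 \<le> (\<Sum>j. f (j + Suc n))" by (rule suminf_nonneg[OF smt f0])
  have "(\<Sum>j. f (j + Suc n)) \<le> (\<Sum>j. 1 / (real (j + Suc n))\<^sup>2)"
    by (rule suminf_le[OF _ smt inverse_squares_tail(1)[OF n_pos]])
       (unfold f_def, intro divide_right_mono mob2, simp)
  also have "\<dots> \<le> 1 / real n" by (rule inverse_squares_tail(2)[OF n_pos])
  finally have t1: "real n * (\<Sum>j. f (j + Suc n)) \<le> 1" using n_pos by (simp add: field_simps)
  have d: "0 \<le> f r - (uK K r)\<^sup>2 \<and> f r - (uK K r)\<^sup>2 \<le> 2 * (real q * (4/5) ^ K)" if r: "r \<in> {1..n}" for r
  proof -
    let ?w = "wt K r"
    have w: "0 \<le> ?w" "?w \<le> 1" by (rule wt_nonneg, rule wt_le_1)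
    have eq: "f r - (uK K r)\<^sup>2 = f r * (1 - ?w\<^sup>2)"
      by (simp add: f_def uK_def power_mult_distrib power_divide right_diff_distrib)
    have w2: "0 \<le> 1 - ?w\<^sup>2" using w by (simp add: power_le_one)
    have "1 - ?w\<^sup>2 = (1 - ?w) * (1 + ?w)" by (simp add: power2_eq_square algebra_simps)
    also have "\<dots> \<le> (1 - ?w) * 2" using w by (intro mult_left_mono) auto
    also have "1 - ?w \<le> real q * (4/5) ^ K"
    proof -
      have "1 - ?w \<le> real r powr (5/4 - 1) / (5/4) ^ K"
        by (rule one_minus_wt_le) (use r in auto)
      also have "\<dots> \<le> real q / (5/4) ^ K"
      proof (rule divide_right_mono)
        have "real r powr (5/4 - 1) \<le> real r powr 1" using r by (intro powr_mono) auto
        also have "\<dots> \<le> real q" using r n_le by simp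
        finally show "real r powr (5/4 - 1) \<le> real q" .
      qed simp
      also have "\<dots> = real q * (4/5) ^ K" by (simp add: power_divide)
      finally show ?thesis .
    qed
    finally have w3: "1 - ?w\<^sup>2 \<le> 2 * (real q * (4/5) ^ K)" by simp
    have "f r \<le> 1"
    proof -
      have "(mob r)\<^sup>2 / (real r)\<^sup>2 \<le> 1 / 1"
        using r by (intro frac_le mob2) (auto simp: one_le_power)
      then show ?thesis by (simp add: f_def)
    qed
    then have "f r * (1 - ?w\<^sup>2) \<le> 1 * (1 - ?w\<^sup>2)" using w2 by (intro mult_right_mono)
    then show ?thesis unfolding eq using f0[of r] w2 w3 by auto
  qed
  have d0: "0 \<le> (\<Sum>r\<in>{1..n}. f r - (uK K r)\<^sup>2)" by (rule sum_nonneg) (use d in auto)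
  have "(\<Sum>r\<in>{1..n}. f r - (uK K r)\<^sup>2) \<le> (\<Sum>r\<in>{1..n}. 2 * (real q * (4/5) ^ K))"
    by (rule sum_mono) (use d in auto)
  also have "\<dots> = 2 * real n * real q * (4/5) ^ K" by simp
  finally have "real n * (\<Sum>r\<in>{1..n}. f r - (uK K r)\<^sup>2) \<le> real n * (2 * real n * real q * (4/5) ^ K)"
    by (intro mult_left_mono) auto
  also have "\<dots> \<le> (real q / 2) * (2 * (real q / 2) * real q * (4/5) ^ K)"
    using n_le q1 by (intro mult_mono mult_right_mono mult_left_mono) auto
  also have "\<dots> = (real q ^ 3 * (4/5) ^ K) / 2" by (simp add: power3_eq_cube)
  also have "\<dots> \<le> 1" using K by simp
  finally have d1: "real n * (\<Sum>r\<in>{1..n}. f r - (uK K r)\<^sup>2) \<le> 1" .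
  have "real n * (rzeta 2 / rzeta 4) - real n * (\<Sum>r\<in>{1..n}. (uK K r)\<^sup>2)
      = real n * (\<Sum>j. f (j + Suc n)) + real n * (\<Sum>r\<in>{1..n}. f r - (uK K r)\<^sup>2)"
    unfolding sp fs sum_subtractf by (simp add: algebra_simps)
  moreover have "0 \<le> real n * (\<Sum>j. f (j + Suc n))" "0 \<le> real n * (\<Sum>r\<in>{1..n}. f r - (uK K r)\<^sup>2)"
    using t0 d0 by auto
  ultimately show ?thesis using t1 d1 by linarith
qed

text \<open>14 = 3 + 1 + 8 + 2: replacing 1/L by the short sum, dropping a = 0, passing from
  \<open>B\<close> to \<open>uK\<close>, and completing the diagonal.\<close>

lemma L_mean_square:
  assumes GRH and K1: "real q ^ 3 * (4/5) ^ K \<le> 1" and K2: "(real q)\<^sup>2 * (5 * Bq q * (4/5) ^ K) \<le> 1"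
  shows "\<bar>(\<Sum>a\<in>{1..<n}. (cmod (inverse (np_char.L q (X a) 1)))\<^sup>2) - real n * (rzeta 2 / rzeta 4)\<bar> \<le> 14 * U\<^sup>2"
proof -
  define I where "I a = inverse (np_char.L q (X a) 1)" for a
  have q1: "real q \<ge> 1" using q_pos by simp
  have U1: "U \<ge> 1" by (rule UB_ge[OF y])
  have U2: "1 \<le> U\<^sup>2" "U \<le> U\<^sup>2"
    using one_le_power[OF U1, of 2] mult_left_mono[OF U1, of U] U1 by (auto simp: power2_eq_square)
  have E: "cmod (I a - Pv a) \<le> 1 / (real q)\<^sup>2" if a: "a \<in> {1..<n}" for a
  proof -
    obtain P where P: "(\<lambda>m. X a m * of_real (uK K m)) sums P" "cmod (I a - P) \<le> 5 * Bq q * (4/5) ^ K"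
      using np_char.inverse_L_approx[OF X_np_char[OF a] \<open>GRH\<close>] unfolding I_def by metis
    have "P = Pv a" using sums_unique2[OF P(1) Pv_sums] .
    moreover have "5 * Bq q * (4/5) ^ K \<le> 1 / (real q)\<^sup>2"
      using K2 q1 by (simp add: pos_le_divide_eq mult.commute)
    ultimately show ?thesis using P(2) by simp
  qed
  have "\<bar>(\<Sum>a\<in>{1..<n}. (cmod (I a))\<^sup>2) - (\<Sum>a\<in>{1..<n}. (cmod (Pv a))\<^sup>2)\<bar> \<le> (\<Sum>a\<in>{1..<n}. \<bar>(cmod (I a))\<^sup>2 - (cmod (Pv a))\<^sup>2\<bar>)"
    unfolding sum_subtractf[symmetric] by (rule sum_abs)
  also have "\<dots> \<le> (\<Sum>a\<in>{1..<n}. 1 / (real q)\<^sup>2 * (2 * U + 1))"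
  proof (rule sum_mono)
    fix a assume a: "a \<in> {1..<n}"
    have "1 \<le> (real q)\<^sup>2" using q1 by (simp add: one_le_power)
    then have q2: "1 / (real q)\<^sup>2 \<le> 1" unfolding divide_le_eq_1 by (intro disjI1 conjI) linarith+
    have "\<bar>(cmod (I a))\<^sup>2 - (cmod (Pv a))\<^sup>2\<bar> \<le> cmod (I a - Pv a) * (2 * cmod (Pv a) + cmod (I a - Pv a))"
      by (rule norm_square_diff_le)
    also have "\<dots> \<le> 1 / (real q)\<^sup>2 * (2 * U + 1)"
      using E[OF a] Pv_le[of a] q2 by (intro mult_mono add_mono) auto
    finally show "\<bar>(cmod (I a))\<^sup>2 - (cmod (Pv a))\<^sup>2\<bar> \<le> 1 / (real q)\<^sup>2 * (2 * U + 1)" .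
  qed
  also have "\<dots> \<le> real n * (1 / (real q)\<^sup>2 * (2 * U + 1))"
    unfolding sum_constant by (rule mult_right_mono) (use U1 in auto)
  also have "\<dots> = (real n / (real q)\<^sup>2) * (2 * U + 1)" by simp
  also have "\<dots> \<le> 1 * (2 * U + 1)"
  proof (rule mult_right_mono)
    have "real n \<le> real q * real q" using n_le q1 mult_mono[of 1 "real q" "real n" "real q"] by auto
    then show "real n / (real q)\<^sup>2 \<le> 1" using q1 by (simp add: power2_eq_square)
  qed (use U1 in simp)
  also have "\<dots> \<le> 3 * U\<^sup>2" using U2 by simp
  finally have 1: "\<bar>(\<Sum>a\<in>{1..<n}. (cmod (I a))\<^sup>2) - (\<Sum>a\<in>{1..<n}. (cmod (Pv a))\<^sup>2)\<bar> \<le> 3 * U\<^sup>2" .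
  have "{..<n} = insert 0 {1..<n}" using n_pos by auto
  then have "(\<Sum>a<n. (cmod (Pv a))\<^sup>2) = (cmod (Pv 0))\<^sup>2 + (\<Sum>a\<in>{1..<n}. (cmod (Pv a))\<^sup>2)" by simp
  moreover have "(cmod (Pv 0))\<^sup>2 \<le> U\<^sup>2" by (intro power_mono Pv_le) auto
  ultimately have 2: "\<bar>(\<Sum>a\<in>{1..<n}. (cmod (Pv a))\<^sup>2) - real n * (\<Sum>r\<in>{1..n}. (B r)\<^sup>2)\<bar> \<le> U\<^sup>2"
    unfolding Pv_parseval[symmetric] by simp
  show ?thesis
    unfolding I_def[symmetric] using 1 2 B_square_sum uK_square_sum[OF K1] U2 by linarith
qed

end

end

text \<open>K is the least number with (5/4)^K \<ge> M = \<beta> q^22, where q^20 comes from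
  \<open>Bq\<close> and q^2 from the precision required. The loss y^(-2K) is at most exp (2\<eta>)
  times M to the power 2\<eta> / ln (5/4) = \<epsilon> / 22, a constant times q^\<epsilon>; this
  fixes the 44 in \<eta>. Finally 168 = 4 * 3 * 14, the 3 coming from q \<le> 3n.\<close>

lemma (in odd_prime_root) dual_norm_asymptotic:
  assumes GRH and \<epsilon>: "\<epsilon> > 0"
  defines "\<eta> \<equiv> \<epsilon> * ln (5/4) / 44"
  defines "\<beta> \<equiv> 5 * Z2 * (2 * Z2 * C0) ^ 20"
  defines "Cv \<equiv> exp (2 * \<eta> + \<epsilon> / 22 * ln \<beta>) * (Zy (exp (- \<eta>)))\<^sup>2"
  shows "\<bar>cyc.C 0 - (4 * rzeta 2 / rzeta 4) / real q\<bar> \<le> 168 * Cv * (1 / real q) * real q powr (- 1 + \<epsilon>)"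
proof -
  have l54: "ln (5/4 :: real) > 0" by simp
  have \<eta>: "\<eta> > 0" unfolding \<eta>_def using \<epsilon> l54 by simp
  define y where "y = exp (- \<eta>)"
  have y: "0 < y" "y < 1" using \<eta> by (auto simp: y_def)
  have q1: "real q \<ge> 1" using q_pos by simp
  have q0: "real q > 0" using q_pos by simp
  have "1 * 1 \<le> Z2 * C0" using Z2_ge C0_ge by (intro mult_mono) auto
  then have zc: "1 \<le> 2 * Z2 * C0" by simp
  then have "1 \<le> (2 * Z2 * C0) ^ 20" by (rule one_le_power)
  then have "1 * 1 \<le> (5 * Z2) * (2 * Z2 * C0) ^ 20" using Z2_ge by (intro mult_mono) auto
  then have \<beta>: "\<beta> \<ge> 1" by (simp add: \<beta>_def)
  define M where "M = \<beta> * real q ^ 22"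
  have M1: "M \<ge> 1" unfolding M_def using \<beta> one_le_power[OF q1, of 22] mult_mono[of 1 \<beta> 1 "real q ^ 22"] by simp
  have lnM: "ln M = ln \<beta> + 22 * ln (real q)"
    unfolding M_def using \<beta> q0 by (simp add: ln_mult ln_realpow)
  define K where "K = nat \<lceil>ln M / ln (5/4)\<rceil>"
  have K1: "ln M / ln (5/4) \<le> real K" "real K \<le> ln M / ln (5/4) + 1"
  proof -
    have "0 \<le> ln M / ln (5/4)" using M1 l54 by (intro divide_nonneg_nonneg) auto
    then have "0 \<le> \<lceil>ln M / ln (5/4)\<rceil>" by linarith
    then show "ln M / ln (5/4) \<le> real K" "real K \<le> ln M / ln (5/4) + 1"
      unfolding K_def by linarith+
  qed
  have MK: "M * (4/5) ^ K \<le> 1"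
  proof -
    have "ln M \<le> real K * ln (5/4)" using K1(1) l54 by (simp add: pos_divide_le_eq)
    also have "\<dots> = ln ((5/4) ^ K)" by (simp add: ln_realpow)
    finally have "M \<le> (5/4) ^ K" using M1 by (subst (asm) ln_le_cancel_iff) auto
    then have "M * (4/5) ^ K \<le> (5/4) ^ K * (4/5) ^ K" by (intro mult_right_mono) auto
    also have "\<dots> = 1" by (simp flip: power_mult_distrib)
    finally show ?thesis .
  qed
  have c1: "real q ^ 3 * (4/5) ^ K \<le> 1"
  proof -
    have "1 * real q ^ 3 \<le> M" unfolding M_def using \<beta> q1 by (intro mult_mono power_increasing) auto
    then have "real q ^ 3 * (4/5) ^ K \<le> M * (4/5) ^ K" by (intro mult_right_mono) auto
    with MK show ?thesis by linarith
  qed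
  have "(real q)\<^sup>2 * (5 * Bq q * (4/5) ^ K) = M * (4/5) ^ K"
    unfolding M_def Bq_def \<beta>_def power_mult_distrib by (simp add: power_add[symmetric])
  then have c2: "(real q)\<^sup>2 * (5 * Bq q * (4/5) ^ K) \<le> 1" using MK by (simp only:)
  define S where "S = (\<Sum>a\<in>{1..<n}. (cmod (inverse (np_char.L q (X a) 1)))\<^sup>2)"
  have mean: "\<bar>S - real n * (rzeta 2 / rzeta 4)\<bar> \<le> 14 * (UB y K)\<^sup>2"
    unfolding S_def by (rule L_mean_square[OF y \<open>GRH\<close> c1 c2])
  have UB: "(UB y K)\<^sup>2 \<le> Cv * real q powr \<epsilon>"
  proof -
    have "y ^ K = exp (- (\<eta> * real K))" unfolding y_def by (simp add: exp_of_nat_mult[symmetric] mult.commute)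
    then have "UB y K = Zy y * exp (\<eta> * real K)"
      unfolding UB_def[OF y] by (simp add: exp_minus divide_inverse)
    then have "(UB y K)\<^sup>2 = (Zy y)\<^sup>2 * exp (2 * (\<eta> * real K))"
      by (simp add: power_mult_distrib exp_double)
    also have "\<dots> \<le> (Zy y)\<^sup>2 * exp (2 * \<eta> + \<epsilon> / 22 * ln \<beta> + \<epsilon> * ln (real q))"
    proof (intro mult_left_mono)
      have "2 * (\<eta> * real K) \<le> 2 * (\<eta> * (ln M / ln (5/4) + 1))"
        using K1(2) \<eta> by (intro mult_left_mono) auto
      also have "\<dots> = 2 * \<eta> + \<epsilon> / 22 * ln M"
        unfolding \<eta>_def using l54 by (simp add: field_simps)
      also have "\<dots> = 2 * \<eta> + \<epsilon> / 22 * ln \<beta> + \<epsilon> * ln (real q)"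
        unfolding lnM by (simp add: field_simps)
      finally show "exp (2 * (\<eta> * real K)) \<le> exp (2 * \<eta> + \<epsilon> / 22 * ln \<beta> + \<epsilon> * ln (real q))" by simp
    qed simp
    also have "\<dots> = Cv * real q powr \<epsilon>"
      unfolding Cv_def y_def exp_add using q0 by (simp add: powr_def)
    finally show ?thesis .
  qed
  have n0: "real n > 0" using n_pos by simp
  have "cyc.C 0 - (4 * rzeta 2 / rzeta 4) / real q = 4 / (real q * real n) * (S - real n * (rzeta 2 / rzeta 4))"
    unfolding C_0_eq S_def[symmetric] using n0 q0 by (simp add: field_simps)
  then have "\<bar>cyc.C 0 - (4 * rzeta 2 / rzeta 4) / real q\<bar> = 4 / (real q * real n) * \<bar>S - real n * (rzeta 2 / rzeta 4)\<bar>"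
    by (simp only: abs_mult) simp
  also have "\<dots> \<le> 4 / (real q * (real q / 3)) * (14 * (Cv * real q powr \<epsilon>))"
  proof (intro mult_mono)
    show "4 / (real q * real n) \<le> 4 / (real q * (real q / 3))"
      using n_le(2) n0 q0 by (intro divide_left_mono mult_left_mono) auto
    show "\<bar>S - real n * (rzeta 2 / rzeta 4)\<bar> \<le> 14 * (Cv * real q powr \<epsilon>)"
      using mean UB by linarith
  qed (use q0 in auto)
  also have "\<dots> = 168 * Cv * (1 / real q) * (real q powr \<epsilon> / real q)"
    by (simp add: field_simps)
  also have "real q powr \<epsilon> / real q = real q powr (- 1 + \<epsilon>)"
    using q0 by (simp add: powr_diff add.commute[of "-1"])
  finally show ?thesis .
qed

theorem theorem3p1:
  shows "(\<forall>q R. prime q \<and> odd q \<and> reps q R \<longrightarrow>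
            (\<exists>v. dual_basis q R v) \<and>
            (\<forall>v. dual_basis q R v \<longrightarrow>
               (\<forall>j\<in>R - {1}. \<forall>j'\<in>R - {1}. innerG R (v j) (v j) = innerG R (v j') (v j')))) \<and>
         (GRH \<longrightarrow>
           (\<forall>\<epsilon>::real. \<epsilon> > 0 \<longrightarrow>
             (\<exists>C Q. \<forall>q R v. prime q \<and> odd q \<and> q \<ge> Q \<and> reps q R \<and> dual_basis q R v \<longrightarrow>
               (\<forall>j\<in>R - {1}.
                  \<bar>innerG R (v j) (v j) - (4 * rzeta 2 / rzeta 4) / real q\<bar>
                    \<le> C * (1 / real q) * real q powr (-1 + \<epsilon>)))))"
proof -
  have ex: "\<exists>g. odd_prime_root q g" if q: "prime q" "odd q" for q
    using prime_primitive_root_exists[OF prime_gt_1_nat q(1)] q by (auto simp: odd_prime_root_def)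
  show ?thesis
  proof (intro conjI allI impI ballI, goal_cases)
    case (1 q R)
    then obtain g where "odd_prime_root q g" using ex by blast
    then interpret odd_prime_root q g .
    show ?case using v0_dual 1 by blast
  next
    case (2 q R v j j')
    then obtain g where "odd_prime_root q g" using ex by blast
    then interpret odd_prime_root q g .
    show ?case using dual_basis_norm[of R v] 2 by simp
  next
    case (3 \<epsilon>)
    define C where "C = 168 * (exp (2 * (\<epsilon> * ln (5/4) / 44) + \<epsilon> / 22 * ln (5 * Z2 * (2 * Z2 * C0) ^ 20)) *
      (Zy (exp (- (\<epsilon> * ln (5/4) / 44))))\<^sup>2)"
    \<comment> \<open>The constant depends on \<epsilon> alone and the estimate holds for every odd
      prime, so 0 serves as the threshold.\<close>
    have "\<forall>q R v. prime q \<and> odd q \<and> q \<ge> 0 \<and> reps q R \<and> dual_basis q R v \<longrightarrow>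
               (\<forall>j\<in>R - {1}.
                  \<bar>innerG R (v j) (v j) - (4 * rzeta 2 / rzeta 4) / real q\<bar>
                    \<le> C * (1 / real q) * real q powr (-1 + \<epsilon>))"
    proof (intro allI impI ballI)
      fix q R v j
      assume a: "prime q \<and> odd q \<and> q \<ge> 0 \<and> reps q R \<and> dual_basis q R v" and j: "j \<in> R - {1}"
      then obtain g where "odd_prime_root q g" using ex by blast
      then interpret odd_prime_root q g .
      show "\<bar>innerG R (v j) (v j) - (4 * rzeta 2 / rzeta 4) / real q\<bar> \<le> C * (1 / real q) * real q powr (-1 + \<epsilon>)"
        using dual_norm_asymptotic[OF 3] dual_basis_norm[of R v j] a j unfolding C_def by simp
    qed
    then show ?case by blast
  qed
qed

end
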